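(* Let $R$ be a Gorenstein (noetherian) local ring, $M$ a finitely generated $R$-module and $i$ any integer. Then $$\bigcup_{p=0}^{\infty}\operatorname{Ass}_R(M_{(i,\ldots,i)p})=\bigcup_{p=0}^{3}\operatorname{Ass}_R(M_{(i,\ldots,i)p}).$$
   Context: $M_{(i,\ldots,i)p}$ denotes the $p$-fold iterated Ext-module $\operatorname{Ext}^{i}_R(\operatorname{Ext}^{i}_R(\cdots\operatorname{Ext}^{i}_R(M,R)\cdots,R),R)$ obtained by applying the functor $\operatorname{Ext}^i_R(-,R)$ $p$ times to $M$; for $p=0$ it is $M$ itself. $\operatorname{Ext}^i_R=0$ for $i<0$. *)

theory Defs
  imports "HOL-Algebra.Ring_Divisibility"
begin

text \<open>
  Modules are the records of \<^theory>\<open>HOL-Algebra.Module\<close>.  These extend ring records, but the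
  locale \<^locale>\<open>module\<close> puts no condition on the fields \<open>mult\<close> and \<open>one\<close> of the module, so they
  are left undefined below.
\<close>

section \<open>Modules\<close>

definition self_module :: "('a, 'm) ring_scheme \<Rightarrow> ('a, 'a) module" where
  "self_module R =
     \<lparr>carrier = carrier R, mult = mult R, one = one R, zero = zero R, add = add R,
      smult = mult R\<rparr>"

text \<open>\<open>R\<^sup>n\<close>, as the functions \<open>{..<n} \<rightarrow> R\<close>.\<close>

definition free_module :: "('a, 'm) ring_scheme \<Rightarrow> nat \<Rightarrow> ('a, nat \<Rightarrow> 'a) module" where
  "free_module R n =
     \<lparr>carrier = {..<n} \<rightarrow>\<^sub>E carrier R, mult = undefined, one = undefined,
      zero = (\<lambda>k\<in>{..<n}. \<zero>\<^bsub>R\<^esub>),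
      add = (\<lambda>x y. \<lambda>k\<in>{..<n}. x k \<oplus>\<^bsub>R\<^esub> y k),
      smult = (\<lambda>a x. \<lambda>k\<in>{..<n}. a \<otimes>\<^bsub>R\<^esub> x k)\<rparr>"

definition module_hom ::
  "('a, 'm) ring_scheme \<Rightarrow> ('a, 'b, 'n) module_scheme \<Rightarrow> ('a, 'c, 'k) module_scheme \<Rightarrow> ('b \<Rightarrow> 'c) set"
where
  "module_hom R M N =
     {f \<in> carrier M \<rightarrow>\<^sub>E carrier N.
        (\<forall>x\<in>carrier M. \<forall>y\<in>carrier M. f (x \<oplus>\<^bsub>M\<^esub> y) = f x \<oplus>\<^bsub>N\<^esub> f y) \<and>
        (\<forall>a\<in>carrier R. \<forall>x\<in>carrier M. f (a \<odot>\<^bsub>M\<^esub> x) = a \<odot>\<^bsub>N\<^esub> f x)}"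

definition hom_module ::
  "('a, 'm) ring_scheme \<Rightarrow> ('a, 'b, 'n) module_scheme \<Rightarrow> ('a, 'c, 'k) module_scheme
    \<Rightarrow> ('a, 'b \<Rightarrow> 'c) module"
where
  "hom_module R M N =
     \<lparr>carrier = module_hom R M N, mult = undefined, one = undefined,
      zero = (\<lambda>x\<in>carrier M. \<zero>\<^bsub>N\<^esub>),
      add = (\<lambda>f g. \<lambda>x\<in>carrier M. f x \<oplus>\<^bsub>N\<^esub> g x),
      smult = (\<lambda>a f. \<lambda>x\<in>carrier M. a \<odot>\<^bsub>N\<^esub> f x)\<rparr>"

definition quotient_module ::
  "('a, 'b, 'n) module_scheme \<Rightarrow> 'b set \<Rightarrow> ('a, 'b set) module"
where
  "quotient_module M H =
     \<lparr>carrier = a_rcosets\<^bsub>M\<^esub> H, mult = undefined, one = undefined,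
      zero = H, add = set_add M,
      smult = (\<lambda>a X. \<Union>x\<in>X. H +>\<^bsub>M\<^esub> (a \<odot>\<^bsub>M\<^esub> x))\<rparr>"

definition finitely_generated_module ::
  "('a, 'm) ring_scheme \<Rightarrow> ('a, 'b, 'n) module_scheme \<Rightarrow> bool"
where
  "finitely_generated_module R M \<longleftrightarrow>
     module R M \<and>
     (\<exists>A. finite A \<and> A \<subseteq> carrier M \<and>
        (\<forall>x\<in>carrier M. \<exists>c\<in>A \<rightarrow> carrier R. x = (\<Oplus>\<^bsub>M\<^esub>a\<in>A. c a \<odot>\<^bsub>M\<^esub> a)))"

definition Ass ::
  "('a, 'm) ring_scheme \<Rightarrow> ('a, 'b, 'n) module_scheme \<Rightarrow> 'a set set"
where
  "Ass R M =
     {P. primeideal P R \<and> (\<exists>x\<in>carrier M. P = {a \<in> carrier R. a \<odot>\<^bsub>M\<^esub> x = \<zero>\<^bsub>M\<^esub>})}"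


section \<open>Ext\<close>

text \<open>
  A resolution \<open>\<dots> \<rightarrow> R\<^bsup>n 2\<^esup> \<rightarrow> R\<^bsup>n 1\<^esup> \<rightarrow> R\<^bsup>n 0\<^esup> \<rightarrow> M \<rightarrow> 0\<close> by free modules of finite rank, with
  \<open>d j : R\<^bsup>n (j + 1)\<^esup> \<rightarrow> R\<^bsup>n j\<^esup>\<close> and augmentation \<open>e\<close>.  Every finitely generated module over a
  noetherian ring has one.
\<close>

definition free_resolution ::
  "('a, 'm) ring_scheme \<Rightarrow> ('a, 'b, 'n) module_scheme
    \<Rightarrow> (nat \<Rightarrow> nat) \<Rightarrow> (nat \<Rightarrow> (nat \<Rightarrow> 'a) \<Rightarrow> (nat \<Rightarrow> 'a)) \<Rightarrow> ((nat \<Rightarrow> 'a) \<Rightarrow> 'b) \<Rightarrow> bool"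
where
  "free_resolution R M n d e \<longleftrightarrow>
     e \<in> module_hom R (free_module R (n 0)) M \<and>
     (\<forall>j. d j \<in> module_hom R (free_module R (n (Suc j))) (free_module R (n j))) \<and>
     e ` carrier (free_module R (n 0)) = carrier M \<and>
     d 0 ` carrier (free_module R (n 1)) = a_kernel (free_module R (n 0)) M e \<and>
     (\<forall>j. d (Suc j) ` carrier (free_module R (n (Suc (Suc j)))) =
          a_kernel (free_module R (n (Suc j))) (free_module R (n j)) (d j))"

text \<open>
  The complex \<open>0 \<rightarrow> Hom(R\<^bsup>n 0\<^esup>, N) \<rightarrow> Hom(R\<^bsup>n 1\<^esup>, N) \<rightarrow> \<dots>\<close>, whose differentials are composition
  with the \<open>d j\<close>, and its cohomology.
\<close>

definition hom_complex ::
  "('a, 'm) ring_scheme \<Rightarrow> ('a, 'c, 'k) module_scheme \<Rightarrow> (nat \<Rightarrow> nat)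
    \<Rightarrow> nat \<Rightarrow> ('a, (nat \<Rightarrow> 'a) \<Rightarrow> 'c) module"
where
  "hom_complex R N n j = hom_module R (free_module R (n j)) N"

definition hom_diff ::
  "('a, 'm) ring_scheme \<Rightarrow> (nat \<Rightarrow> nat) \<Rightarrow> (nat \<Rightarrow> (nat \<Rightarrow> 'a) \<Rightarrow> (nat \<Rightarrow> 'a))
    \<Rightarrow> nat \<Rightarrow> ((nat \<Rightarrow> 'a) \<Rightarrow> 'c) \<Rightarrow> ((nat \<Rightarrow> 'a) \<Rightarrow> 'c)"
where
  "hom_diff R n d j f = compose (carrier (free_module R (n (Suc j)))) f (d j)"

definition cocycles ::
  "('a, 'm) ring_scheme \<Rightarrow> ('a, 'c, 'k) module_scheme \<Rightarrow> (nat \<Rightarrow> nat)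
    \<Rightarrow> (nat \<Rightarrow> (nat \<Rightarrow> 'a) \<Rightarrow> (nat \<Rightarrow> 'a)) \<Rightarrow> nat \<Rightarrow> ((nat \<Rightarrow> 'a) \<Rightarrow> 'c) set"
where
  "cocycles R N n d j =
     a_kernel (hom_complex R N n j) (hom_complex R N n (Suc j)) (hom_diff R n d j)"

definition coboundaries ::
  "('a, 'm) ring_scheme \<Rightarrow> ('a, 'c, 'k) module_scheme \<Rightarrow> (nat \<Rightarrow> nat)
    \<Rightarrow> (nat \<Rightarrow> (nat \<Rightarrow> 'a) \<Rightarrow> (nat \<Rightarrow> 'a)) \<Rightarrow> nat \<Rightarrow> ((nat \<Rightarrow> 'a) \<Rightarrow> 'c) set"
where
  "coboundaries R N n d j =
     (case j of
        0 \<Rightarrow> {\<zero>\<^bsub>hom_complex R N n 0\<^esub>}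
      | Suc k \<Rightarrow> hom_diff R n d k ` carrier (hom_complex R N n k))"

definition hom_cohomology ::
  "('a, 'm) ring_scheme \<Rightarrow> ('a, 'c, 'k) module_scheme \<Rightarrow> (nat \<Rightarrow> nat)
    \<Rightarrow> (nat \<Rightarrow> (nat \<Rightarrow> 'a) \<Rightarrow> (nat \<Rightarrow> 'a)) \<Rightarrow> nat \<Rightarrow> ('a, ((nat \<Rightarrow> 'a) \<Rightarrow> 'c) set) module"
where
  "hom_cohomology R N n d j =
     quotient_module (hom_complex R N n j\<lparr>carrier := cocycles R N n d j\<rparr>) (coboundaries R N n d j)"

text \<open>
  \<open>Ext\<^sup>i\<^sub>R(M, N)\<close> for finitely generated \<open>M\<close> over a noetherian ring, computed from a chosen free
  resolution of \<open>M\<close>; another choice gives an isomorphic module.  For \<open>i < 0\<close> it is a zero module.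
\<close>

definition Ext ::
  "('a, 'm) ring_scheme \<Rightarrow> int \<Rightarrow> ('a, 'b, 'n) module_scheme \<Rightarrow> ('a, 'c, 'k) module_scheme
    \<Rightarrow> ('a, ((nat \<Rightarrow> 'a) \<Rightarrow> 'c) set) module"
where
  "Ext R i M N =
     (if i < 0
      then \<lparr>carrier = {{}}, mult = undefined, one = undefined, zero = {},
            add = (\<lambda>_ _. {}), smult = (\<lambda>_ _. {})\<rparr>
      else let (n, d) = (SOME (n, d). \<exists>e. free_resolution R M n d e)
           in hom_cohomology R N n d (nat i))"

text \<open>
  \<open>Ass\<^sub>R(M\<^bsub>(i,\<dots>,i)p\<^esub>)\<close>.  The case distinction is due to typing only: \<open>M\<close> itself has elements of an
  arbitrary type, whereas all \<open>Ext\<^sup>i\<^sub>R(-, R)\<close> have elements of one and the same type.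
\<close>

definition Ass_iterated_Ext ::
  "('a, 'm) ring_scheme \<Rightarrow> int \<Rightarrow> ('a, 'b, 'n) module_scheme \<Rightarrow> nat \<Rightarrow> 'a set set"
where
  "Ass_iterated_Ext R i M p =
     (case p of
        0 \<Rightarrow> Ass R M
      | Suc q \<Rightarrow> Ass R (((\<lambda>N. Ext R i N (self_module R)) ^^ q) (Ext R i M (self_module R))))"


section \<open>Gorenstein local rings\<close>

text \<open>
  The test modules \<open>B\<close> have to be taken from some fixed type.  By Baer's criterion it is enough
  that \<open>R\<close> occurs among them, so \<open>nat \<Rightarrow> 'a\<close>, which accommodates all \<open>R\<^sup>n\<close>, gives the usual notion.
\<close>

definition injective_module ::
  "('a, 'm) ring_scheme \<Rightarrow> ('a, 'c, 'n) module_scheme \<Rightarrow> bool"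
where
  "injective_module R I \<longleftrightarrow>
     module R I \<and>
     (\<forall>(B :: ('a, nat \<Rightarrow> 'a) module) A. module R B \<and> submodule A R B \<longrightarrow>
        (\<forall>f\<in>module_hom R (B\<lparr>carrier := A\<rparr>) I. \<exists>g\<in>module_hom R B I. \<forall>x\<in>A. g x = f x))"

text \<open>
  A finite injective resolution \<open>0 \<rightarrow> M \<rightarrow> I 0 \<rightarrow> I 1 \<rightarrow> \<dots> \<rightarrow> I k \<rightarrow> 0\<close>, continued by zero modules.
  The type argument \<open>'c\<close> is where the elements of the injective modules live; a theorem assuming
  this for a type variable \<open>'c\<close> covers injective resolutions of every size.
\<close>

definition finite_injective_dimension ::
  "'c itself \<Rightarrow> ('a, 'm) ring_scheme \<Rightarrow> ('a, 'b, 'n) module_scheme \<Rightarrow> bool"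
where
  "finite_injective_dimension _ R M \<longleftrightarrow>
     (\<exists>(I :: nat \<Rightarrow> ('a, 'c) module) d e k.
        (\<forall>j. injective_module R (I j)) \<and>
        e \<in> module_hom R M (I 0) \<and>
        (\<forall>j. d j \<in> module_hom R (I j) (I (Suc j))) \<and>
        inj_on e (carrier M) \<and>
        e ` carrier M = a_kernel (I 0) (I 1) (d 0) \<and>
        (\<forall>j. d j ` carrier (I j) = a_kernel (I (Suc j)) (I (Suc (Suc j))) (d (Suc j))) \<and>
        (\<forall>j>k. carrier (I j) = {\<zero>\<^bsub>I j\<^esub>}))"

definition local_ring :: "('a, 'm) ring_scheme \<Rightarrow> bool" where
  "local_ring R \<longleftrightarrow> cring R \<and> (\<exists>!\<mm>. maximalideal \<mm> R)"

definition gorenstein_local_ring :: "'c itself \<Rightarrow> ('a, 'm) ring_scheme \<Rightarrow> bool" where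
  "gorenstein_local_ring T R \<longleftrightarrow>
     noetherian_ring R \<and> local_ring R \<and> finite_injective_dimension T R (self_module R)"

end

theory Submission
  imports Defs
begin

text \<open>
  Put \<open>N\<^sub>1 = Ext\<^sup>i(M, R)\<close> and \<open>N\<^sub>p\<^sub>+\<^sub>1 = Ext\<^sup>i(N\<^sub>p, R)\<close>.  The annihilator of \<open>N\<^sub>1\<close> contains a (weakly) regular
  sequence \<open>x\<close> of length \<open>i\<close>.  Any annihilator of \<open>N\<^sub>p\<close> annihilates \<open>N\<^sub>p\<^sub>+\<^sub>1\<close>, so \<open>x\<close> annihilates every
  \<open>N\<^sub>p\<close>, and dimension shifting gives \<open>N\<^sub>p\<^sub>+\<^sub>1 = Hom(N\<^sub>p, R/x)\<close>.  Hence \<open>Ass N\<^sub>p\<^sub>+\<^sub>1\<close> consists of the associated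
  primes of \<open>R/x\<close> that contain the annihilator of \<open>N\<^sub>p\<close>.  As these annihilators increase with \<open>p\<close>, the
  sets \<open>Ass N\<^sub>p\<close> decrease from \<open>p = 2\<close> on.

  If there were no such \<open>x\<close>, prime avoidance would give a regular sequence \<open>y\<close> of length \<open>g < i\<close> in
  the annihilator of \<open>N\<^sub>1\<close> and an associated prime \<open>P\<close> of \<open>R/y\<close> containing that annihilator.  But then
  \<open>Ext\<^sup>i(-, R)\<close> vanishes at \<open>P\<close>, by descending induction on \<open>i > g\<close> starting from the injective
  dimension: for \<open>R/P\<close>, which embeds into \<open>R/y\<close>, because \<open>Ext\<^sup>i(R/y, R) = 0\<close>; for \<open>R/Q\<close> with a
  prime \<open>Q\<close> properly contained in \<open>P\<close> by Nakayama's lemma; and in general by a filtration.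
\<close>

section \<open>Linear maps\<close>

text \<open>The annihilator of M may contain no regular sequence of length i, so R/x does not
  describe Ass N_1, and the decrease starts only at p = 2; one application of Ext^i forces grade at
  least i. Ext is defined by free resolutions of the first argument, whereas the hypothesis on R
  provides an injective resolution of the second. Information therefore travels along a staircase
  through the double complex Hom(F m, I j), in both directions: the finite generation of Ext(R/Q, R)
  that Nakayama's lemma requires comes from the free side, the vanishing above the injective
  dimension from the injective side. Neither localizations nor quotient rings are formed. A
  statement at P asserts the existence of a multiplier t outside P, R/J-valued maps are R-valued
  maps up to J, and Hom(R/J, I) is the part of I killed by J. Long exact sequences appear as
  explicit chases with elements and cocycles.\<close>

definition linear_map ::
  "('a, 'm) ring_scheme \<Rightarrow> ('a, 'b, 'n) module_scheme \<Rightarrow> ('a, 'c, 'k) module_scheme \<Rightarrow> ('b \<Rightarrow> 'c) \<Rightarrow> bool"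
where
  "linear_map R M N f \<longleftrightarrow>
     (\<forall>x\<in>carrier M. f x \<in> carrier N) \<and>
     (\<forall>x\<in>carrier M. \<forall>y\<in>carrier M. f (x \<oplus>\<^bsub>M\<^esub> y) = f x \<oplus>\<^bsub>N\<^esub> f y) \<and>
     (\<forall>a\<in>carrier R. \<forall>x\<in>carrier M. f (a \<odot>\<^bsub>M\<^esub> x) = a \<odot>\<^bsub>N\<^esub> f x)"

lemma linear_mapI:
  assumes "\<And>x. x \<in> carrier M \<Longrightarrow> f x \<in> carrier N"
    and "\<And>x y. x \<in> carrier M \<Longrightarrow> y \<in> carrier M \<Longrightarrow> f (x \<oplus>\<^bsub>M\<^esub> y) = f x \<oplus>\<^bsub>N\<^esub> f y"
    and "\<And>a x. a \<in> carrier R \<Longrightarrow> x \<in> carrier M \<Longrightarrow> f (a \<odot>\<^bsub>M\<^esub> x) = a \<odot>\<^bsub>N\<^esub> f x"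
  shows "linear_map R M N f"
  using assms by (simp add: linear_map_def)

lemma linear_mapD:
  assumes "linear_map R M N f"
  shows "x \<in> carrier M \<Longrightarrow> f x \<in> carrier N"
    and "x \<in> carrier M \<Longrightarrow> y \<in> carrier M \<Longrightarrow> f (x \<oplus>\<^bsub>M\<^esub> y) = f x \<oplus>\<^bsub>N\<^esub> f y"
    and "a \<in> carrier R \<Longrightarrow> x \<in> carrier M \<Longrightarrow> f (a \<odot>\<^bsub>M\<^esub> x) = a \<odot>\<^bsub>N\<^esub> f x"
  using assms by (simp_all add: linear_map_def)

text \<open>Elements of \<open>module_hom\<close> are extensional, so a pointwise sum or composite
  written as a plain function need not belong to it. The arguments therefore run with
  \<open>linear_map\<close>, and \<open>restrict_module_hom\<close> returns to
  \<open>module_hom\<close>.\<close>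

lemma module_hom_iff:
  "f \<in> module_hom R M N \<longleftrightarrow> linear_map R M N f \<and> f \<in> extensional (carrier M)"
  by (auto simp: module_hom_def linear_map_def PiE_def)

lemma module_hom_linear_map: "f \<in> module_hom R M N \<Longrightarrow> linear_map R M N f"
  by (simp add: module_hom_iff)

lemma linear_map_cong:
  assumes "linear_map R M N f" "module R M" "\<And>x. x \<in> carrier M \<Longrightarrow> g x = f x"
  shows "linear_map R M N g"
proof -
  interpret module R M by fact
  show ?thesis using assms(1,3) by (simp add: linear_map_def)
qed

lemma restrict_module_hom:
  assumes "linear_map R M N f" "module R M"
  shows "restrict f (carrier M) \<in> module_hom R M N"
  using linear_map_cong[OF assms, of "restrict f (carrier M)"] by (simp add: module_hom_iff)

lemma linear_map_comp:
  assumes "linear_map R M N f" "linear_map R N L g"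
  shows "linear_map R M L (\<lambda>x. g (f x))"
  using assms by (simp add: linear_map_def)

lemma (in module) minus_closed' [simp]:
  "x \<in> carrier M \<Longrightarrow> y \<in> carrier M \<Longrightarrow> x \<ominus>\<^bsub>M\<^esub> y \<in> carrier M"
  by (simp add: M.minus_closed)

lemma (in module) minus_eq_zero_iff:
  "x \<in> carrier M \<Longrightarrow> y \<in> carrier M \<Longrightarrow> x \<ominus>\<^bsub>M\<^esub> y = \<zero>\<^bsub>M\<^esub> \<longleftrightarrow> x = y"
  by (metis M.a_inv_closed M.minus_equality M.minus_minus M.r_neg M.minus_eq)

lemma (in module) minus_plus_cancel [simp]:
  "x \<in> carrier M \<Longrightarrow> y \<in> carrier M \<Longrightarrow> y \<oplus>\<^bsub>M\<^esub> (x \<ominus>\<^bsub>M\<^esub> y) = x"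
  by (simp add: M.minus_eq M.a_lcomm M.r_neg)

lemma (in module) minus_plus_cancel' [simp]:
  "x \<in> carrier M \<Longrightarrow> y \<in> carrier M \<Longrightarrow> (x \<ominus>\<^bsub>M\<^esub> y) \<oplus>\<^bsub>M\<^esub> y = x"
  by (simp add: M.minus_eq M.a_assoc M.l_neg)

lemma (in module) minus_zero' [simp]: "x \<in> carrier M \<Longrightarrow> x \<ominus>\<^bsub>M\<^esub> \<zero>\<^bsub>M\<^esub> = x"
  by (simp add: M.minus_eq)

lemma (in module) minus_as_smult:
  "x \<in> carrier M \<Longrightarrow> y \<in> carrier M \<Longrightarrow> x \<ominus>\<^bsub>M\<^esub> y = x \<oplus>\<^bsub>M\<^esub> (\<ominus> \<one>) \<odot>\<^bsub>M\<^esub> y"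
  by (simp add: M.minus_eq smult_l_minus)

lemma (in module) smult_minus_distr:
  "a \<in> carrier R \<Longrightarrow> x \<in> carrier M \<Longrightarrow> y \<in> carrier M \<Longrightarrow>
     a \<odot>\<^bsub>M\<^esub> (x \<ominus>\<^bsub>M\<^esub> y) = a \<odot>\<^bsub>M\<^esub> x \<ominus>\<^bsub>M\<^esub> a \<odot>\<^bsub>M\<^esub> y"
  by (simp add: M.minus_eq smult_r_distr smult_r_minus)

lemma (in module) smult_commute:
  "a \<in> carrier R \<Longrightarrow> b \<in> carrier R \<Longrightarrow> x \<in> carrier M \<Longrightarrow>
     a \<odot>\<^bsub>M\<^esub> (b \<odot>\<^bsub>M\<^esub> x) = b \<odot>\<^bsub>M\<^esub> (a \<odot>\<^bsub>M\<^esub> x)"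
  by (metis smult_assoc1 R.m_comm)

lemma linear_map_zero:
  assumes "linear_map R M N f" "module R M" "module R N"
  shows "f \<zero>\<^bsub>M\<^esub> = \<zero>\<^bsub>N\<^esub>"
proof -
  interpret M: module R M by fact
  interpret N: module R N by fact
  have "f (\<zero>\<^bsub>R\<^esub> \<odot>\<^bsub>M\<^esub> \<zero>\<^bsub>M\<^esub>) = \<zero>\<^bsub>R\<^esub> \<odot>\<^bsub>N\<^esub> f \<zero>\<^bsub>M\<^esub>"
    using assms(1) by (simp add: linear_map_def del: M.smult_l_null M.smult_r_null)
  thus ?thesis using linear_mapD(1)[OF assms(1)] by simp
qed

lemma linear_map_minus:
  assumes "linear_map R M N f" "module R M" "module R N" "x \<in> carrier M" "y \<in> carrier M"
  shows "f (x \<ominus>\<^bsub>M\<^esub> y) = f x \<ominus>\<^bsub>N\<^esub> f y"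
proof -
  interpret M: module R M by fact
  interpret N: module R N by fact
  show ?thesis using linear_mapD[OF assms(1)] assms(4,5)
    by (simp add: M.minus_as_smult N.minus_as_smult)
qed

lemma linear_map_add_fun:
  assumes "linear_map R M N f" "linear_map R M N g" "module R N"
  shows "linear_map R M N (\<lambda>x. f x \<oplus>\<^bsub>N\<^esub> g x)"
proof -
  interpret N: module R N by fact
  show ?thesis using linear_mapD[OF assms(1)] linear_mapD[OF assms(2)]
    by (intro linear_mapI) (simp_all add: N.smult_r_distr N.a_ac)
qed

lemma linear_map_smult_fun:
  assumes "linear_map R M N f" "a \<in> carrier R" "module R N"
  shows "linear_map R M N (\<lambda>x. a \<odot>\<^bsub>N\<^esub> f x)"
proof -
  interpret N: module R N by fact
  show ?thesis using linear_mapD[OF assms(1)] assms(2)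
    by (intro linear_mapI) (simp_all add: N.smult_r_distr N.smult_commute)
qed

lemma linear_map_minus_fun:
  assumes "linear_map R M N f" "linear_map R M N g" "module R M" "module R N"
  shows "linear_map R M N (\<lambda>x. f x \<ominus>\<^bsub>N\<^esub> g x)"
proof -
  interpret N: module R N by fact
  have "linear_map R M N (\<lambda>x. f x \<oplus>\<^bsub>N\<^esub> (\<ominus>\<^bsub>R\<^esub> \<one>\<^bsub>R\<^esub>) \<odot>\<^bsub>N\<^esub> g x)"
    using assms by (intro linear_map_add_fun linear_map_smult_fun) simp_all
  thus ?thesis
    by (rule linear_map_cong[OF _ assms(3)])
      (simp add: N.minus_as_smult linear_mapD(1)[OF assms(1)] linear_mapD(1)[OF assms(2)])
qed

lemma linear_map_zero_fun:
  assumes "module R N"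
  shows "linear_map R M N (\<lambda>x. \<zero>\<^bsub>N\<^esub>)"
proof -
  interpret N: module R N by fact
  show ?thesis by (intro linear_mapI) simp_all
qed

section \<open>Submodules, images and kernels\<close>

lemma (in module) submoduleI':
  assumes "H \<subseteq> carrier M" "\<zero>\<^bsub>M\<^esub> \<in> H"
    and "\<And>a b. \<lbrakk>a \<in> H; b \<in> H\<rbrakk> \<Longrightarrow> a \<oplus>\<^bsub>M\<^esub> b \<in> H"
    and "\<And>a x. \<lbrakk>a \<in> carrier R; x \<in> H\<rbrakk> \<Longrightarrow> a \<odot>\<^bsub>M\<^esub> x \<in> H"
  shows "submodule H R M"
proof (rule submoduleI)
  fix a assume a: "a \<in> H"
  hence "\<ominus>\<^bsub>M\<^esub> a = (\<ominus> \<one>) \<odot>\<^bsub>M\<^esub> a" using assms(1) by (auto simp: smult_l_minus)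
  thus "\<ominus>\<^bsub>M\<^esub> a \<in> H" using assms(4)[OF _ a] by simp
qed (use assms in auto)

lemma submoduleD:
  assumes "submodule H R M"
  shows "x \<in> H \<Longrightarrow> x \<in> carrier M" "\<zero>\<^bsub>M\<^esub> \<in> H" "x \<in> H \<Longrightarrow> y \<in> H \<Longrightarrow> x \<oplus>\<^bsub>M\<^esub> y \<in> H"
    "a \<in> carrier R \<Longrightarrow> x \<in> H \<Longrightarrow> a \<odot>\<^bsub>M\<^esub> x \<in> H"
  using assms subgroup.subset[OF submodule.axioms(1)[OF assms]] subgroup.one_closed[OF submodule.axioms(1)[OF assms]]
    subgroup.m_closed[OF submodule.axioms(1)[OF assms]] submodule.smult_closed[OF assms]
  by auto

lemma (in module) submodule_minus:
  assumes "submodule H R M" "x \<in> H" "y \<in> H"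
  shows "x \<ominus>\<^bsub>M\<^esub> y \<in> H"
  using submoduleD[OF assms(1)] assms by (simp add: minus_as_smult)

lemma linear_map_image_submodule:
  assumes "linear_map R M N f" "module R M" "module R N"
  shows "submodule (f ` carrier M) R N"
proof -
  interpret M: module R M by fact
  interpret N: module R N by fact
  note D = linear_mapD[OF assms(1)]
  show ?thesis
  proof (rule N.submoduleI')
    show "\<zero>\<^bsub>N\<^esub> \<in> f ` carrier M" using linear_map_zero[OF assms] by (metis M.zero_closed imageI)
  qed (use D in \<open>auto simp flip: D(2,3)\<close>)
qed

lemma a_kernel_iff: "x \<in> a_kernel M N f \<longleftrightarrow> x \<in> carrier M \<and> f x = \<zero>\<^bsub>N\<^esub>"
  by (simp add: a_kernel_def')

lemma linear_map_kernel_submodule: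
  assumes "linear_map R M N f" "module R M" "module R N"
  shows "submodule (a_kernel M N f) R M"
proof -
  interpret M: module R M by fact
  interpret N: module R N by fact
  show ?thesis
    by (rule M.submoduleI')
      (auto simp: a_kernel_iff linear_map_zero[OF assms] linear_mapD[OF assms(1)])
qed


section \<open>Rings, free modules and modules of homomorphisms as modules\<close>

lemma self_module_simps [simp]:
  "carrier (self_module R) = carrier R" "zero (self_module R) = zero R"
  "add (self_module R) = add R" "smult (self_module R) = mult R"
  by (simp_all add: self_module_def)

lemma self_module_minus [simp]:
  "a_inv (self_module R) = a_inv R" "a_minus (self_module R) = a_minus R"
  by (auto simp: fun_eq_iff a_inv_def a_minus_def m_inv_def)

lemma (in cring) self_module: "module R (self_module R)"
proof (rule moduleI)
  show "abelian_group (self_module R)"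
  proof (rule abelian_groupI)
    show "\<And>x. x \<in> carrier (self_module R) \<Longrightarrow>
      \<exists>y\<in>carrier (self_module R). y \<oplus>\<^bsub>self_module R\<^esub> x = \<zero>\<^bsub>self_module R\<^esub>"
      using l_neg by auto
  qed (auto simp: a_ac)
qed (auto simp: is_cring l_distr r_distr m_assoc)

lemma free_module_simps [simp]:
  "carrier (free_module R n) = {..<n} \<rightarrow>\<^sub>E carrier R"
  "zero (free_module R n) = (\<lambda>k\<in>{..<n}. \<zero>\<^bsub>R\<^esub>)"
  "add (free_module R n) = (\<lambda>x y. \<lambda>k\<in>{..<n}. x k \<oplus>\<^bsub>R\<^esub> y k)"
  "smult (free_module R n) = (\<lambda>a x. \<lambda>k\<in>{..<n}. a \<otimes>\<^bsub>R\<^esub> x k)"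
  by (simp_all add: free_module_def)

lemma (in cring) free_module: "module R (free_module R n)"
proof (rule moduleI)
  show "abelian_group (free_module R n)"
  proof (rule abelian_groupI)
    fix x assume x: "x \<in> carrier (free_module R n)"
    show "\<exists>y\<in>carrier (free_module R n). y \<oplus>\<^bsub>free_module R n\<^esub> x = \<zero>\<^bsub>free_module R n\<^esub>"
      by (rule bexI[of _ "\<lambda>k\<in>{..<n}. \<ominus> x k"]) (use x in \<open>auto simp: fun_eq_iff l_neg PiE_def Pi_def\<close>)
  qed (auto simp: fun_eq_iff PiE_def Pi_def extensional_def a_ac)
qed (auto simp: is_cring fun_eq_iff PiE_def Pi_def extensional_def l_distr r_distr m_assoc)

lemma hom_module_simps [simp]:
  "carrier (hom_module R M N) = module_hom R M N"
  "zero (hom_module R M N) = (\<lambda>x\<in>carrier M. \<zero>\<^bsub>N\<^esub>)"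
  "add (hom_module R M N) = (\<lambda>f g. \<lambda>x\<in>carrier M. f x \<oplus>\<^bsub>N\<^esub> g x)"
  "smult (hom_module R M N) = (\<lambda>a f. \<lambda>x\<in>carrier M. a \<odot>\<^bsub>N\<^esub> f x)"
  by (simp_all add: hom_module_def)

lemma hom_module:
  assumes "module R M" "module R N"
  shows "module R (hom_module R M N)"
proof -
  interpret M: module R M by fact
  interpret N: module R N by fact
  have ext: "f = g" if "f \<in> extensional (carrier M)" "g \<in> extensional (carrier M)"
    "\<And>x. x \<in> carrier M \<Longrightarrow> f x = g x" for f g :: "'c \<Rightarrow> 'e"
    using that by (rule extensionalityI)
  have cl: "\<And>f x. f \<in> module_hom R M N \<Longrightarrow> x \<in> carrier M \<Longrightarrow> f x \<in> carrier N"
    and exl: "\<And>f. f \<in> module_hom R M N \<Longrightarrow> f \<in> extensional (carrier M)"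
    by (auto simp: module_hom_iff linear_mapD)
  show ?thesis
  proof (rule moduleI)
    show "abelian_group (hom_module R M N)"
    proof (rule abelian_groupI)
      fix f assume f: "f \<in> carrier (hom_module R M N)"
      show "\<exists>g\<in>carrier (hom_module R M N). g \<oplus>\<^bsub>hom_module R M N\<^esub> f = \<zero>\<^bsub>hom_module R M N\<^esub>"
      proof (rule bexI[of _ "\<lambda>x\<in>carrier M. (\<ominus>\<^bsub>R\<^esub> \<one>\<^bsub>R\<^esub>) \<odot>\<^bsub>N\<^esub> f x"])
        show "(\<lambda>x\<in>carrier M. (\<ominus>\<^bsub>R\<^esub> \<one>\<^bsub>R\<^esub>) \<odot>\<^bsub>N\<^esub> f x) \<in> carrier (hom_module R M N)"
          using f assms by (auto intro!: restrict_module_hom linear_map_smult_fun simp: module_hom_linear_map)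
      qed (use f in \<open>auto intro!: ext simp: cl N.smult_l_minus N.M.l_neg\<close>)
    qed (auto intro!: ext restrict_module_hom linear_map_add_fun linear_map_zero_fun assms
        intro: exl simp: cl N.a_ac module_hom_linear_map)
  qed (auto intro!: ext restrict_module_hom linear_map_smult_fun assms
        intro: exl M.R.is_cring simp: cl module_hom_linear_map N.smult_l_distr N.smult_r_distr N.smult_assoc1)
qed

section \<open>Finitely generated modules over noetherian rings\<close>

text \<open>Recursion on the length makes induction on the number of generators available, and the
  coefficient argument has the type of the elements of \<open>free_module\<close>, so a vector can
  be used as coefficients directly.\<close>

primrec lincomb ::
  "('a, 'b, 'n) module_scheme \<Rightarrow> (nat \<Rightarrow> 'b) \<Rightarrow> (nat \<Rightarrow> 'a) \<Rightarrow> nat \<Rightarrow> 'b"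
where
  "lincomb M a c 0 = \<zero>\<^bsub>M\<^esub>"
| "lincomb M a c (Suc l) = lincomb M a c l \<oplus>\<^bsub>M\<^esub> c l \<odot>\<^bsub>M\<^esub> a l"

definition std_basis :: "('a, 'm) ring_scheme \<Rightarrow> nat \<Rightarrow> nat \<Rightarrow> nat \<Rightarrow> 'a" where
  "std_basis R n k = (\<lambda>j\<in>{..<n}. if j = k then \<one>\<^bsub>R\<^esub> else \<zero>\<^bsub>R\<^esub>)"

lemma (in cring) std_basis_closed [simp]: "std_basis R n k \<in> {..<n} \<rightarrow>\<^sub>E carrier R"
  by (auto simp: std_basis_def)

lemma (in module) lincomb_closed:
  assumes "\<And>k. k < l \<Longrightarrow> a k \<in> carrier M" "\<And>k. k < l \<Longrightarrow> c k \<in> carrier R"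
  shows "lincomb M a c l \<in> carrier M"
  using assms by (induction l) auto

lemma (in module) lincomb_submodule:
  assumes "submodule H R M" "\<And>k. k < l \<Longrightarrow> a k \<in> H" "\<And>k. k < l \<Longrightarrow> c k \<in> carrier R"
  shows "lincomb M a c l \<in> H"
  using assms(2,3) submoduleD[OF assms(1)] by (induction l) auto

lemma (in module) lincomb_add:
  assumes "\<And>k. k < l \<Longrightarrow> a k \<in> carrier M" "\<And>k. k < l \<Longrightarrow> c k \<in> carrier R"
    "\<And>k. k < l \<Longrightarrow> d k \<in> carrier R" "\<And>k. k < l \<Longrightarrow> e k = c k \<oplus> d k"
  shows "lincomb M a e l = lincomb M a c l \<oplus>\<^bsub>M\<^esub> lincomb M a d l"
  using assms
proof (induction l)
  case (Suc l)
  hence "lincomb M a c l \<in> carrier M" "lincomb M a d l \<in> carrier M"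
    by (auto intro!: lincomb_closed)
  with Suc show ?case by (simp add: smult_l_distr M.a_ac)
qed simp

lemma (in module) lincomb_smult:
  assumes "\<And>k. k < l \<Longrightarrow> a k \<in> carrier M" "\<And>k. k < l \<Longrightarrow> c k \<in> carrier R"
    "r \<in> carrier R" "\<And>k. k < l \<Longrightarrow> e k = r \<otimes> c k"
  shows "lincomb M a e l = r \<odot>\<^bsub>M\<^esub> lincomb M a c l"
  using assms
proof (induction l)
  case (Suc l)
  hence "lincomb M a c l \<in> carrier M"
    by (auto intro!: lincomb_closed)
  with Suc show ?case by (simp add: smult_r_distr smult_assoc1)
qed simp

lemma (in module) lincomb_linear_map:
  assumes "\<And>k. k < n \<Longrightarrow> a k \<in> carrier M"
  shows "linear_map R (free_module R n) M (\<lambda>c. lincomb M a c n)"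
  by (rule linear_mapI)
    (auto intro!: lincomb_closed lincomb_add lincomb_smult simp: assms PiE_def Pi_def)

lemma linear_map_lincomb:
  assumes "linear_map R M N f" "module R M" "module R N"
    "\<And>k. k < l \<Longrightarrow> a k \<in> carrier M" "\<And>k. k < l \<Longrightarrow> c k \<in> carrier R"
  shows "f (lincomb M a c l) = lincomb N (\<lambda>k. f (a k)) c l"
  using assms(4,5)
proof (induction l)
  case 0 show ?case using linear_map_zero[OF assms(1-3)] by simp
next
  case (Suc l)
  interpret M: module R M by fact
  have "lincomb M a c l \<in> carrier M" using Suc by (auto intro!: M.lincomb_closed)
  with Suc show ?case by (simp add: linear_mapD[OF assms(1)])
qed

lemma (in cring) free_module_expand:
  assumes "x \<in> carrier (free_module R n)"
  shows "lincomb (free_module R n) (std_basis R n) x n = x"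
proof -
  have "lincomb (free_module R n) (std_basis R n) x l =
      (\<lambda>k\<in>{..<n}. if k < l then x k else \<zero>)" if "l \<le> n" for l
    using that
  proof (induction l)
    case (Suc l)
    with assms show ?case
      by (auto simp: fun_eq_iff std_basis_def PiE_def Pi_def not_less less_Suc_eq)
  qed (auto simp: fun_eq_iff)
  from this[of n] assms show ?thesis by (auto simp: fun_eq_iff PiE_def extensional_def)
qed

text \<open>This replaces all liftings along surjections.\<close>

lemma (in module) free_module_choose:
  assumes add: "\<And>x y u v. \<lbrakk>x \<in> carrier (free_module R n); y \<in> carrier (free_module R n);
        u \<in> carrier M; v \<in> carrier M; Q x u; Q y v\<rbrakk> \<Longrightarrow> Q (x \<oplus>\<^bsub>free_module R n\<^esub> y) (u \<oplus>\<^bsub>M\<^esub> v)"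
    and smult: "\<And>a x u. \<lbrakk>a \<in> carrier R; x \<in> carrier (free_module R n); u \<in> carrier M; Q x u\<rbrakk>
        \<Longrightarrow> Q (a \<odot>\<^bsub>free_module R n\<^esub> x) (a \<odot>\<^bsub>M\<^esub> u)"
    and ex: "\<And>x. x \<in> carrier (free_module R n) \<Longrightarrow> \<exists>u\<in>carrier M. Q x u"
  obtains f where "linear_map R (free_module R n) M f"
    "\<And>x. x \<in> carrier (free_module R n) \<Longrightarrow> Q x (f x)"
proof -
  interpret F: module R "free_module R n" by (rule R.free_module)
  let ?e = "std_basis R n"
  have e: "?e k \<in> carrier (free_module R n)" for k by simp
  \<comment> \<open>Images are chosen on the basis vectors only. The map is their linear extension,
    and closure of \<open>Q\<close> under sums and multiples carries \<open>Q\<close> from the basis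
    to all vectors.\<close>
  obtain u where u: "\<And>k. u k \<in> carrier M" "\<And>k. Q (?e k) (u k)"
    using ex[OF e] by metis
  obtain v where v: "v \<in> carrier M" "Q \<zero>\<^bsub>free_module R n\<^esub> v"
    using ex[OF F.zero_closed] by blast
  \<comment> \<open>Any value related to zero gives the pair of zeros after multiplication by the
    scalar zero.\<close>
  have Q0: "Q \<zero>\<^bsub>free_module R n\<^esub> \<zero>\<^bsub>M\<^esub>"
    using smult[of "\<zero>" "\<zero>\<^bsub>free_module R n\<^esub>" v] F.smult_r_null[OF R.zero_closed] v F.zero_closed
    by (simp add: case_prod_beta del: free_module_simps)
  show thesis
  proof
    show "linear_map R (free_module R n) M (\<lambda>x. lincomb M u x n)"
      using u by (intro lincomb_linear_map)
    fix x assume x: "x \<in> carrier (free_module R n)"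
    have xk: "x k \<in> carrier R" if "k < n" for k using x that by auto
    have "Q (lincomb (free_module R n) ?e x l) (lincomb M u x l)" if "l \<le> n" for l
      using that
    proof (induction l)
      case (Suc l)
      have "lincomb (free_module R n) ?e x l \<in> carrier (free_module R n)"
        using Suc.prems xk e by (intro F.lincomb_closed) auto
      moreover have "lincomb M u x l \<in> carrier M"
        using Suc.prems xk u by (intro lincomb_closed) auto
      ultimately show ?case using Suc xk[of l] u e[of l] F.smult_closed[of "x l" "?e l"]
        by (simp del: free_module_simps add: add smult)
    qed (use Q0 in simp)
    from this[of n] show "Q x (lincomb M u x n)"
      by (simp del: free_module_simps add: R.free_module_expand[OF x])
  qed
qed

section \<open>Spans, and submodules of free modules over a noetherian ring\<close>

definition span ::
  "('a, 'm) ring_scheme \<Rightarrow> ('a, 'b, 'n) module_scheme \<Rightarrow> 'b set \<Rightarrow> 'b set" where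
  "span R M A = \<Inter> {H. submodule H R M \<and> A \<subseteq> H}"

lemma (in module) span_submodule:
  assumes "A \<subseteq> carrier M"
  shows "submodule (span R M A) R M"
proof (rule submoduleI')
  show "span R M A \<subseteq> carrier M"
    using assms carrier_is_submodule by (auto simp: span_def)
qed (auto simp: span_def submoduleD)

lemma span_superset: "A \<subseteq> span R M A"
  by (auto simp: span_def)

lemma span_least: "submodule H R M \<Longrightarrow> A \<subseteq> H \<Longrightarrow> span R M A \<subseteq> H"
  by (auto simp: span_def)

lemma (in module) finite_span_image:
  assumes "finite A" "A \<subseteq> carrier M"
  obtains m u where "linear_map R (free_module R m) M u" "u ` carrier (free_module R m) = span R M A"
proof -
  from assms(1) obtain m :: nat and a where a: "A = a ` {..<m}"
    by (metis finite_conv_nat_seg_image lessThan_def)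
  have ak: "a k \<in> carrier M" if "k < m" for k using a assms(2) that by auto
  let ?u = "\<lambda>c. lincomb M a c m"
  have lin: "linear_map R (free_module R m) M ?u" using ak by (rule lincomb_linear_map)
  show thesis
  proof (rule that[OF lin])
    show "?u ` carrier (free_module R m) = span R M A"
    proof
      show "?u ` carrier (free_module R m) \<subseteq> span R M A"
      proof
        fix x assume "x \<in> ?u ` carrier (free_module R m)"
        then obtain c where c: "c \<in> {..<m} \<rightarrow>\<^sub>E carrier R" "x = lincomb M a c m" by auto
        show "x \<in> span R M A"
          unfolding c(2) using c(1) a span_superset[of A R M]
          by (intro lincomb_submodule[OF span_submodule[OF assms(2)]]) auto
      qed
      have "a k \<in> ?u ` carrier (free_module R m)" if "k < m" for k
      proof -
        have "lincomb M a (std_basis R m k) l = (if k < l then a k else \<zero>\<^bsub>M\<^esub>)" if "l \<le> m" for l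
          using that ak \<open>k < m\<close> by (induction l) (auto simp: std_basis_def less_Suc_eq)
        from this[of m] that show ?thesis
          using R.std_basis_closed[of m k] by (intro image_eqI[of _ _ "std_basis R m k"]) simp_all
      qed
      thus "span R M A \<subseteq> ?u ` carrier (free_module R m)"
        using a lin by (intro span_least linear_map_image_submodule R.free_module module_axioms) auto
    qed
  qed
qed

lemma free_module_coord: "x \<in> carrier (free_module R n) \<Longrightarrow> k < n \<Longrightarrow> x k \<in> carrier R"
  by auto

lemma (in cring) free_module_minus:
  assumes "x \<in> carrier (free_module R n)" "y \<in> carrier (free_module R n)" "k < n"
  shows "(x \<ominus>\<^bsub>free_module R n\<^esub> y) k = x k \<ominus> y k"
proof -
  interpret F: module R "free_module R n" by (rule free_module)
  have "y k \<in> carrier R" using assms by auto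
  thus ?thesis using assms(3) by (simp add: F.minus_as_smult[OF assms(1,2)] l_minus minus_eq)
qed

text \<open>Induction on the number l of coordinates that may be nonzero. In the step the l-th
  coordinates form an ideal, which is finitely generated; lifts of its generators together with
  generators for the previous level suffice. The case l = n says that K is finitely
  generated.\<close>

lemma (in cring) free_submodule_span:
  assumes "noetherian_ring R" "submodule K R (free_module R n)" "l \<le> n"
  shows "\<exists>A. finite A \<and> A \<subseteq> K \<and>
    span R (free_module R n) A = {y \<in> K. \<forall>k. l \<le> k \<longrightarrow> k < n \<longrightarrow> y k = \<zero>}"
  using assms(3)
proof (induction l)
  case 0
  interpret F: module R "free_module R n" by (rule free_module)
  note KD = submoduleD[OF assms(2)]
  have 1: "y = \<zero>\<^bsub>free_module R n\<^esub>" if "y \<in> K" "\<forall>k<n. y k = \<zero>" for y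
    using that KD(1)[of y] by (auto simp: fun_eq_iff PiE_def extensional_def)
  have 2: "{y \<in> K. \<forall>k. 0 \<le> k \<longrightarrow> k < n \<longrightarrow> y k = \<zero>} = {\<zero>\<^bsub>free_module R n\<^esub>}"
  proof (intro equalityI subsetI)
    fix y assume "y \<in> {\<zero>\<^bsub>free_module R n\<^esub>}"
    hence "y = \<zero>\<^bsub>free_module R n\<^esub>" by blast
    thus "y \<in> {y \<in> K. \<forall>k. 0 \<le> k \<longrightarrow> k < n \<longrightarrow> y k = \<zero>}" using KD(2) by simp
  qed (use 1 in blast)
  have "span R (free_module R n) {} = {\<zero>\<^bsub>free_module R n\<^esub>}"
  proof
    show "span R (free_module R n) {} \<subseteq> {\<zero>\<^bsub>free_module R n\<^esub>}"
      by (rule span_least[OF F.submoduleI'])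
        (use F.zero_closed F.M.l_zero[OF F.zero_closed] F.smult_r_null in
          \<open>auto simp del: free_module_simps\<close>)
  qed (use submoduleD(2)[OF F.span_submodule[of "{}"]] in \<open>simp del: free_module_simps\<close>)
  thus ?case unfolding 2 by blast
next
  case (Suc l)
  interpret F: module R "free_module R n" by (rule free_module)
  note KD = submoduleD[OF assms(2)]
  let ?F = "free_module R n"
  let ?K = "\<lambda>l. {y \<in> K. \<forall>k. l \<le> k \<longrightarrow> k < n \<longrightarrow> y k = \<zero>}"
  have l: "l < n" using Suc.prems by simp
  from Suc obtain A where A: "finite A" "A \<subseteq> K" "span R ?F A = ?K l" by auto
  have Ksub: "submodule (?K j) R ?F" for j
    by (rule F.submoduleI') (use KD(1) KD(2-4) in auto)
  have ideal: "ideal ((\<lambda>y. y l) ` H) R" if H: "submodule H R ?F" for H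
  proof (rule idealI)
    note HD = submoduleD[OF H]
    show "subgroup ((\<lambda>y. y l) ` H) (add_monoid R)"
    proof (rule add.subgroupI)
      show "(\<lambda>y. y l) ` H \<subseteq> carrier R" using HD(1) l by auto
      show "(\<lambda>y. y l) ` H \<noteq> {}" using HD(2) by auto
    next
      fix a assume "a \<in> (\<lambda>y. y l) ` H"
      then obtain y where y: "y \<in> H" "a = y l" by auto
      have "y l \<in> carrier R" using HD(1)[OF y(1)] l by auto
      have "(\<ominus> \<one>) \<odot>\<^bsub>?F\<^esub> y \<in> H" using HD(4)[OF _ y(1), of "\<ominus> \<one>"] by auto
      moreover have "((\<ominus> \<one>) \<odot>\<^bsub>?F\<^esub> y) l = \<ominus> a" using l y \<open>y l \<in> carrier R\<close> by (simp add: l_minus)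
      ultimately show "\<ominus> a \<in> (\<lambda>y. y l) ` H" by (metis imageI)
    next
      fix a b assume "a \<in> (\<lambda>y. y l) ` H" "b \<in> (\<lambda>y. y l) ` H"
      then obtain y z where y: "y \<in> H" "a = y l" "z \<in> H" "b = z l" by auto
      show "a \<oplus> b \<in> (\<lambda>y. y l) ` H"
        using HD(3)[OF y(1,3)] l y(2,4) by (intro image_eqI[of _ _ "y \<oplus>\<^bsub>?F\<^esub> z"]) auto
    qed
    have 1: "x \<otimes> a \<in> (\<lambda>y. y l) ` H" if "a \<in> (\<lambda>y. y l) ` H" "x \<in> carrier R" for a x
      using HD(4) l that by (auto intro!: image_eqI[of _ _ "x \<odot>\<^bsub>?F\<^esub> y" for y])
    show "x \<otimes> a \<in> (\<lambda>y. y l) ` H" if "a \<in> (\<lambda>y. y l) ` H" "x \<in> carrier R" for a x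
      using 1 that .
    show "a \<otimes> x \<in> (\<lambda>y. y l) ` H" if "a \<in> (\<lambda>y. y l) ` H" "x \<in> carrier R" for a x
      using 1[OF that] that(2) that(1) HD(1) l by (subst m_comm) auto
  qed (rule ring_axioms)
  \<comment> \<open>\<open>G\<close> generates the ideal of l-th coordinates, and \<open>Y\<close>
    consists of vectors that have the elements of \<open>G\<close> as l-th coordinates.\<close>
  obtain G where G: "G \<subseteq> carrier R" "finite G" "(\<lambda>y. y l) ` ?K (Suc l) = Idl G"
    using noetherian_ring.finetely_gen[OF assms(1) ideal[OF Ksub]] by blast
  hence GK: "G \<subseteq> (\<lambda>y. y l) ` ?K (Suc l)" using genideal_self[of G] by simp
  obtain Y where Y: "finite Y" "Y \<subseteq> ?K (Suc l)" "G = (\<lambda>y. y l) ` Y"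
    using finite_subset_image[OF G(2) GK] by blast
  have YF: "Y \<subseteq> carrier ?F" and AF: "A \<subseteq> carrier ?F" using Y(2) A(2) KD(1) by blast+
  have "span R ?F (A \<union> Y) = ?K (Suc l)"
  proof
    have "A \<subseteq> ?K (Suc l)" using A(3) span_superset[of A R ?F] by fastforce
    thus "span R ?F (A \<union> Y) \<subseteq> ?K (Suc l)" using Y(2) by (intro span_least Ksub) auto
    show "?K (Suc l) \<subseteq> span R ?F (A \<union> Y)"
    proof
      fix y assume y: "y \<in> ?K (Suc l)"
      have "Idl G \<subseteq> (\<lambda>y. y l) ` span R ?F Y"
        unfolding Y(3)
        by (intro genideal_minimal ideal F.span_submodule YF image_mono span_superset)
      moreover have "y l \<in> Idl G" unfolding G(3)[symmetric] using y by (rule imageI)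
      ultimately have "y l \<in> (\<lambda>y. y l) ` span R ?F Y" by (rule subsetD)
      then obtain w where w: "y l = w l" "w \<in> span R ?F Y" by (rule imageE)
      have wK: "w \<in> ?K (Suc l)" using w(2) span_least[OF Ksub Y(2)] by blast
      have yw: "y \<ominus>\<^bsub>?F\<^esub> w \<in> ?K (Suc l)" using F.submodule_minus[OF Ksub y wK] .
      have yF: "y \<in> carrier ?F" "w \<in> carrier ?F" using y wK by (blast intro: KD(1))+
      \<comment> \<open>Subtracting the combination w of \<open>Y\<close> with the same l-th
        coordinate pushes y down to the previous level.\<close>
      have "(y \<ominus>\<^bsub>?F\<^esub> w) l = \<zero>"
      proof -
        have "w l \<in> carrier R" by (rule free_module_coord[OF yF(2) l])
        thus ?thesis by (simp only: free_module_minus[OF yF l] w(1) minus_eq r_neg)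
      qed
      moreover have "l = k \<or> Suc l \<le> k" if "l \<le> k" for k using that by auto
      ultimately have "y \<ominus>\<^bsub>?F\<^esub> w \<in> ?K l" using yw by blast
      hence 1: "y \<ominus>\<^bsub>?F\<^esub> w \<in> span R ?F (A \<union> Y)"
        unfolding A(3)[symmetric] by (auto simp: span_def)
      have 2: "w \<in> span R ?F (A \<union> Y)" using w(2) by (auto simp: span_def)
      show "y \<in> span R ?F (A \<union> Y)"
        using submoduleD(3)[OF F.span_submodule[of "A \<union> Y"] 2 1] F.minus_plus_cancel[OF yF] AF YF by simp
    qed
  qed
  moreover have "A \<union> Y \<subseteq> K" "finite (A \<union> Y)" using A(1,2) Y(1,2) by auto
  ultimately show ?case by blast
qed

lemma (in cring) free_submodule_image:
  assumes "noetherian_ring R" "submodule K R (free_module R n)"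
  obtains m u where "linear_map R (free_module R m) (free_module R n) u"
    "u ` carrier (free_module R m) = K"
proof -
  interpret F: module R "free_module R n" by (rule free_module)
  from free_submodule_span[OF assms, of n] obtain A where
    A: "finite A" "A \<subseteq> K" "span R (free_module R n) A = K" by auto
  moreover have "A \<subseteq> carrier (free_module R n)" using A(2) submoduleD(1)[OF assms(2)] by blast
  ultimately show thesis using F.finite_span_image[of A] that by metis
qed

declare free_module_simps [simp del]

section \<open>Free resolutions of finite rank\<close>

definition free_exact ::
  "('a, 'm) ring_scheme \<Rightarrow> (nat \<Rightarrow> nat) \<Rightarrow> (nat \<Rightarrow> (nat \<Rightarrow> 'a) \<Rightarrow> (nat \<Rightarrow> 'a)) \<Rightarrow> bool"
where
  "free_exact R n d \<longleftrightarrow>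
     (\<forall>j. d j \<in> module_hom R (free_module R (n (Suc j))) (free_module R (n j))) \<and>
     (\<forall>j. d (Suc j) ` carrier (free_module R (n (Suc (Suc j)))) =
          a_kernel (free_module R (n (Suc j))) (free_module R (n j)) (d j))"

lemma (in cring) free_exact_exists:
  assumes "noetherian_ring R" "submodule K R (free_module R n0)"
  obtains n d where "n 0 = n0" "free_exact R n d" "d 0 ` carrier (free_module R (n 1)) = K"
proof -
  have ex: "\<exists>mu. snd mu \<in> module_hom R (free_module R (fst mu)) (free_module R k) \<and>
      snd mu ` carrier (free_module R (fst mu)) = H"
    if H: "submodule H R (free_module R k)" for H k
  proof -
    obtain m u where "linear_map R (free_module R m) (free_module R k) u" "u ` carrier (free_module R m) = H"
      using free_submodule_image[OF assms(1) H] .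
    thus ?thesis by (intro exI[of _ "(m, restrict u (carrier (free_module R m)))"])
        (auto intro!: restrict_module_hom free_module simp del: free_module_simps)
  qed
  \<comment> \<open>A state (k, m, u) is a map u from R^m to R^k. The next state must map onto the
    kernel of u, hence has target rank m. The condition at j = 0 fixes the first target and the
    first image.\<close>
  let ?P = "\<lambda>(j::nat) (k, m, u). u \<in> module_hom R (free_module R m) (free_module R k)
     \<and> (j = 0 \<longrightarrow> k = n0 \<and> u ` carrier (free_module R m) = K)"
  let ?Q = "\<lambda>(j::nat) (k, m, u) (k', m', u'). k' = m \<and>
     u' ` carrier (free_module R m') = a_kernel (free_module R m) (free_module R k) u"
  have "\<exists>f. \<forall>j. ?P j (f j) \<and> ?Q j (f j) (f (Suc j))"
  proof (rule dependent_nat_choice)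
    show "\<exists>x. ?P 0 x" using ex[OF assms(2)] by auto
  next
    fix x j assume "?P j x"
    moreover obtain k m u where x: "x = (k, m, u)" by (cases x)
    ultimately have "submodule (a_kernel (free_module R m) (free_module R k) u) R (free_module R m)"
      by (intro linear_map_kernel_submodule free_module) (auto simp: module_hom_linear_map)
    from ex[OF this] obtain mu where
      "snd mu \<in> module_hom R (free_module R (fst mu)) (free_module R m)"
      "snd mu ` carrier (free_module R (fst mu)) = a_kernel (free_module R m) (free_module R k) u"
      by blast
    thus "\<exists>y. ?P (Suc j) y \<and> ?Q j x y" unfolding x
      by (intro exI[of _ "(m, fst mu, snd mu)"]) (simp add: case_prod_beta del: free_module_simps)
  qed
  then obtain f where f: "\<forall>j. ?P j (f j) \<and> ?Q j (f j) (f (Suc j))" by (rule exE)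
  define n where "n j = fst (f j)" for j
  define m where "m j = fst (snd (f j))" for j
  define d where "d j = snd (snd (f j))" for j
  have f_eq: "f j = (n j, m j, d j)" for j by (simp add: n_def m_def d_def)
  have m: "m j = n (Suc j)" for j using f by (simp add: f_eq)
  show thesis
  proof
    show "n 0 = n0" "d 0 ` carrier (free_module R (n 1)) = K"
      using f[rule_format, of 0] by (simp_all add: f_eq m)
    show "free_exact R n d"
      unfolding free_exact_def using f by (simp add: f_eq m)
  qed
qed

text \<open>Only the augmentation mentions M. The rest is exactness in positive degrees, and M is
  recovered as the cokernel of \<open>d 0\<close>; cochain arguments can thus be carried out for
  \<open>n\<close> and \<open>d\<close> alone, independently of the type of M.\<close>

lemma free_resolution_iff:
  "free_resolution R M n d e \<longleftrightarrow> free_exact R n d \<and> e \<in> module_hom R (free_module R (n 0)) M \<and>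
     e ` carrier (free_module R (n 0)) = carrier M \<and>
     d 0 ` carrier (free_module R (n 1)) = a_kernel (free_module R (n 0)) M e"
  by (auto simp: free_resolution_def free_exact_def)

lemma (in module) free_resolution_exists:
  assumes "noetherian_ring R" "linear_map R (free_module R n0) M e"
    "e ` carrier (free_module R n0) = carrier M"
  shows "\<exists>n d e. free_resolution R M n d e"
proof -
  have "submodule (a_kernel (free_module R n0) M e) R (free_module R n0)"
    by (intro linear_map_kernel_submodule assms R.free_module module_axioms)
  then obtain n d where nd: "n 0 = n0" "free_exact R n d"
    "d 0 ` carrier (free_module R (n 1)) = a_kernel (free_module R n0) M e"
    using R.free_exact_exists[OF assms(1)] by metis
  let ?e = "restrict e (carrier (free_module R n0))"
  have "a_kernel (free_module R n0) M ?e = a_kernel (free_module R n0) M e"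
    by (auto simp: a_kernel_iff)
  moreover have "?e ` carrier (free_module R n0) = carrier M" using assms(3) by simp
  ultimately have "free_resolution R M n d ?e"
    using nd restrict_module_hom[OF assms(2) R.free_module] by (simp add: free_resolution_iff)
  thus ?thesis by blast
qed

lemma (in module) finsum_submodule:
  assumes "submodule H R M" "finite A" "\<And>a. a \<in> A \<Longrightarrow> g a \<in> H"
  shows "finsum M g A \<in> H"
  using assms(2,3)
proof (induction A)
  case (insert a A)
  hence "g \<in> A \<rightarrow> carrier M" "g a \<in> carrier M" using submoduleD(1)[OF assms(1)] by auto
  with insert show ?case using submoduleD(3)[OF assms(1)] by simp
qed (simp add: submoduleD(2)[OF assms(1)])

lemma finitely_generated_free_resolution:
  assumes "noetherian_ring R" "finitely_generated_module R M"
  shows "\<exists>n d e. free_resolution R M n d e"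
proof -
  interpret module R M using assms(2) by (simp add: finitely_generated_module_def)
  obtain A where A: "finite A" "A \<subseteq> carrier M"
    "\<And>x. x \<in> carrier M \<Longrightarrow> \<exists>c\<in>A \<rightarrow> carrier R. x = (\<Oplus>\<^bsub>M\<^esub>a\<in>A. c a \<odot>\<^bsub>M\<^esub> a)"
    using assms(2) unfolding finitely_generated_module_def by blast
  obtain m u where u: "linear_map R (free_module R m) M u" "u ` carrier (free_module R m) = span R M A"
    using finite_span_image[OF A(1,2)] .
  have sub: "submodule (span R M A) R M" by (rule span_submodule[OF A(2)])
  have "x \<in> span R M A" if x: "x \<in> carrier M" for x
  proof -
    obtain c where c: "c \<in> A \<rightarrow> carrier R" "x = (\<Oplus>\<^bsub>M\<^esub>a\<in>A. c a \<odot>\<^bsub>M\<^esub> a)" using A(3)[OF x] by blast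
    show ?thesis unfolding c(2) using c(1) span_superset[of A R M]
      by (intro finsum_submodule[OF sub A(1)] submoduleD(4)[OF sub]) auto
  qed
  hence "span R M A = carrier M" using submoduleD(1)[OF sub] by blast
  thus ?thesis using free_resolution_exists[OF assms(1) u(1)] u(2) by simp
qed

section \<open>Quotient modules and cohomology\<close>

context
  fixes R :: "('a, 'm) ring_scheme" and M :: "('a, 'b, 'n) module_scheme" and H
  assumes module: "module R M" and submodule: "submodule H R M"
begin

interpretation module R M by (rule module)

interpretation H: abelian_subgroup H M
  by (rule abelian_subgroupI3[OF additive_subgroup.intro[OF submodule.axioms(1)[OF submodule]]
        M.abelian_group_axioms])

lemma quotient_module_simps:
  "carrier (quotient_module M H) = (\<lambda>x. H +>\<^bsub>M\<^esub> x) ` carrier M"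
  "zero (quotient_module M H) = H"
  "x \<in> carrier M \<Longrightarrow> y \<in> carrier M \<Longrightarrow>
     (H +>\<^bsub>M\<^esub> x) \<oplus>\<^bsub>quotient_module M H\<^esub> (H +>\<^bsub>M\<^esub> y) = H +>\<^bsub>M\<^esub> (x \<oplus>\<^bsub>M\<^esub> y)"
  "a \<in> carrier R \<Longrightarrow> x \<in> carrier M \<Longrightarrow>
     a \<odot>\<^bsub>quotient_module M H\<^esub> (H +>\<^bsub>M\<^esub> x) = H +>\<^bsub>M\<^esub> (a \<odot>\<^bsub>M\<^esub> x)"
proof -
  show "carrier (quotient_module M H) = (\<lambda>x. H +>\<^bsub>M\<^esub> x) ` carrier M"
    by (auto simp: quotient_module_def A_RCOSETS_def')
  show "zero (quotient_module M H) = H" by (simp add: quotient_module_def)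
  show "(H +>\<^bsub>M\<^esub> x) \<oplus>\<^bsub>quotient_module M H\<^esub> (H +>\<^bsub>M\<^esub> y) = H +>\<^bsub>M\<^esub> (x \<oplus>\<^bsub>M\<^esub> y)"
    if "x \<in> carrier M" "y \<in> carrier M"
    using that by (simp add: quotient_module_def H.a_rcos_sum)
  assume a: "a \<in> carrier R" and x: "x \<in> carrier M"
  \<comment> \<open>Multiplication in the quotient is a union over all representatives. The united
    cosets are all equal and there is at least one, so the union is that coset.\<close>
  have "H +>\<^bsub>M\<^esub> (a \<odot>\<^bsub>M\<^esub> y) = H +>\<^bsub>M\<^esub> (a \<odot>\<^bsub>M\<^esub> x)" if y: "y \<in> H +>\<^bsub>M\<^esub> x" for y
  proof -
    obtain h where h: "h \<in> H" "y = h \<oplus>\<^bsub>M\<^esub> x" using y by (auto simp: a_r_coset_def')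
    have "a \<odot>\<^bsub>M\<^esub> y = a \<odot>\<^bsub>M\<^esub> h \<oplus>\<^bsub>M\<^esub> a \<odot>\<^bsub>M\<^esub> x" using h a x by (simp add: smult_r_distr)
    hence "a \<odot>\<^bsub>M\<^esub> y \<in> H +>\<^bsub>M\<^esub> (a \<odot>\<^bsub>M\<^esub> x)"
      using submoduleD(4)[OF submodule a h(1)] by (auto simp: a_r_coset_def')
    thus ?thesis using a x by (intro a_repr_independence[symmetric] H.a_subgroup) simp_all
  qed
  hence "(\<Union>y\<in>H +>\<^bsub>M\<^esub> x. H +>\<^bsub>M\<^esub> (a \<odot>\<^bsub>M\<^esub> y)) = (\<Union>y\<in>H +>\<^bsub>M\<^esub> x. H +>\<^bsub>M\<^esub> (a \<odot>\<^bsub>M\<^esub> x))"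
    by (intro SUP_cong refl)
  moreover have "H +>\<^bsub>M\<^esub> x \<noteq> {}" using H.a_rcos_self[OF x] by blast
  ultimately have "(\<Union>y\<in>H +>\<^bsub>M\<^esub> x. H +>\<^bsub>M\<^esub> (a \<odot>\<^bsub>M\<^esub> y)) = H +>\<^bsub>M\<^esub> (a \<odot>\<^bsub>M\<^esub> x)" by simp
  thus "a \<odot>\<^bsub>quotient_module M H\<^esub> (H +>\<^bsub>M\<^esub> x) = H +>\<^bsub>M\<^esub> (a \<odot>\<^bsub>M\<^esub> x)"
    by (simp add: quotient_module_def)
qed

lemma quotient_module_eq_zero_iff:
  assumes "x \<in> carrier M"
  shows "H +>\<^bsub>M\<^esub> x = H \<longleftrightarrow> x \<in> H"
  using H.a_rcos_self[OF assms] H.a_rcos_const by auto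

lemma quotient_module: "module R (quotient_module M H)"
proof (rule moduleI)
  show "abelian_group (quotient_module M H)"
  proof (rule abelian_groupI)
    fix X assume "X \<in> carrier (quotient_module M H)"
    then obtain x where "x \<in> carrier M" "X = H +>\<^bsub>M\<^esub> x" by (auto simp: quotient_module_simps(1))
    thus "\<exists>Y\<in>carrier (quotient_module M H). Y \<oplus>\<^bsub>quotient_module M H\<^esub> X = \<zero>\<^bsub>quotient_module M H\<^esub>"
      by (intro bexI[of _ "H +>\<^bsub>M\<^esub> (\<ominus>\<^bsub>M\<^esub> x)"])
        (auto simp: quotient_module_simps M.l_neg quotient_module_eq_zero_iff submoduleD(2)[OF submodule])
  next
    have "H = H +>\<^bsub>M\<^esub> \<zero>\<^bsub>M\<^esub>"
      using quotient_module_eq_zero_iff[of "\<zero>\<^bsub>M\<^esub>"] submoduleD(2)[OF submodule] by simp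
    thus "\<zero>\<^bsub>quotient_module M H\<^esub> \<in> carrier (quotient_module M H)"
      by (auto simp: quotient_module_simps)
    fix X assume "X \<in> carrier (quotient_module M H)"
    then obtain x where x: "x \<in> carrier M" "X = H +>\<^bsub>M\<^esub> x" by (auto simp: quotient_module_simps(1))
    have "(H +>\<^bsub>M\<^esub> \<zero>\<^bsub>M\<^esub>) \<oplus>\<^bsub>quotient_module M H\<^esub> X = X"
      unfolding x(2) using x(1) by (subst quotient_module_simps(3)) simp_all
    thus "\<zero>\<^bsub>quotient_module M H\<^esub> \<oplus>\<^bsub>quotient_module M H\<^esub> X = X"
      using \<open>H = H +>\<^bsub>M\<^esub> \<zero>\<^bsub>M\<^esub>\<close> by (simp add: quotient_module_simps(2))
  qed (auto simp: quotient_module_simps(1,3) M.a_ac)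
qed (auto simp: quotient_module_simps(1,3,4) is_cring smult_l_distr smult_r_distr smult_assoc1)

lemma quotient_module_linear_map: "linear_map R M (quotient_module M H) (\<lambda>x. H +>\<^bsub>M\<^esub> x)"
  by (rule linear_mapI) (auto simp: quotient_module_simps)

end

text \<open>Hom(R^n, R) is a quotient of R^n, so its submodules are finitely generated along with
  those of R^n. Applied to cocycles, this shows that Ext is again finitely generated and can be
  resolved once more.\<close>

lemma (in cring) hom_self_submodule_image:
  assumes "noetherian_ring R" "submodule Z R (hom_module R (free_module R n) (self_module R))"
  obtains m u where "linear_map R (free_module R m) (hom_module R (free_module R n) (self_module R)) u"
    "u ` carrier (free_module R m) = Z"
proof -
  let ?F = "free_module R n" and ?H = "hom_module R (free_module R n) (self_module R)"
  interpret F: module R ?F by (rule free_module)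
  interpret S: module R "self_module R" by (rule self_module)
  interpret H: module R ?H by (rule hom_module) (rule free_module self_module)+
  note ZD = submoduleD[OF assms(2)]
  \<comment> \<open>\<open>ev c\<close> is the pairing with c, x being sent to the sum of the
    products x_k c_k.\<close>
  define ev where "ev c = restrict (\<lambda>x. lincomb (self_module R) c x n) (carrier ?F)" for c
  have c: "c k \<in> carrier R" if "c \<in> carrier ?F" "k < n" for c k
    using that by (rule free_module_coord)
  have ev: "linear_map R ?F ?H ev"
  proof (rule linear_mapI)
    fix x assume x: "x \<in> carrier ?F"
    have "linear_map R ?F (self_module R) (\<lambda>y. lincomb (self_module R) x y n)"
      using c[OF x] by (intro S.lincomb_linear_map) simp
    thus "ev x \<in> carrier ?H" unfolding ev_def by (simp add: restrict_module_hom free_module)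
  next
    fix x y assume xy: "x \<in> carrier ?F" "y \<in> carrier ?F"
    have "lincomb (self_module R) (x \<oplus>\<^bsub>?F\<^esub> y) z l =
        lincomb (self_module R) x z l \<oplus> lincomb (self_module R) y z l"
      if z: "z \<in> carrier ?F" and "l \<le> n" for z l
      using that(2)
    proof (induction l)
      case (Suc l)
      hence "lincomb (self_module R) x z l \<in> carrier R" "lincomb (self_module R) y z l \<in> carrier R"
        using c[OF z] c[OF xy(1)] c[OF xy(2)] S.lincomb_closed[of l _ z] by simp_all
      with Suc c[OF z, of l] c[OF xy(1), of l] c[OF xy(2), of l]
      show ?case by (simp add: free_module_simps r_distr a_ac)
    qed simp
    thus "ev (x \<oplus>\<^bsub>?F\<^esub> y) = ev x \<oplus>\<^bsub>?H\<^esub> ev y" by (auto simp: ev_def fun_eq_iff)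
  next
    fix a x assume a: "a \<in> carrier R" and x: "x \<in> carrier ?F"
    have "lincomb (self_module R) (a \<odot>\<^bsub>?F\<^esub> x) z l = a \<otimes> lincomb (self_module R) x z l"
      if z: "z \<in> carrier ?F" and "l \<le> n" for z l
      using that(2)
    proof (induction l)
      case (Suc l)
      hence "lincomb (self_module R) x z l \<in> carrier R"
        using c[OF z] c[OF x] S.lincomb_closed[of l _ z] by simp_all
      with Suc c[OF z, of l] c[OF x, of l] a
      show ?case by (simp add: free_module_simps r_distr m_lcomm)
    qed (simp add: a)
    thus "ev (a \<odot>\<^bsub>?F\<^esub> x) = a \<odot>\<^bsub>?H\<^esub> ev x" by (auto simp: ev_def fun_eq_iff)
  qed
  have surj: "\<exists>c\<in>carrier ?F. ev c = f" if "f \<in> carrier ?H" for f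
  proof -
    from that have f: "linear_map R ?F (self_module R) f" "f \<in> extensional (carrier ?F)"
      by (auto simp: module_hom_iff)
    \<comment> \<open>A linear form is the pairing with the vector of its values on the standard
      basis.\<close>
    let ?c = "\<lambda>k\<in>{..<n}. f (std_basis R n k)"
    have e: "std_basis R n k \<in> carrier ?F" for k by (simp add: free_module_simps)
    have cF: "?c \<in> carrier ?F" using linear_mapD(1)[OF f(1) e] by (auto simp: free_module_simps)
    have "ev ?c x = f x" for x
    proof (cases "x \<in> carrier ?F")
      case True
      have "lincomb (self_module R) ?c x l = lincomb (self_module R) (\<lambda>k. f (std_basis R n k)) x l"
        if "l \<le> n" for l using that by (induction l) simp_all
      moreover have "f (lincomb ?F (std_basis R n) x n) =
          lincomb (self_module R) (\<lambda>k. f (std_basis R n k)) x n"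
        using c[OF True] e by (intro linear_map_lincomb[OF f(1) free_module self_module])
      ultimately show ?thesis using True free_module_expand[OF True] by (simp add: ev_def)
    next
      case False thus ?thesis using f(2) by (simp add: ev_def extensional_def)
    qed
    thus ?thesis using cF by (auto simp: fun_eq_iff)
  qed
  let ?K = "{c \<in> carrier ?F. ev c \<in> Z}"
  have K: "submodule ?K R ?F"
    using ZD linear_mapD[OF ev] linear_map_zero[OF ev F.module_axioms H.module_axioms]
    by (intro F.submoduleI') (auto simp del: hom_module_simps)
  obtain m u where u: "linear_map R (free_module R m) ?F u" "u ` carrier (free_module R m) = ?K"
    using free_submodule_image[OF assms(1) K] .
  have "(\<lambda>x. ev (u x)) ` carrier (free_module R m) = ev ` ?K"
    by (simp only: u(2)[symmetric] image_image)
  also have "\<dots> = Z"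
  proof
    show "Z \<subseteq> ev ` ?K"
    proof
      fix f assume f: "f \<in> Z"
      with ZD(1) surj obtain c where "c \<in> carrier ?F" "ev c = f" by blast
      with f show "f \<in> ev ` ?K" by blast
    qed
  qed blast
  finally show thesis using that[OF linear_map_comp[OF u(1) ev]] by simp
qed

section \<open>Cocycles, coboundaries and the cohomology of Hom(F, N)\<close>

context
  fixes R :: "('a, 'm) ring_scheme" and N :: "('a, 'c, 'k) module_scheme" and n d
  assumes N: "module R N" and exact: "free_exact R n d"
begin

interpretation N: module R N by (rule N)

lemma free_exact_linear_map: "linear_map R (free_module R (n (Suc j))) (free_module R (n j)) (d j)"
  using exact by (simp add: free_exact_def module_hom_linear_map)

lemma cocycles_iff:
  "f \<in> cocycles R N n d j \<longleftrightarrow> f \<in> module_hom R (free_module R (n j)) N \<and>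
     (\<forall>x\<in>carrier (free_module R (n (Suc j))). f (d j x) = \<zero>\<^bsub>N\<^esub>)"
  by (auto simp: cocycles_def a_kernel_iff hom_complex_def hom_diff_def compose_def fun_eq_iff restrict_def)

lemma coboundaries_0_iff:
  "f \<in> coboundaries R N n d 0 \<longleftrightarrow> f \<in> module_hom R (free_module R (n 0)) N \<and>
     (\<forall>x\<in>carrier (free_module R (n 0)). f x = \<zero>\<^bsub>N\<^esub>)" (is "_ \<longleftrightarrow> ?r")
proof
  assume "f \<in> coboundaries R N n d 0"
  hence "f = (\<lambda>x\<in>carrier (free_module R (n 0)). \<zero>\<^bsub>N\<^esub>)"
    by (simp add: coboundaries_def hom_complex_def)
  thus ?r using linear_map_zero_fun[OF N, where M="free_module R (n 0)"]
    by (auto intro!: restrict_module_hom N.R.free_module)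
next
  assume ?r
  hence "f = (\<lambda>x\<in>carrier (free_module R (n 0)). \<zero>\<^bsub>N\<^esub>)"
    by (intro extensionalityI[of f "carrier (free_module R (n 0))"]) (auto simp: module_hom_iff)
  thus "f \<in> coboundaries R N n d 0" by (simp add: coboundaries_def hom_complex_def)
qed

lemma coboundaries_Suc_iff:
  "f \<in> coboundaries R N n d (Suc j) \<longleftrightarrow> f \<in> module_hom R (free_module R (n (Suc j))) N \<and>
     (\<exists>g. linear_map R (free_module R (n j)) N g \<and>
          (\<forall>x\<in>carrier (free_module R (n (Suc j))). f x = g (d j x)))" (is "_ \<longleftrightarrow> ?r")
proof
  assume "f \<in> coboundaries R N n d (Suc j)"
  then obtain g where g: "g \<in> module_hom R (free_module R (n j)) N"
    "f = compose (carrier (free_module R (n (Suc j)))) g (d j)"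
    by (auto simp: coboundaries_def hom_complex_def hom_diff_def)
  have "linear_map R (free_module R (n (Suc j))) N (\<lambda>x. g (d j x))"
    using linear_map_comp[OF free_exact_linear_map module_hom_linear_map[OF g(1)]] .
  hence "f \<in> module_hom R (free_module R (n (Suc j))) N"
    unfolding g(2) compose_def by (intro restrict_module_hom N.R.free_module)
  moreover have "\<forall>x\<in>carrier (free_module R (n (Suc j))). f x = g (d j x)"
    by (simp add: g(2) compose_def)
  ultimately show ?r using module_hom_linear_map[OF g(1)] by blast
next
  assume ?r
  then obtain g where f: "f \<in> module_hom R (free_module R (n (Suc j))) N"
    and g: "linear_map R (free_module R (n j)) N g"
      "\<forall>x\<in>carrier (free_module R (n (Suc j))). f x = g (d j x)" by blast
  have "f = compose (carrier (free_module R (n (Suc j)))) (restrict g (carrier (free_module R (n j)))) (d j)"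
    using f g linear_mapD(1)[OF free_exact_linear_map[of j]]
    by (intro extensionalityI[of f "carrier (free_module R (n (Suc j)))"])
      (auto simp: compose_def module_hom_iff)
  moreover have "restrict g (carrier (free_module R (n j))) \<in> module_hom R (free_module R (n j)) N"
    using g(1) by (intro restrict_module_hom N.R.free_module)
  ultimately show "f \<in> coboundaries R N n d (Suc j)"
    by (auto simp: coboundaries_def hom_complex_def hom_diff_def)
qed

lemma free_exact_comp: "x \<in> carrier (free_module R (n (Suc (Suc j)))) \<Longrightarrow>
    d j (d (Suc j) x) = \<zero>\<^bsub>free_module R (n j)\<^esub>"
  using exact by (auto simp: free_exact_def a_kernel_iff set_eq_iff)

lemma free_exact_kernel:
  assumes "x \<in> carrier (free_module R (n (Suc j)))" "d j x = \<zero>\<^bsub>free_module R (n j)\<^esub>"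
  obtains y where "y \<in> carrier (free_module R (n (Suc (Suc j))))" "x = d (Suc j) y"
proof -
  have "x \<in> a_kernel (free_module R (n (Suc j))) (free_module R (n j)) (d j)"
    using assms by (simp add: a_kernel_iff)
  also have "\<dots> = d (Suc j) ` carrier (free_module R (n (Suc (Suc j))))"
    using exact by (simp add: free_exact_def)
  finally show thesis using that by blast
qed

interpretation H: module R "hom_module R (free_module R (n j)) N" for j
  by (rule hom_module) (rule N.R.free_module N)+

lemma cocycles_submodule: "submodule (cocycles R N n d j) R (hom_module R (free_module R (n j)) N)"
proof (rule H.submoduleI')
  note D = linear_mapD(1)[OF free_exact_linear_map]
  show "\<zero>\<^bsub>hom_module R (free_module R (n j)) N\<^esub> \<in> cocycles R N n d j"
    using H.zero_closed[of j] D by (simp add: cocycles_iff)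
  fix f assume f: "f \<in> cocycles R N n d j"
  show "f \<oplus>\<^bsub>hom_module R (free_module R (n j)) N\<^esub> g \<in> cocycles R N n d j"
    if "g \<in> cocycles R N n d j" for g
    using H.add.m_closed[of f j g] D f that by (simp add: cocycles_iff)
  show "a \<odot>\<^bsub>hom_module R (free_module R (n j)) N\<^esub> f \<in> cocycles R N n d j" if "a \<in> carrier R" for a
    using H.smult_closed[of a f j] D f that by (simp add: cocycles_iff)
qed (auto simp: cocycles_iff)

lemma coboundaries_submodule:
  "submodule (coboundaries R N n d j) R (hom_module R (free_module R (n j)) N)"
proof (rule H.submoduleI', goal_cases)
  case 1 show ?case by (cases j) (auto simp: coboundaries_0_iff coboundaries_Suc_iff)
next
  case 2 show ?case
  proof (cases j)
    case 0 thus ?thesis using H.zero_closed[of j] by (simp add: coboundaries_0_iff)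
  next
    case (Suc k)
    thus ?thesis using H.zero_closed[of j] linear_map_zero_fun[OF N, where M="free_module R (n k)"]
      by (auto simp: coboundaries_Suc_iff)
  qed
next
  case (3 f g)
  show ?case
  proof (cases j)
    case 0 thus ?thesis using H.add.m_closed[of f j g] 3 by (auto simp: coboundaries_0_iff)
  next
    case (Suc k)
    with 3 obtain f' g' where fg: "linear_map R (free_module R (n k)) N f'" "linear_map R (free_module R (n k)) N g'"
      "\<forall>x\<in>carrier (free_module R (n (Suc k))). f x = f' (d k x)"
      "\<forall>x\<in>carrier (free_module R (n (Suc k))). g x = g' (d k x)"
      by (auto simp: coboundaries_Suc_iff)
    show ?thesis using H.add.m_closed[of f j g] 3 Suc fg(3,4) linear_map_add_fun[OF fg(1,2) N]
      by (auto simp: coboundaries_Suc_iff intro!: exI[of _ "\<lambda>x. f' x \<oplus>\<^bsub>N\<^esub> g' x"])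
  qed
next
  case (4 a f)
  show ?case
  proof (cases j)
    case 0 thus ?thesis using H.smult_closed[of a f j] 4 by (auto simp: coboundaries_0_iff)
  next
    case (Suc k)
    with 4 obtain f' where f: "linear_map R (free_module R (n k)) N f'"
      "\<forall>x\<in>carrier (free_module R (n (Suc k))). f x = f' (d k x)"
      by (auto simp: coboundaries_Suc_iff)
    show ?thesis using H.smult_closed[of a f j] 4 Suc f(2) linear_map_smult_fun[OF f(1) _ N]
      by (auto simp: coboundaries_Suc_iff intro!: exI[of _ "\<lambda>x. a \<odot>\<^bsub>N\<^esub> f' x"])
  qed
qed

lemma coboundaries_subset_cocycles: "coboundaries R N n d j \<subseteq> cocycles R N n d j"
proof (cases j)
  case 0 thus ?thesis
    using linear_mapD(1)[OF free_exact_linear_map]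
    by (auto simp: coboundaries_0_iff cocycles_iff)
next
  case (Suc k)
  show ?thesis
  proof
    fix f assume "f \<in> coboundaries R N n d j"
    with Suc obtain g where f: "f \<in> module_hom R (free_module R (n (Suc k))) N"
      and g: "linear_map R (free_module R (n k)) N g"
      "\<forall>x\<in>carrier (free_module R (n (Suc k))). f x = g (d k x)" by (auto simp: coboundaries_Suc_iff)
    have "f (d (Suc k) x) = \<zero>\<^bsub>N\<^esub>" if x: "x \<in> carrier (free_module R (n (Suc (Suc k))))" for x
      using g(2) linear_mapD(1)[OF free_exact_linear_map x] free_exact_comp[OF x]
        linear_map_zero[OF g(1) N.R.free_module N] by simp
    thus "f \<in> cocycles R N n d j" using f Suc by (simp add: cocycles_iff)
  qed
qed

lemma cocycles_module: "module R (hom_complex R N n j\<lparr>carrier := cocycles R N n d j\<rparr>)"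
  unfolding hom_complex_def by (rule submodule.submodule_is_module[OF cocycles_submodule H.module_axioms])

lemma coboundaries_submodule':
  "submodule (coboundaries R N n d j) R (hom_complex R N n j\<lparr>carrier := cocycles R N n d j\<rparr>)"
proof -
  interpret Z: module R "hom_complex R N n j\<lparr>carrier := cocycles R N n d j\<rparr>" by (rule cocycles_module)
  show ?thesis
    using submoduleD[OF coboundaries_submodule[of j]] coboundaries_subset_cocycles[of j]
    by (intro Z.submoduleI') (simp_all add: hom_complex_def)
qed

lemma hom_cohomology_module: "module R (hom_cohomology R N n d j)"
  unfolding hom_cohomology_def by (rule quotient_module[OF cocycles_module coboundaries_submodule'])

lemma hom_cohomology_annihilator:
  assumes "a \<in> carrier R"
  shows "(\<forall>z\<in>carrier (hom_cohomology R N n d j). a \<odot>\<^bsub>hom_cohomology R N n d j\<^esub> z = \<zero>\<^bsub>hom_cohomology R N n d j\<^esub>)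
    \<longleftrightarrow> (\<forall>f\<in>cocycles R N n d j. a \<odot>\<^bsub>hom_module R (free_module R (n j)) N\<^esub> f \<in> coboundaries R N n d j)"
  using assms quotient_module_eq_zero_iff[OF cocycles_module coboundaries_submodule', of _ j]
    submoduleD(4)[OF cocycles_submodule[of j] assms]
  unfolding hom_cohomology_def
  by (simp add: quotient_module_simps[OF cocycles_module coboundaries_submodule'])
    (simp add: hom_complex_def)

text \<open>The annihilator of the class of f consists of the scalars a for which a f is a
  coboundary. In this form cosets no longer occur.\<close>

lemma Ass_hom_cohomology:
  "Ass R (hom_cohomology R N n d j) = {P. primeideal P R \<and> (\<exists>f\<in>cocycles R N n d j.
     P = {a \<in> carrier R. a \<odot>\<^bsub>hom_module R (free_module R (n j)) N\<^esub> f \<in> coboundaries R N n d j})}"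
proof -
  let ?C = "hom_cohomology R N n d j" and ?Z = "hom_complex R N n j\<lparr>carrier := cocycles R N n d j\<rparr>"
  have "{a \<in> carrier R. a \<odot>\<^bsub>?C\<^esub> (coboundaries R N n d j +>\<^bsub>?Z\<^esub> f) = \<zero>\<^bsub>?C\<^esub>} =
      {a \<in> carrier R. a \<odot>\<^bsub>hom_module R (free_module R (n j)) N\<^esub> f \<in> coboundaries R N n d j}"
    if "f \<in> cocycles R N n d j" for f
    using that quotient_module_eq_zero_iff[OF cocycles_module coboundaries_submodule', of _ j]
      submoduleD(4)[OF cocycles_submodule[of j]]
    unfolding hom_cohomology_def
    by (auto simp: quotient_module_simps[OF cocycles_module coboundaries_submodule'])
      (auto simp: hom_complex_def)
  moreover have "carrier ?C = (\<lambda>f. coboundaries R N n d j +>\<^bsub>?Z\<^esub> f) ` cocycles R N n d j"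
    unfolding hom_cohomology_def by (simp add: quotient_module_simps[OF cocycles_module coboundaries_submodule'])
  ultimately show ?thesis unfolding Ass_def by simp
qed

end

lemma (in cring) hom_cohomology_image:
  assumes "noetherian_ring R" "free_exact R n d"
  obtains m u where "linear_map R (free_module R m) (hom_cohomology R (self_module R) n d j) u"
    "u ` carrier (free_module R m) = carrier (hom_cohomology R (self_module R) n d j)"
proof -
  let ?N = "self_module R"
  let ?Z = "hom_complex R ?N n j\<lparr>carrier := cocycles R ?N n d j\<rparr>"
  let ?B = "coboundaries R ?N n d j"
  note N = self_module
  obtain m u where u: "linear_map R (free_module R m) (hom_module R (free_module R (n j)) ?N) u"
    "u ` carrier (free_module R m) = cocycles R ?N n d j"
    using hom_self_submodule_image[OF assms(1) cocycles_submodule[OF N assms(2)]] .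
  have "linear_map R (free_module R m) ?Z u"
    using u by (auto simp: linear_map_def hom_complex_def)
  from linear_map_comp[OF this quotient_module_linear_map[OF cocycles_module[OF N assms(2)]
        coboundaries_submodule'[OF N assms(2)]]]
  have "linear_map R (free_module R m) (hom_cohomology R ?N n d j) (\<lambda>x. ?B +>\<^bsub>?Z\<^esub> u x)"
    by (simp add: hom_cohomology_def)
  moreover have "(\<lambda>x. ?B +>\<^bsub>?Z\<^esub> u x) ` carrier (free_module R m) = (\<lambda>f. ?B +>\<^bsub>?Z\<^esub> f) ` cocycles R ?N n d j"
    by (simp only: u(2)[symmetric] image_image)
  hence "(\<lambda>x. ?B +>\<^bsub>?Z\<^esub> u x) ` carrier (free_module R m) = carrier (hom_cohomology R ?N n d j)"
    by (simp add: hom_cohomology_def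
        quotient_module_simps(1)[OF cocycles_module[OF N assms(2)] coboundaries_submodule'[OF N assms(2)]])
  ultimately show thesis using that by blast
qed

text \<open>Brings out the resolution selected by \<open>SOME\<close>. The statements about
  cohomology hold for every resolution, hence for the selected one.\<close>

lemma Ext_eq_hom_cohomology:
  assumes "i \<ge> 0" "\<exists>n d e. free_resolution R M n d e"
  obtains n d e where "free_resolution R M n d e" "Ext R i M N = hom_cohomology R N n d (nat i)"
proof -
  have "\<exists>nd. (\<lambda>(n, d). \<exists>e. free_resolution R M n d e) nd" using assms(2) by auto
  hence "case (SOME (n, d). \<exists>e. free_resolution R M n d e) of (n, d) \<Rightarrow> \<exists>e. free_resolution R M n d e"
    by (rule someI_ex)
  moreover obtain n d where nd: "(SOME (n, d). \<exists>e. free_resolution R M n d e) = (n, d)"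
    by fastforce
  ultimately show thesis using that assms(1) by (auto simp: Ext_def)
qed

section \<open>Ideals\<close>

definition ideal_adjoin :: "('a, 'm) ring_scheme \<Rightarrow> 'a set \<Rightarrow> 'a \<Rightarrow> 'a set" where
  "ideal_adjoin R J x = {j \<oplus>\<^bsub>R\<^esub> x \<otimes>\<^bsub>R\<^esub> r | j r. j \<in> J \<and> r \<in> carrier R}"

text \<open>The ideal (J : a). The equation \<open>colon R J a = J\<close> is the form in which a is
  said to be a nonzerodivisor modulo J.\<close>

definition colon :: "('a, 'm) ring_scheme \<Rightarrow> 'a set \<Rightarrow> 'a \<Rightarrow> 'a set" where
  "colon R J a = {r \<in> carrier R. a \<otimes>\<^bsub>R\<^esub> r \<in> J}"

text \<open>The associated primes of \<open>R/J\<close>.\<close>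

definition assoc_primes :: "('a, 'm) ring_scheme \<Rightarrow> 'a set \<Rightarrow> 'a set set" where
  "assoc_primes R J = {P. primeideal P R \<and> (\<exists>z\<in>carrier R. P = colon R J z)}"

lemma idealD:
  assumes "ideal J R"
  shows "x \<in> J \<Longrightarrow> x \<in> carrier R" "\<zero>\<^bsub>R\<^esub> \<in> J" "x \<in> J \<Longrightarrow> y \<in> J \<Longrightarrow> x \<oplus>\<^bsub>R\<^esub> y \<in> J"
    "a \<in> carrier R \<Longrightarrow> x \<in> J \<Longrightarrow> a \<otimes>\<^bsub>R\<^esub> x \<in> J" "a \<in> carrier R \<Longrightarrow> x \<in> J \<Longrightarrow> x \<otimes>\<^bsub>R\<^esub> a \<in> J"
proof -
  interpret ideal J R by fact
  show "x \<in> J \<Longrightarrow> x \<in> carrier R" "\<zero>\<^bsub>R\<^esub> \<in> J" "x \<in> J \<Longrightarrow> y \<in> J \<Longrightarrow> x \<oplus>\<^bsub>R\<^esub> y \<in> J"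
    "a \<in> carrier R \<Longrightarrow> x \<in> J \<Longrightarrow> a \<otimes>\<^bsub>R\<^esub> x \<in> J" "a \<in> carrier R \<Longrightarrow> x \<in> J \<Longrightarrow> x \<otimes>\<^bsub>R\<^esub> a \<in> J"
    by (auto simp: I_l_closed I_r_closed)
qed

context cring
begin

lemma idealI':
  assumes "J \<subseteq> carrier R" "\<zero> \<in> J" "\<And>x y. x \<in> J \<Longrightarrow> y \<in> J \<Longrightarrow> x \<oplus> y \<in> J"
    "\<And>a x. a \<in> carrier R \<Longrightarrow> x \<in> J \<Longrightarrow> a \<otimes> x \<in> J"
  shows "ideal J R"
proof (rule idealI)
  show "subgroup J (add_monoid R)"
  proof (rule add.subgroupI)
    fix x assume x: "x \<in> J"
    hence "\<ominus> x = (\<ominus> \<one>) \<otimes> x" using assms(1) by (auto simp: l_minus)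
    thus "\<ominus> x \<in> J" using assms(4)[OF _ x] by simp
  qed (use assms in auto)
  show "a \<in> J \<Longrightarrow> x \<in> carrier R \<Longrightarrow> a \<otimes> x \<in> J" for a x
    using assms(1,4) m_comm[of a x] by auto
qed (use assms ring_axioms in auto)

lemma ideal_minus:
  assumes "ideal J R" "x \<in> J" "y \<in> J"
  shows "x \<ominus> y \<in> J"
proof -
  interpret ideal J R by fact
  show ?thesis using assms by (simp add: minus_eq)
qed

lemma ideal_add_cancel:
  assumes "ideal J R" "x \<in> J" "y \<in> carrier R" "x \<oplus> y \<in> J"
  shows "y \<in> J"
proof -
  have "y = (x \<oplus> y) \<ominus> x" using idealD(1)[OF assms(1,2)] assms(3) by algebra
  thus ?thesis using ideal_minus[OF assms(1,4,2)] by simp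
qed

lemma colon_ideal:
  assumes "ideal J R" "a \<in> carrier R"
  shows "ideal (colon R J a) R"
  using ideal.helper_max_prime[OF assms(1) is_cring assms(2)] by (simp add: colon_def)

lemma colon_superset:
  assumes "ideal J R" "a \<in> carrier R"
  shows "J \<subseteq> colon R J a"
  using idealD[OF assms(1)] assms(2) by (auto simp: colon_def)

lemma ideal_adjoin_ideal:
  assumes "ideal J R" "x \<in> carrier R"
  shows "ideal (ideal_adjoin R J x) R"
proof (rule idealI')
  note D = idealD[OF assms(1)]
  show "ideal_adjoin R J x \<subseteq> carrier R" using D(1) assms(2) by (auto simp: ideal_adjoin_def)
  have "\<zero> = \<zero> \<oplus> x \<otimes> \<zero>" using assms(2) by simp
  thus "\<zero> \<in> ideal_adjoin R J x" using D(2) unfolding ideal_adjoin_def by blast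
  fix y assume "y \<in> ideal_adjoin R J x"
  then obtain j r where y: "y = j \<oplus> x \<otimes> r" "j \<in> J" "r \<in> carrier R" by (auto simp: ideal_adjoin_def)
  have j: "j \<in> carrier R" using D(1) y(2) .
  show "y \<oplus> z \<in> ideal_adjoin R J x" if "z \<in> ideal_adjoin R J x" for z
  proof -
    obtain k s where z: "z = k \<oplus> x \<otimes> s" "k \<in> J" "s \<in> carrier R" using \<open>z \<in> _\<close> by (auto simp: ideal_adjoin_def)
    have "y \<oplus> z = (j \<oplus> k) \<oplus> x \<otimes> (r \<oplus> s)" using y z j D(1)[OF z(2)] assms(2) by algebra
    thus ?thesis using D(3)[OF y(2) z(2)] y(3) z(3) unfolding ideal_adjoin_def by blast
  qed
  show "a \<otimes> y \<in> ideal_adjoin R J x" if a: "a \<in> carrier R" for a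
  proof -
    have "a \<otimes> y = a \<otimes> j \<oplus> x \<otimes> (a \<otimes> r)" using y j a assms(2) by algebra
    thus ?thesis using D(4)[OF a y(2)] y(3) a unfolding ideal_adjoin_def by blast
  qed
qed

lemma ideal_adjoin_superset:
  assumes "ideal J R" "x \<in> carrier R"
  shows "J \<subseteq> ideal_adjoin R J x"
proof
  fix j assume j: "j \<in> J"
  hence "j = j \<oplus> x \<otimes> \<zero>" using assms idealD(1)[OF assms(1)] by simp
  thus "j \<in> ideal_adjoin R J x" using j unfolding ideal_adjoin_def by blast
qed

lemma ideal_adjoin_multiple:
  assumes "ideal J R" "x \<in> carrier R" "r \<in> carrier R"
  shows "x \<otimes> r \<in> ideal_adjoin R J x"
proof -
  have "x \<otimes> r = \<zero> \<oplus> x \<otimes> r" using assms by simp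
  thus ?thesis using assms(3) idealD(2)[OF assms(1)] unfolding ideal_adjoin_def by blast
qed

lemma ideal_adjoin_self:
  assumes "ideal J R" "x \<in> carrier R"
  shows "x \<in> ideal_adjoin R J x"
  using ideal_adjoin_multiple[OF assms one_closed] assms(2) by simp

text \<open>An infinite strictly ascending chain of ideals would contain its own union. The
  induction hypothesis is thus available for all strictly larger ideals.\<close>

lemma noetherian_ideal_induct [consumes 2, case_names step]:
  assumes "noetherian_ring R" "ideal J R"
    and step: "\<And>J. ideal J R \<Longrightarrow> (\<And>I. ideal I R \<Longrightarrow> J \<subset> I \<Longrightarrow> P I) \<Longrightarrow> P J"
  shows "P J"
proof -
  have "wf {(I, J). ideal I R \<and> ideal J R \<and> J \<subset> I}"
  proof (rule ccontr)
    assume "\<not> ?thesis"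
    then obtain f where f: "\<forall>i::nat. (f (Suc i), f i) \<in> {(I, J). ideal I R \<and> ideal J R \<and> J \<subset> I}"
      unfolding wf_iff_no_infinite_down_chain by blast
    hence sub: "f i \<subset> f (Suc i)" and id: "ideal (f i) R" for i by auto
    have mono: "f i \<subseteq> f j" if "i \<le> j" for i j
      by (rule lift_Suc_mono_le[of f, OF _ that]) (use sub in blast)
    have "f i \<subseteq> f j \<or> f j \<subseteq> f i" for i j
      using mono[of i j] mono[of j i] by linarith
    hence "subset.chain {I. ideal I R} (range f)"
      using id by (auto simp: subset_chain_def)
    hence "\<Union> (range f) \<in> range f"
      by (intro noetherian_ring.ideal_chain_is_trivial[OF assms(1)]) auto
    then obtain k where "\<Union> (range f) = f k" by auto
    thus False using sub[of k] by blast
  qed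
  thus ?thesis using assms(2)
  proof (induction J rule: wf_induct_rule)
    case (less J)
    show ?case
    proof (rule step[OF less.prems])
      fix I assume "ideal I R" "J \<subset> I"
      thus "P I" using less.IH[of I] less.prems by simp
    qed
  qed
qed

section \<open>Associated primes and prime avoidance\<close>

lemma not_primeE:
  assumes "ideal J R" "\<not> primeideal J R" "J \<noteq> carrier R"
  obtains a b where "a \<in> carrier R" "b \<in> carrier R" "a \<otimes> b \<in> J" "a \<notin> J" "b \<notin> J"
  using ideal.primeidealCD[OF assms(1) is_cring assms(2)] assms(3) by metis

lemma primeD:
  assumes "primeideal P R"
  shows "ideal P R" "\<one> \<notin> P" "a \<in> carrier R \<Longrightarrow> b \<in> carrier R \<Longrightarrow> a \<otimes> b \<in> P \<Longrightarrow> a \<in> P \<or> b \<in> P"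
proof -
  interpret primeideal P R by fact
  show "ideal P R" by (rule is_ideal)
  show "\<one> \<notin> P" using I_notcarr one_imp_carrier by blast
  show "a \<in> carrier R \<Longrightarrow> b \<in> carrier R \<Longrightarrow> a \<otimes> b \<in> P \<Longrightarrow> a \<in> P \<or> b \<in> P" by (rule I_prime)
qed

text \<open>This is the inclusion of associated primes for 0 -> R/(J:a) -> R/J -> R/(J+aR) -> 0, the
  first map being multiplication by a. Let P be the annihilator of z in R/J. If some z r with r
  outside P is congruent to a c modulo J, then P is the annihilator of c in R/(J:a); otherwise it is
  the annihilator of z in R/(J+aR).\<close>

lemma assoc_primes_split:
  assumes J: "ideal J R" and a: "a \<in> carrier R"
  shows "assoc_primes R J \<subseteq> assoc_primes R (colon R J a) \<union> assoc_primes R (ideal_adjoin R J a)"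
proof
  note D = idealD[OF J]
  fix P assume "P \<in> assoc_primes R J"
  then obtain z where P: "primeideal P R" and z: "z \<in> carrier R" and Pz: "P = colon R J z"
    by (auto simp: assoc_primes_def)
  show "P \<in> assoc_primes R (colon R J a) \<union> assoc_primes R (ideal_adjoin R J a)"
  proof (cases "\<exists>r\<in>carrier R. r \<notin> P \<and> z \<otimes> r \<in> ideal_adjoin R J a")
    case True
    then obtain r j c where r: "r \<in> carrier R" "r \<notin> P" and j: "j \<in> J" and c: "c \<in> carrier R"
      and eq: "z \<otimes> r = j \<oplus> a \<otimes> c" by (auto simp: ideal_adjoin_def)
    have jR: "j \<in> carrier R" using D(1)[OF j] .
    have "t \<in> P \<longleftrightarrow> t \<in> colon R (colon R J a) c" if t: "t \<in> carrier R" for t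
    proof -
      have act: "a \<otimes> (c \<otimes> t) \<in> carrier R" using a c t by simp
      have "t \<in> P \<longleftrightarrow> r \<otimes> t \<in> P"
        using primeD(3)[OF P r(1) t] r(2) idealD(4)[OF primeD(1)[OF P] r(1)] by blast
      also have "\<dots> \<longleftrightarrow> z \<otimes> r \<otimes> t \<in> J" using r(1) t z by (simp add: Pz colon_def m_assoc)
      also have "z \<otimes> r \<otimes> t = j \<otimes> t \<oplus> a \<otimes> (c \<otimes> t)"
        unfolding eq using jR c t a by algebra
      also have "\<dots> \<in> J \<longleftrightarrow> a \<otimes> (c \<otimes> t) \<in> J"
        using ideal_add_cancel[OF J D(5)[OF t j] act] D(3)[OF D(5)[OF t j], of "a \<otimes> (c \<otimes> t)"] by blast
      finally show ?thesis using a c t by (simp add: colon_def)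
    qed
    hence "P = colon R (colon R J a) c" using idealD(1)[OF primeD(1)[OF P]] by (auto simp: colon_def)
    thus ?thesis using P c by (auto simp: assoc_primes_def)
  next
    case False
    hence "P = colon R (ideal_adjoin R J a) z"
      using ideal_adjoin_superset[OF J a] by (auto simp: Pz colon_def)
    thus ?thesis using P z by (auto simp: assoc_primes_def)
  qed
qed

text \<open>A prime J is its only associated prime. Otherwise a b lies in J with a and b outside,
  and both ideals of \<open>assoc_primes_split\<close> are strictly larger, since (J:a) contains
  b.\<close>

lemma finite_assoc_primes:
  assumes "noetherian_ring R" "ideal J R"
  shows "finite (assoc_primes R J)"
  using assms
proof (induction J rule: noetherian_ideal_induct)
  case (step J)
  note D = idealD[OF step(1)]
  consider "J = carrier R" | "primeideal J R" | "\<not> primeideal J R" "J \<noteq> carrier R" by blast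
  thus ?case
  proof cases
    case 1
    have "P \<notin> assoc_primes R J" for P
      using primeD(2)[of P] by (auto simp: 1 assoc_primes_def colon_def)
    hence "assoc_primes R J = {}" by blast
    thus ?thesis by simp
  next
    case 2
    have "P = J" if P: "P \<in> assoc_primes R J" for P
    proof -
      obtain z where z: "primeideal P R" "z \<in> carrier R" "P = colon R J z"
        using P by (auto simp: assoc_primes_def)
      have "z \<notin> J" using primeD(2)[OF z(1)] D(5)[of \<one> z] z(2,3) by (auto simp: colon_def)
      thus ?thesis using z(3) primeD(3)[OF 2 z(2)] D(1) D(4)[OF z(2)] by (auto simp: colon_def)
    qed
    hence "assoc_primes R J \<subseteq> {J}" by blast
    thus ?thesis using finite_subset by blast
  next
    case 3
    obtain a b where ab: "a \<in> carrier R" "b \<in> carrier R" "a \<otimes> b \<in> J" "a \<notin> J" "b \<notin> J"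
      using not_primeE[OF step(1) 3] .
    have "J \<subset> colon R J a" using colon_superset[OF step(1) ab(1)] ab by (auto simp: colon_def)
    moreover have "J \<subset> ideal_adjoin R J a"
      using ideal_adjoin_superset[OF step(1) ab(1)] ideal_adjoin_self[OF step(1) ab(1)] ab(4) by blast
    ultimately have "finite (assoc_primes R (colon R J a) \<union> assoc_primes R (ideal_adjoin R J a))"
      using step colon_ideal ideal_adjoin_ideal ab(1) by simp
    thus ?thesis using assoc_primes_split[OF step(1) ab(1)] finite_subset by blast
  qed
qed

text \<open>A maximal annihilator of a nonzero element is prime: if a b kills z but neither factor
  does, then the annihilator of z a is larger, as it contains b.\<close>

lemma colon_subset_assoc_prime:
  assumes "noetherian_ring R" "ideal J R" "z \<in> carrier R" "z \<notin> J"
  obtains P where "P \<in> assoc_primes R J" "colon R J z \<subseteq> P"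
proof -
  have "\<exists>P\<in>assoc_primes R J. I \<subseteq> P"
    if "ideal I R" "\<exists>z\<in>carrier R. z \<notin> J \<and> I = colon R J z" for I
    using assms(1) that
  proof (induction I rule: noetherian_ideal_induct)
    case (step I)
    then obtain z where z: "z \<in> carrier R" "z \<notin> J" "I = colon R J z" by blast
    show ?case
    proof (cases "primeideal I R")
      case True thus ?thesis using z by (auto simp: assoc_primes_def)
    next
      case False
      have "\<one> \<notin> I" using z by (simp add: colon_def)
      hence "I \<noteq> carrier R" by auto
      then obtain a b where ab: "a \<in> carrier R" "b \<in> carrier R" "a \<otimes> b \<in> I" "a \<notin> I" "b \<notin> I"
        using not_primeE[OF step(1) False] by metis
      have za: "z \<otimes> a \<in> carrier R" "z \<otimes> a \<notin> J" using z ab by (auto simp: colon_def)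
      have "I \<subseteq> colon R J (z \<otimes> a)"
      proof
        fix r assume r: "r \<in> I"
        hence rR: "r \<in> carrier R" "z \<otimes> r \<in> J" using z(3) by (auto simp: colon_def)
        have "z \<otimes> a \<otimes> r = a \<otimes> (z \<otimes> r)" using z(1) ab(1) rR(1) by algebra
        thus "r \<in> colon R J (z \<otimes> a)" using idealD(4)[OF assms(2) ab(1) rR(2)] rR(1) by (simp add: colon_def)
      qed
      moreover have "b \<in> colon R J (z \<otimes> a)" using ab z by (simp add: colon_def m_assoc)
      ultimately have "I \<subset> colon R J (z \<otimes> a)" using ab(5) by blast
      with step(2)[OF colon_ideal[OF assms(2) za(1)] this] za show ?thesis by blast
    qed
  qed
  from this[OF colon_ideal[OF assms(2,3)]] assms(3,4) that show thesis by blast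
qed

lemma prime_avoidance:
  assumes "finite S" "\<And>P. P \<in> S \<Longrightarrow> primeideal P R" "ideal A R" "\<And>P. P \<in> S \<Longrightarrow> \<not> A \<subseteq> P"
  obtains a where "a \<in> A" "\<And>P. P \<in> S \<Longrightarrow> a \<notin> P"
proof -
  note A = idealD[OF assms(3)]
  have "\<exists>a\<in>A. \<forall>P\<in>S. a \<notin> P"
    using assms(1,2,4)
  proof (induction S rule: finite_psubset_induct)
    case (psubset S)
    show ?case
    proof (cases "\<exists>P\<in>S. \<exists>Q\<in>S. P \<noteq> Q \<and> P \<subseteq> Q")
      \<comment> \<open>A prime contained in another one may be dropped, as avoiding the larger
        avoids both. Afterwards no two members of \<open>S\<close> are comparable.\<close>
      case True
      then obtain P Q where PQ: "P \<in> S" "Q \<in> S" "P \<noteq> Q" "P \<subseteq> Q" by blast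
      have "S - {P} \<subset> S" using PQ by blast
      then obtain a where a: "a \<in> A" "\<forall>P'\<in>S - {P}. a \<notin> P'"
        using psubset.IH[of "S - {P}"] psubset.prems by blast
      have "a \<notin> Q" using a(2) PQ by blast
      hence "\<forall>P'\<in>S. a \<notin> P'" using a(2) PQ(4) by blast
      thus ?thesis using a(1) by blast
    next
      case False
      show ?thesis
      proof (cases "S = {}")
        case True thus ?thesis using A(2) by blast
      next
        case nonempty: False
        then obtain Q where Q: "Q \<in> S" by blast
        have Qp: "primeideal Q R" using psubset.prems(1)[OF Q] .
        obtain a where a: "a \<in> A" "\<forall>P\<in>S - {Q}. a \<notin> P"
          using psubset.IH[of "S - {Q}"] psubset.prems Q by blast
        show ?thesis
        proof (cases "a \<in> Q")
          case aQ: True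
          \<comment> \<open>When the candidate a lies in Q, it is corrected by some b in A that lies
            in all the other primes but not in Q; then a + b avoids every prime. Such b is a product
            of an element of A outside Q with one factor from each other prime, chosen outside
            Q.\<close>
          have "\<exists>b\<in>A. b \<notin> Q \<and> (\<forall>P\<in>T. b \<in> P)" if "finite T" "T \<subseteq> S - {Q}" for T
            using that
          proof (induction T)
            case empty thus ?case using psubset.prems(2)[OF Q] by blast
          next
            case (insert P T)
            then obtain b where b: "b \<in> A" "b \<notin> Q" "\<forall>P\<in>T. b \<in> P" by blast
            have P: "P \<in> S" "P \<noteq> Q" and T: "T \<subseteq> S" using insert.prems by auto
            have "\<not> P \<subseteq> Q" using False P Q by metis
            then obtain x where x: "x \<in> P" "x \<notin> Q" by blast
            have Pi: "ideal P R" using primeD(1)[OF psubset.prems(1)[OF P(1)]] .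
            have xR: "x \<in> carrier R" and bR: "b \<in> carrier R" using idealD(1)[OF Pi x(1)] A(1)[OF b(1)] .
            have "x \<otimes> b \<in> A" using A(4)[OF xR b(1)] .
            moreover have "x \<otimes> b \<notin> Q" using primeD(3)[OF Qp xR bR] x(2) b(2) by blast
            moreover have "x \<otimes> b \<in> P" using idealD(5)[OF Pi bR x(1)] .
            moreover have "x \<otimes> b \<in> P'" if "P' \<in> T" for P'
            proof -
              have "P' \<in> S" "b \<in> P'" using that T b(3) by auto
              thus ?thesis using idealD(4)[OF primeD(1)[OF psubset.prems(1)] xR] by simp
            qed
            ultimately show ?case by blast
          qed
          from this[of "S - {Q}"] psubset.hyps obtain b where
            b: "b \<in> A" "b \<notin> Q" "\<forall>P\<in>S - {Q}. b \<in> P" by auto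
          have aR: "a \<in> carrier R" "b \<in> carrier R" using A(1) a(1) b(1) by blast+
          have "a \<oplus> b \<notin> P" if P: "P \<in> S" for P
          proof (cases "P = Q")
            case True
            thus ?thesis using ideal_add_cancel[OF primeD(1)[OF Qp] aQ aR(2)] b(2) by blast
          next
            case False
            hence "b \<in> P" "a \<notin> P" using P a(2) b(3) by blast+
            thus ?thesis using ideal_add_cancel[OF primeD(1)[OF psubset.prems(1)[OF P]] _ aR(1), of b] aR
              by (auto simp: a_comm)
          qed
          thus ?thesis using A(3)[OF a(1) b(1)] by blast
        qed (use a in blast)
      qed
    qed
  qed
  thus thesis using that by blast
qed

text \<open>A zero divisor modulo J kills some z outside J, so it lies in an associated prime
  containing (J:z). Since there are finitely many associated primes, prime avoidance finds an
  element of A outside all of them.\<close>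

lemma regular_element_or_assoc_prime:
  assumes "noetherian_ring R" "ideal J R" "ideal A R"
    and "\<And>P. P \<in> assoc_primes R J \<Longrightarrow> \<not> A \<subseteq> P"
  obtains a where "a \<in> A" "colon R J a = J"
proof -
  obtain a where a: "a \<in> A" "\<And>P. P \<in> assoc_primes R J \<Longrightarrow> a \<notin> P"
    using prime_avoidance[OF finite_assoc_primes[OF assms(1,2)] _ assms(3,4)]
    by (auto simp: assoc_primes_def)
  have aR: "a \<in> carrier R" using idealD(1)[OF assms(3) a(1)] .
  have "z \<in> J" if z: "z \<in> carrier R" "a \<otimes> z \<in> J" for z
  proof (rule ccontr)
    assume "z \<notin> J"
    then obtain P where P: "P \<in> assoc_primes R J" "colon R J z \<subseteq> P"
      using colon_subset_assoc_prime[OF assms(1,2) z(1)] by blast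
    have "a \<in> colon R J z" using z aR by (simp add: colon_def m_comm)
    thus False using a(2)[OF P(1)] P(2) by blast
  qed
  hence "colon R J a = J" using colon_superset[OF assms(2) aR] by (auto simp: colon_def)
  thus thesis using that a(1) by blast
qed

end

text \<open>
  \<open>J\<close> is generated by a sequence of \<open>l\<close> elements of \<open>A\<close>, each of which is a nonzerodivisor modulo its
  predecessors.  The quotient \<open>R/J\<close> may vanish.
\<close>

inductive regular_chain :: "('a, 'm) ring_scheme \<Rightarrow> 'a set \<Rightarrow> nat \<Rightarrow> 'a set \<Rightarrow> bool" for R A where
  zero: "regular_chain R A 0 {\<zero>\<^bsub>R\<^esub>}"
| Suc: "regular_chain R A l J \<Longrightarrow> x \<in> A \<Longrightarrow> colon R J x = J \<Longrightarrow>
    regular_chain R A (Suc l) (ideal_adjoin R J x)"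

lemma (in cring) regular_chain_ideal:
  assumes "regular_chain R A l J" "A \<subseteq> carrier R"
  shows "ideal J R"
  using assms(1)
proof induction
  case zero show ?case by (rule zeroideal)
next
  case (Suc l J x) thus ?case using assms(2) by (intro ideal_adjoin_ideal) auto
qed

section \<open>Cochains with values modulo an ideal\<close>

text \<open>
  As the modules in the resolution are free, \<open>R/J\<close>-valued cochains are represented by \<open>R\<close>-valued ones.
\<close>

definition cocycle_mod ::
  "('a, 'm) ring_scheme \<Rightarrow> (nat \<Rightarrow> nat) \<Rightarrow> (nat \<Rightarrow> (nat \<Rightarrow> 'a) \<Rightarrow> (nat \<Rightarrow> 'a)) \<Rightarrow> 'a set \<Rightarrow> nat
    \<Rightarrow> ((nat \<Rightarrow> 'a) \<Rightarrow> 'a) \<Rightarrow> bool"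
where
  "cocycle_mod R n d J j f \<longleftrightarrow> linear_map R (free_module R (n j)) (self_module R) f \<and>
     (\<forall>x\<in>carrier (free_module R (n (Suc j))). f (d j x) \<in> J)"

definition coboundary_mod ::
  "('a, 'm) ring_scheme \<Rightarrow> (nat \<Rightarrow> nat) \<Rightarrow> (nat \<Rightarrow> (nat \<Rightarrow> 'a) \<Rightarrow> (nat \<Rightarrow> 'a)) \<Rightarrow> 'a set \<Rightarrow> nat
    \<Rightarrow> ((nat \<Rightarrow> 'a) \<Rightarrow> 'a) \<Rightarrow> bool"
where
  "coboundary_mod R n d J j f \<longleftrightarrow>
     (case j of
        0 \<Rightarrow> \<forall>x\<in>carrier (free_module R (n 0)). f x \<in> J
      | Suc k \<Rightarrow> \<exists>g. linear_map R (free_module R (n k)) (self_module R) g \<and>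
          (\<forall>x\<in>carrier (free_module R (n (Suc k))). f x \<ominus>\<^bsub>R\<^esub> g (d k x) \<in> J))"

definition cohomology_mod_primes ::
  "('a, 'm) ring_scheme \<Rightarrow> (nat \<Rightarrow> nat) \<Rightarrow> (nat \<Rightarrow> (nat \<Rightarrow> 'a) \<Rightarrow> (nat \<Rightarrow> 'a)) \<Rightarrow> 'a set \<Rightarrow> nat
    \<Rightarrow> 'a set set"
where
  "cohomology_mod_primes R n d J j = {P. primeideal P R \<and> (\<exists>f. cocycle_mod R n d J j f \<and>
     P = {a \<in> carrier R. coboundary_mod R n d J j (\<lambda>x. a \<otimes>\<^bsub>R\<^esub> f x)})}"

text \<open>The annihilator of the resolved module, expressed through the complex alone;
  \<open>coker_annihilator_resolution\<close> makes the link.\<close>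

definition coker_annihilator ::
  "('a, 'm) ring_scheme \<Rightarrow> (nat \<Rightarrow> nat) \<Rightarrow> (nat \<Rightarrow> (nat \<Rightarrow> 'a) \<Rightarrow> (nat \<Rightarrow> 'a)) \<Rightarrow> 'a set"
where
  "coker_annihilator R n d = {a \<in> carrier R. \<forall>x\<in>carrier (free_module R (n 0)).
     a \<odot>\<^bsub>free_module R (n 0)\<^esub> x \<in> d 0 ` carrier (free_module R (n 1))}"

locale free_exact_complex = cring R for R :: "('a, 'm) ring_scheme" (structure) +
  fixes n :: "nat \<Rightarrow> nat" and d :: "nat \<Rightarrow> (nat \<Rightarrow> 'a) \<Rightarrow> (nat \<Rightarrow> 'a)"
  assumes exact: "free_exact R n d"
begin

abbreviation "F j \<equiv> free_module R (n j)"

sublocale F: module R "F j" for j by (rule free_module)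

sublocale S: module R "self_module R" by (rule self_module)

lemmas d_linear = free_exact_linear_map[OF self_module exact]
lemmas d_closed = linear_mapD(1)[OF d_linear]
lemmas d_d = free_exact_comp[OF self_module exact]
lemmas d_kernel = free_exact_kernel[OF self_module exact]

lemma linear_form_closed:
  "linear_map R (F j) (self_module R) f \<Longrightarrow> x \<in> carrier (F j) \<Longrightarrow> f x \<in> carrier R"
  by (drule (1) linear_mapD(1)) simp

lemma linear_form_zero: "linear_map R (F j) (self_module R) f \<Longrightarrow> f \<zero>\<^bsub>F j\<^esub> = \<zero>"
  using linear_map_zero[OF _ free_module self_module] by fastforce

text \<open>
  Multiplication by an annihilator of the cokernel is homotopic to zero; only one half of the
  homotopy is recorded.
\<close>

lemma annihilator_homotopy:
  assumes a: "a \<in> coker_annihilator R n d"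
  shows "\<exists>h. linear_map R (F j) (F (Suc j)) h \<and>
    (\<forall>x\<in>carrier (F (Suc j)). d j (h (d j x)) = a \<odot>\<^bsub>F j\<^esub> d j x)"
proof (induction j)
  case 0
  have aR: "a \<in> carrier R" using a by (simp add: coker_annihilator_def)
  obtain h where h: "linear_map R (F 0) (F (Suc 0)) h" "\<And>x. x \<in> carrier (F 0) \<Longrightarrow> d 0 (h x) = a \<odot>\<^bsub>F 0\<^esub> x"
  proof (rule F.free_module_choose[of "n 0" "Suc 0" "\<lambda>x u. d 0 u = a \<odot>\<^bsub>F 0\<^esub> x"])
    show "\<exists>u\<in>carrier (F (Suc 0)). d 0 u = a \<odot>\<^bsub>F 0\<^esub> x" if "x \<in> carrier (F 0)" for x
      using a that unfolding coker_annihilator_def by (auto simp: image_iff) metis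
  qed (use aR in \<open>simp_all add: linear_mapD[OF d_linear] F.smult_r_distr F.smult_commute\<close>)
  thus ?case using d_closed[of _ 0] by auto
next
  case (Suc j)
  have aR: "a \<in> carrier R" using a by (simp add: coker_annihilator_def)
  from Suc obtain h where h: "linear_map R (F j) (F (Suc j)) h"
    "\<And>x. x \<in> carrier (F (Suc j)) \<Longrightarrow> d j (h (d j x)) = a \<odot>\<^bsub>F j\<^esub> d j x" by blast
  \<comment> \<open>As d h d = a d, the map g = a - h d takes values in the kernel of d, so it lifts
    through the next differential. On boundaries h d vanishes, which gives the same relation one
    degree higher.\<close>
  define g where "g x = a \<odot>\<^bsub>F (Suc j)\<^esub> x \<ominus>\<^bsub>F (Suc j)\<^esub> h (d j x)" for x
  have hd: "linear_map R (F (Suc j)) (F (Suc j)) (\<lambda>x. h (d j x))"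
    by (rule linear_map_comp[OF d_linear h(1)])
  have g: "linear_map R (F (Suc j)) (F (Suc j)) g"
    unfolding g_def by (intro linear_map_minus_fun hd free_module linear_mapI)
      (use aR in \<open>simp_all add: F.smult_r_distr F.smult_commute\<close>)
  obtain h' where h': "linear_map R (F (Suc j)) (F (Suc (Suc j))) h'"
    "\<And>x. x \<in> carrier (F (Suc j)) \<Longrightarrow> d (Suc j) (h' x) = g x"
  proof (rule F.free_module_choose[of "n (Suc j)" "Suc (Suc j)" "\<lambda>x u. d (Suc j) u = g x"])
    show "\<exists>u\<in>carrier (F (Suc (Suc j))). d (Suc j) u = g x" if x: "x \<in> carrier (F (Suc j))" for x
    proof -
      have "d j (g x) = \<zero>\<^bsub>F j\<^esub>"
        using x aR h(2)[OF x] linear_mapD(1)[OF hd x] d_closed[OF x]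
        by (simp add: g_def linear_map_minus[OF d_linear free_module free_module] linear_mapD(3)[OF d_linear]
            F.minus_eq_zero_iff)
      thus ?thesis using d_kernel[OF linear_mapD(1)[OF g x]] by metis
    qed
  qed (simp_all add: linear_mapD[OF d_linear] linear_mapD[OF g])
  show ?case
  proof (intro exI conjI ballI, rule h'(1))
    fix x assume x: "x \<in> carrier (F (Suc (Suc j)))"
    show "d (Suc j) (h' (d (Suc j) x)) = a \<odot>\<^bsub>F (Suc j)\<^esub> d (Suc j) x"
      using d_closed[OF x] aR
      by (simp add: h'(2) g_def d_d[OF x] linear_map_zero[OF h(1) free_module free_module] F.minus_eq)
  qed
qed

text \<open>With h from the homotopy, a x - h (d x) is a cycle, hence a boundary, where f takes
  values in J. So a f agrees modulo J with the coboundary of f h. In degree 0 the vector a x itself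
  is a boundary.\<close>

lemma annihilator_cocycle:
  assumes a: "a \<in> coker_annihilator R n d" and f: "cocycle_mod R n d J j f"
  shows "coboundary_mod R n d J j (\<lambda>x. a \<otimes> f x)"
proof -
  have aR: "a \<in> carrier R" using a by (simp add: coker_annihilator_def)
  have lin: "linear_map R (F j) (self_module R) f"
    and fd: "\<And>x. x \<in> carrier (F (Suc j)) \<Longrightarrow> f (d j x) \<in> J"
    using f by (auto simp: cocycle_mod_def)
  have af: "a \<otimes> f x = f (a \<odot>\<^bsub>F j\<^esub> x)" if "x \<in> carrier (F j)" for x
    using linear_mapD(3)[OF lin aR that] by simp
  show ?thesis
  proof (cases j)
    case 0
    have "a \<otimes> f x \<in> J" if x: "x \<in> carrier (F 0)" for x
    proof -
      have "a \<odot>\<^bsub>F 0\<^esub> x \<in> d 0 ` carrier (F 1)" using a x by (simp add: coker_annihilator_def)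
      then obtain y where "y \<in> carrier (F 1)" "a \<odot>\<^bsub>F 0\<^esub> x = d 0 y" by blast
      thus ?thesis using af[of x] x fd[of y] 0 by simp
    qed
    thus ?thesis by (simp add: coboundary_mod_def 0)
  next
    case (Suc k)
    obtain h where h: "linear_map R (F k) (F (Suc k)) h"
      "\<And>x. x \<in> carrier (F (Suc k)) \<Longrightarrow> d k (h (d k x)) = a \<odot>\<^bsub>F k\<^esub> d k x"
      using annihilator_homotopy[OF a, of k] by blast
    have "a \<otimes> f x \<ominus> f (h (d k x)) \<in> J" if x: "x \<in> carrier (F (Suc k))" for x
    proof -
      let ?y = "a \<odot>\<^bsub>F (Suc k)\<^esub> x \<ominus>\<^bsub>F (Suc k)\<^esub> h (d k x)"
      have hd: "h (d k x) \<in> carrier (F (Suc k))" using linear_mapD(1)[OF h(1) d_closed[OF x]] .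
      have y: "?y \<in> carrier (F (Suc k))" using x aR hd by simp
      have "d k ?y = \<zero>\<^bsub>F k\<^esub>"
        using x aR h(2)[OF x] hd d_closed[OF x]
        by (simp add: linear_map_minus[OF d_linear free_module free_module] linear_mapD(3)[OF d_linear]
            F.minus_eq_zero_iff)
      then obtain z where z: "z \<in> carrier (F (Suc (Suc k)))" "?y = d (Suc k) z" using d_kernel[OF y] by blast
      have "f ?y = a \<otimes> f x \<ominus> f (h (d k x))"
        using linear_map_minus[OF lin free_module self_module, of "a \<odot>\<^bsub>F (Suc k)\<^esub> x" "h (d k x)"]
          x hd aR Suc af[of x] by simp
      thus ?thesis using fd[of z] z Suc by simp
    qed
    thus ?thesis using linear_map_comp[OF h(1), of "self_module R" f] lin Suc
      by (auto simp: coboundary_mod_def intro!: exI[of _ "\<lambda>x. f (h x)"])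
  qed
qed

lemma cocycle_mod_smult:
  assumes "ideal J R" "a \<in> carrier R" "cocycle_mod R n d J j f"
  shows "cocycle_mod R n d J j (\<lambda>x. a \<otimes> f x)"
  using assms linear_map_smult_fun[of R "F j" "self_module R" f a] idealD(4)[OF assms(1,2)]
  by (auto simp: cocycle_mod_def self_module)

section \<open>The long exact sequence for multiplication by a nonzerodivisor x on R/J\<close>

context
  fixes J x
  assumes J: "ideal J R" and x: "x \<in> coker_annihilator R n d" and nzd: "colon R J x = J"
begin

private lemma xR: "x \<in> carrier R"
  using x by (simp add: coker_annihilator_def)

private lemma x_cancel: "r \<in> carrier R \<Longrightarrow> x \<otimes> r \<in> J \<Longrightarrow> r \<in> J"
  using nzd by (auto simp: colon_def)

private abbreviation "J' \<equiv> ideal_adjoin R J x"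

private lemma J': "ideal J' R"
  by (rule ideal_adjoin_ideal[OF J xR])

private lemma J'_iff: "y \<in> carrier R \<Longrightarrow> y \<in> J' \<longleftrightarrow> (\<exists>r\<in>carrier R. y \<ominus> x \<otimes> r \<in> J)"
proof
  assume "y \<in> J'"
  then obtain j r where "y = j \<oplus> x \<otimes> r" "j \<in> J" "r \<in> carrier R" by (auto simp: ideal_adjoin_def)
  moreover from this have "y \<ominus> x \<otimes> r = j" using idealD(1)[OF J] xR by (simp add: minus_eq a_assoc r_neg)
  ultimately show "\<exists>r\<in>carrier R. y \<ominus> x \<otimes> r \<in> J" by (intro bexI[of _ r]) simp_all
next
  assume y: "y \<in> carrier R" and "\<exists>r\<in>carrier R. y \<ominus> x \<otimes> r \<in> J"
  then obtain r where r: "r \<in> carrier R" "y \<ominus> x \<otimes> r \<in> J" by blast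
  have "y = (y \<ominus> x \<otimes> r) \<oplus> x \<otimes> r" using y r(1) xR by algebra
  thus "y \<in> J'" using r unfolding ideal_adjoin_def by blast
qed

private lemma J'I: "y \<in> carrier R \<Longrightarrow> r \<in> carrier R \<Longrightarrow> y \<ominus> x \<otimes> r \<in> J \<Longrightarrow> y \<in> J'"
  using J'_iff by blast

private lemma divide_choose:
  assumes g: "linear_map R (F k) (self_module R) g" and gJ: "\<And>y. y \<in> carrier (F k) \<Longrightarrow> g y \<in> J'"
  obtains v where "linear_map R (F k) (self_module R) v"
    "\<And>y. y \<in> carrier (F k) \<Longrightarrow> g y \<ominus> x \<otimes> v y \<in> J"
proof (rule S.free_module_choose[of "n k" "\<lambda>y u. g y \<ominus> x \<otimes> u \<in> J"])
  note gc = linear_form_closed[OF g]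
  show "\<exists>u\<in>carrier (self_module R). g y \<ominus> x \<otimes> u \<in> J" if "y \<in> carrier (F k)" for y
    using gJ[OF that] J'_iff[OF gc[OF that]] by simp
  show "g (y \<oplus>\<^bsub>F k\<^esub> z) \<ominus> x \<otimes> (u \<oplus>\<^bsub>self_module R\<^esub> v) \<in> J"
    if "y \<in> carrier (F k)" "z \<in> carrier (F k)" "u \<in> carrier (self_module R)" "v \<in> carrier (self_module R)"
      "g y \<ominus> x \<otimes> u \<in> J" "g z \<ominus> x \<otimes> v \<in> J" for y z u v
  proof -
    have "g (y \<oplus>\<^bsub>F k\<^esub> z) \<ominus> x \<otimes> (u \<oplus> v) = (g y \<ominus> x \<otimes> u) \<oplus> (g z \<ominus> x \<otimes> v)"
      using that gc xR unfolding linear_mapD(2)[OF g that(1,2)] self_module_simps by algebra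
    thus ?thesis using idealD(3)[OF J that(5,6)] by simp
  qed
  show "g (a \<odot>\<^bsub>F k\<^esub> y) \<ominus> x \<otimes> (a \<odot>\<^bsub>self_module R\<^esub> u) \<in> J"
    if "a \<in> carrier R" "y \<in> carrier (F k)" "u \<in> carrier (self_module R)" "g y \<ominus> x \<otimes> u \<in> J" for a y u
  proof -
    have "g (a \<odot>\<^bsub>F k\<^esub> y) \<ominus> x \<otimes> (a \<otimes> u) = a \<otimes> (g y \<ominus> x \<otimes> u)"
      using that gc xR unfolding linear_mapD(3)[OF g that(1,2)] self_module_simps by algebra
    thus ?thesis using idealD(4)[OF J that(1,4)] by simp
  qed
qed (use that in blast)

text \<open>A coboundary modulo J' has the form u d + x v modulo J. Composed with one more
  differential the first term vanishes, and only the multiple of x remains.\<close>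

private lemma coboundary_lift:
  assumes g: "linear_map R (F k) (self_module R) g" and b: "coboundary_mod R n d J' k g"
  obtains v where "linear_map R (F k) (self_module R) v"
    "\<And>y. y \<in> carrier (F (Suc k)) \<Longrightarrow> g (d k y) \<ominus> x \<otimes> v (d k y) \<in> J"
proof (cases k)
  case 0
  hence "\<And>y. y \<in> carrier (F k) \<Longrightarrow> g y \<in> J'" using b by (simp add: coboundary_mod_def)
  then obtain v where "linear_map R (F k) (self_module R) v"
    "\<And>y. y \<in> carrier (F k) \<Longrightarrow> g y \<ominus> x \<otimes> v y \<in> J" using divide_choose[OF g] by blast
  thus thesis using that d_closed by blast
next
  case (Suc l)
  then obtain u where u: "linear_map R (F l) (self_module R) u"
    "\<And>y. y \<in> carrier (F (Suc l)) \<Longrightarrow> g y \<ominus> u (d l y) \<in> J'"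
    using b by (auto simp: coboundary_mod_def)
  have ud: "linear_map R (F (Suc l)) (self_module R) (\<lambda>y. u (d l y))" by (rule linear_map_comp[OF d_linear u(1)])
  have g': "linear_map R (F k) (self_module R) (\<lambda>y. g y \<ominus> u (d l y))"
    using linear_map_minus_fun[OF g _ free_module self_module, of "\<lambda>y. u (d l y)"] ud Suc by simp
  obtain v where v: "linear_map R (F k) (self_module R) v"
    "\<And>y. y \<in> carrier (F k) \<Longrightarrow> (g y \<ominus> u (d l y)) \<ominus> x \<otimes> v y \<in> J"
    using divide_choose[OF g'] u(2) Suc by blast
  have "g (d k y) \<ominus> x \<otimes> v (d k y) \<in> J" if y: "y \<in> carrier (F (Suc k))" for y
  proof -
    have "u (d l (d k y)) = \<zero>" using y linear_form_zero[OF u(1)] Suc d_d by simp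
    thus ?thesis using v(2)[OF d_closed[OF y]] linear_form_closed[OF g d_closed[OF y]] by (simp add: minus_eq)
  qed
  thus thesis using that v(1) by blast
qed

text \<open>Surjectivity of the connecting map from degree k with values in R/J' to degree k + 1
  with values in R/J. As x kills the cohomology, x f is a coboundary g d modulo J, and g is a
  cocycle modulo J' whose image is the class of f.\<close>

private lemma annihilator_quotient:
  assumes f: "cocycle_mod R n d J (Suc k) f"
  shows "\<exists>g. cocycle_mod R n d J' k g \<and> (\<forall>y\<in>carrier (F (Suc k)). g (d k y) \<ominus> x \<otimes> f y \<in> J)"
proof -
  from annihilator_cocycle[OF x f] obtain g where g: "linear_map R (F k) (self_module R) g"
    "\<And>y. y \<in> carrier (F (Suc k)) \<Longrightarrow> x \<otimes> f y \<ominus> g (d k y) \<in> J" by (auto simp: coboundary_mod_def)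
  have "linear_map R (F (Suc k)) (self_module R) f" using f by (simp add: cocycle_mod_def)
  note fc = linear_form_closed[OF this]
  have 1: "g (d k y) \<ominus> x \<otimes> f y \<in> J" if y: "y \<in> carrier (F (Suc k))" for y
  proof -
    have "g (d k y) \<ominus> x \<otimes> f y = (\<ominus> \<one>) \<otimes> (x \<otimes> f y \<ominus> g (d k y))"
      using fc[OF y] linear_form_closed[OF g(1) d_closed[OF y]] xR by algebra
    thus ?thesis using idealD(4)[OF J _ g(2)[OF y], of "\<ominus> \<one>"] by simp
  qed
  hence "cocycle_mod R n d J' k g"
    using g(1) J'I[OF linear_form_closed[OF g(1) d_closed] fc] by (simp add: cocycle_mod_def)
  thus ?thesis using 1 by blast
qed

private lemma cancel_diff:
  assumes "a \<in> carrier R" "b \<in> carrier R" "c \<in> carrier R" "c \<ominus> x \<otimes> a \<in> J" "c \<ominus> x \<otimes> b \<in> J"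
  shows "a \<ominus> b \<in> J"
proof -
  have eq: "x \<otimes> (a \<ominus> b) = (c \<ominus> x \<otimes> b) \<ominus> (c \<ominus> x \<otimes> a)" using assms(1-3) xR by algebra
  have "x \<otimes> (a \<ominus> b) \<in> J" unfolding eq by (rule ideal_minus[OF J assms(5,4)])
  thus ?thesis by (rule x_cancel[OF minus_closed[OF assms(1,2)]])
qed

text \<open>Since x acts as zero, each cohomology group of R/J in positive degree is a quotient of
  the group of R/J' one degree lower. In degree 0, x kills f modulo J and can be cancelled.\<close>

lemma cohomology_mod_vanish:
  assumes van: "\<And>j f. j < m \<Longrightarrow> cocycle_mod R n d J' j f \<Longrightarrow> coboundary_mod R n d J' j f"
    and j: "j < Suc m" and f: "cocycle_mod R n d J j f"
  shows "coboundary_mod R n d J j f"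
proof (cases j)
  case 0
  hence "\<And>y. y \<in> carrier (F 0) \<Longrightarrow> x \<otimes> f y \<in> J"
    using annihilator_cocycle[OF x f] by (simp add: coboundary_mod_def)
  thus ?thesis using x_cancel linear_form_closed f 0 by (auto simp: coboundary_mod_def cocycle_mod_def)
next
  case (Suc k)
  have fl: "linear_map R (F (Suc k)) (self_module R) f" using f Suc by (simp add: cocycle_mod_def)
  obtain g where g: "cocycle_mod R n d J' k g"
    "\<And>y. y \<in> carrier (F (Suc k)) \<Longrightarrow> g (d k y) \<ominus> x \<otimes> f y \<in> J"
    using annihilator_quotient[of k f] f Suc by blast
  have gl: "linear_map R (F k) (self_module R) g" using g(1) by (simp add: cocycle_mod_def)
  have "coboundary_mod R n d J' k g" using van g(1) j Suc by simp
  then obtain v where v: "linear_map R (F k) (self_module R) v"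
    "\<And>y. y \<in> carrier (F (Suc k)) \<Longrightarrow> g (d k y) \<ominus> x \<otimes> v (d k y) \<in> J"
    using coboundary_lift[OF gl] by blast
  have "f y \<ominus> v (d k y) \<in> J" if y: "y \<in> carrier (F (Suc k))" for y
    by (rule cancel_diff[OF linear_form_closed[OF fl y] linear_form_closed[OF v(1) d_closed[OF y]]
          linear_form_closed[OF gl d_closed[OF y]] g(2)[OF y] v(2)[OF y]])
  thus ?thesis using v(1) Suc by (auto simp: coboundary_mod_def)
qed

text \<open>The congruence of h d and x f modulo J says that the connecting map sends the class of h
  to the class of f. The implication from f to h is injectivity; it uses that the cohomology of R/J
  vanishes in degree m.\<close>

private lemma connecting_iff:
  assumes van: "\<And>j f. j < m \<Longrightarrow> cocycle_mod R n d J' j f \<Longrightarrow> coboundary_mod R n d J' j f"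
    and h: "cocycle_mod R n d J' m h" and f: "cocycle_mod R n d J (Suc m) f"
    and hf: "\<And>y. y \<in> carrier (F (Suc m)) \<Longrightarrow> h (d m y) \<ominus> x \<otimes> f y \<in> J"
  shows "coboundary_mod R n d J' m h \<longleftrightarrow> coboundary_mod R n d J (Suc m) f"
proof
  have hl: "linear_map R (F m) (self_module R) h" using h by (simp add: cocycle_mod_def)
  have fl: "linear_map R (F (Suc m)) (self_module R) f" using f by (simp add: cocycle_mod_def)
  show "coboundary_mod R n d J (Suc m) f" if b: "coboundary_mod R n d J' m h"
  proof -
    obtain v where v: "linear_map R (F m) (self_module R) v"
      "\<And>y. y \<in> carrier (F (Suc m)) \<Longrightarrow> h (d m y) \<ominus> x \<otimes> v (d m y) \<in> J"
      using coboundary_lift[OF hl b] by blast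
    have "f y \<ominus> v (d m y) \<in> J" if y: "y \<in> carrier (F (Suc m))" for y
      by (rule cancel_diff[OF linear_form_closed[OF fl y] linear_form_closed[OF v(1) d_closed[OF y]]
            linear_form_closed[OF hl d_closed[OF y]] hf[OF y] v(2)[OF y]])
    thus ?thesis using v(1) by (auto simp: coboundary_mod_def)
  qed
  assume "coboundary_mod R n d J (Suc m) f"
  then obtain v where v: "linear_map R (F m) (self_module R) v"
    "\<And>y. y \<in> carrier (F (Suc m)) \<Longrightarrow> f y \<ominus> v (d m y) \<in> J" by (auto simp: coboundary_mod_def)
  \<comment> \<open>Subtracting x v does not affect h modulo J', and the difference is a cocycle
    modulo J, to which the vanishing in degree m applies.\<close>
  let ?g = "\<lambda>y. h y \<ominus> x \<otimes> v y"
  have "linear_map R (F m) (self_module R) ?g"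
    using linear_map_minus_fun[OF hl linear_map_smult_fun[OF v(1) xR self_module] free_module self_module]
    by simp
  moreover have "?g (d m y) \<in> J" if y: "y \<in> carrier (F (Suc m))" for y
  proof -
    have "?g (d m y) = (h (d m y) \<ominus> x \<otimes> f y) \<oplus> x \<otimes> (f y \<ominus> v (d m y))"
      using linear_form_closed[OF fl y] linear_form_closed[OF v(1) d_closed[OF y]]
        linear_form_closed[OF hl d_closed[OF y]] xR by algebra
    thus ?thesis using idealD(3)[OF J hf[OF y] idealD(4)[OF J xR v(2)[OF y]]] by simp
  qed
  ultimately have "cocycle_mod R n d J m ?g" by (simp add: cocycle_mod_def)
  hence b: "coboundary_mod R n d J m ?g" using cohomology_mod_vanish[OF van, of m] by simp
  show "coboundary_mod R n d J' m h"
  proof (cases m)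
    case 0
    thus ?thesis using b J'I[OF linear_form_closed[OF hl] linear_form_closed[OF v(1)]]
      by (simp add: coboundary_mod_def)
  next
    case (Suc l)
    then obtain u where u: "linear_map R (F l) (self_module R) u"
      "\<And>y. y \<in> carrier (F (Suc l)) \<Longrightarrow> ?g y \<ominus> u (d l y) \<in> J" using b by (auto simp: coboundary_mod_def)
    have "h y \<ominus> u (d l y) \<in> J'" if y: "y \<in> carrier (F (Suc l))" for y
    proof -
      have c: "h y \<in> carrier R" "v y \<in> carrier R" "u (d l y) \<in> carrier R"
        using linear_form_closed[OF hl] linear_form_closed[OF v(1)] linear_form_closed[OF u(1) d_closed[OF y]] y Suc
        by simp_all
      have "(h y \<ominus> u (d l y)) \<ominus> x \<otimes> v y = ?g y \<ominus> u (d l y)" using c xR by algebra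
      thus ?thesis using u(2)[OF y] J'I[of "h y \<ominus> u (d l y)" "v y"] c by simp
    qed
    thus ?thesis using u(1) Suc by (auto simp: coboundary_mod_def)
  qed
qed

text \<open>The connecting map is bijective here. Instead of constructing it, cocycles h and f are
  paired by the congruence of h d and x f modulo J; the pairing is preserved by multiplication with
  scalars, so paired classes have the same annihilator.\<close>

lemma cohomology_mod_primes_shift:
  assumes van: "\<And>j f. j < m \<Longrightarrow> cocycle_mod R n d J' j f \<Longrightarrow> coboundary_mod R n d J' j f"
  shows "cohomology_mod_primes R n d J (Suc m) = cohomology_mod_primes R n d J' m"
proof -
  have eq: "{a \<in> carrier R. coboundary_mod R n d J' m (\<lambda>x. a \<otimes> h x)} =
      {a \<in> carrier R. coboundary_mod R n d J (Suc m) (\<lambda>x. a \<otimes> f x)}"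
    if h: "cocycle_mod R n d J' m h" and f: "cocycle_mod R n d J (Suc m) f"
      and hf: "\<And>y. y \<in> carrier (F (Suc m)) \<Longrightarrow> h (d m y) \<ominus> x \<otimes> f y \<in> J" for h f
  proof (intro Collect_cong conj_cong refl)
    fix a assume a: "a \<in> carrier R"
    show "coboundary_mod R n d J' m (\<lambda>x. a \<otimes> h x) \<longleftrightarrow> coboundary_mod R n d J (Suc m) (\<lambda>x. a \<otimes> f x)"
    proof (rule connecting_iff[OF van cocycle_mod_smult[OF J' a h] cocycle_mod_smult[OF J a f]])
      fix y assume y: "y \<in> carrier (F (Suc m))"
      have "h (d m y) \<in> carrier R" "f y \<in> carrier R"
        using h f y linear_form_closed d_closed by (auto simp: cocycle_mod_def)
      hence "a \<otimes> h (d m y) \<ominus> x \<otimes> (a \<otimes> f y) = a \<otimes> (h (d m y) \<ominus> x \<otimes> f y)" using a xR by algebra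
      thus "a \<otimes> h (d m y) \<ominus> x \<otimes> (a \<otimes> f y) \<in> J" using idealD(4)[OF J a hf[OF y]] by simp
    qed
  qed
  have 1: "\<exists>h. cocycle_mod R n d J' m h \<and> (\<forall>y\<in>carrier (F (Suc m)). h (d m y) \<ominus> x \<otimes> f y \<in> J)"
    if "cocycle_mod R n d J (Suc m) f" for f
    using that by (rule annihilator_quotient)
  \<comment> \<open>The values of h d lie in J + xR, so f arises by division by x; that f is a
    cocycle modulo J follows by cancelling x.\<close>
  have 2: "\<exists>f. cocycle_mod R n d J (Suc m) f \<and> (\<forall>y\<in>carrier (F (Suc m)). h (d m y) \<ominus> x \<otimes> f y \<in> J)"
    if h: "cocycle_mod R n d J' m h" for h
  proof -
    have hl: "linear_map R (F m) (self_module R) h" using h by (simp add: cocycle_mod_def)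
    have "linear_map R (F (Suc m)) (self_module R) (\<lambda>y. h (d m y))" by (rule linear_map_comp[OF d_linear hl])
    then obtain f where f: "linear_map R (F (Suc m)) (self_module R) f"
      "\<And>y. y \<in> carrier (F (Suc m)) \<Longrightarrow> h (d m y) \<ominus> x \<otimes> f y \<in> J"
      using divide_choose[of "Suc m" "\<lambda>y. h (d m y)"] h by (auto simp: cocycle_mod_def)
    have "f (d (Suc m) z) \<in> J" if z: "z \<in> carrier (F (Suc (Suc m)))" for z
    proof -
      have fz: "f (d (Suc m) z) \<in> carrier R" using linear_form_closed[OF f(1) d_closed[OF z]] .
      have "\<zero> \<ominus> x \<otimes> f (d (Suc m) z) \<in> J"
        using f(2)[OF d_closed[OF z]] d_d[OF z] linear_form_zero[OF hl] by simp
      hence "\<zero> \<ominus> (\<zero> \<ominus> x \<otimes> f (d (Suc m) z)) \<in> J" using ideal_minus[OF J idealD(2)[OF J]] by blast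
      moreover have "\<zero> \<ominus> (\<zero> \<ominus> x \<otimes> f (d (Suc m) z)) = x \<otimes> f (d (Suc m) z)" using fz xR by algebra
      ultimately show ?thesis using x_cancel[OF fz] by simp
    qed
    thus ?thesis using f by (auto simp: cocycle_mod_def)
  qed
  show ?thesis
    unfolding cohomology_mod_primes_def
  proof (intro Collect_cong conj_cong refl iffI)
    fix P
    assume "\<exists>f. cocycle_mod R n d J (Suc m) f \<and>
      P = {a \<in> carrier R. coboundary_mod R n d J (Suc m) (\<lambda>x. a \<otimes> f x)}"
    then obtain f where f: "cocycle_mod R n d J (Suc m) f"
      "P = {a \<in> carrier R. coboundary_mod R n d J (Suc m) (\<lambda>x. a \<otimes> f x)}" by blast
    obtain h where h: "cocycle_mod R n d J' m h"
      "\<forall>y\<in>carrier (F (Suc m)). h (d m y) \<ominus> x \<otimes> f y \<in> J" using 1[OF f(1)] by blast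
    show "\<exists>h. cocycle_mod R n d J' m h \<and>
      P = {a \<in> carrier R. coboundary_mod R n d J' m (\<lambda>x. a \<otimes> h x)}"
      using eq[OF h(1) f(1)] h f(2) by (intro exI[of _ h]) simp
  next
    fix P
    assume "\<exists>h. cocycle_mod R n d J' m h \<and>
      P = {a \<in> carrier R. coboundary_mod R n d J' m (\<lambda>x. a \<otimes> h x)}"
    then obtain h where h: "cocycle_mod R n d J' m h"
      "P = {a \<in> carrier R. coboundary_mod R n d J' m (\<lambda>x. a \<otimes> h x)}" by blast
    obtain f where f: "cocycle_mod R n d J (Suc m) f"
      "\<forall>y\<in>carrier (F (Suc m)). h (d m y) \<ominus> x \<otimes> f y \<in> J" using 2[OF h(1)] by blast
    show "\<exists>f. cocycle_mod R n d J (Suc m) f \<and>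
      P = {a \<in> carrier R. coboundary_mod R n d J (Suc m) (\<lambda>x. a \<otimes> f x)}"
      using eq[OF h(1) f(1)] f h(2) by (intro exI[of _ f]) simp
  qed
qed

end

text \<open>Removing the last generator raises the degree by one and also extends the range of
  vanishing by one, which is why m is kept general. For m = 0 the vanishing condition is void and
  the equality reflects Ext^l(M, R) = Hom(M, R/J).\<close>

lemma regular_chain_cohomology:
  assumes "regular_chain R A l J" "A \<subseteq> coker_annihilator R n d"
    and "\<And>j f. j < m \<Longrightarrow> cocycle_mod R n d J j f \<Longrightarrow> coboundary_mod R n d J j f"
  shows "cohomology_mod_primes R n d {\<zero>} (l + m) = cohomology_mod_primes R n d J m"
  using assms(1,3)
proof (induction l J arbitrary: m rule: regular_chain.induct)
  case (Suc l J x)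
  have AR: "A \<subseteq> carrier R" using assms(2) by (auto simp: coker_annihilator_def)
  have J: "ideal J R" by (rule regular_chain_ideal[OF Suc.hyps(1) AR])
  have x: "x \<in> coker_annihilator R n d" using Suc.hyps(2) assms(2) by blast
  have "cohomology_mod_primes R n d {\<zero>} (l + Suc m) = cohomology_mod_primes R n d J (Suc m)"
    using cohomology_mod_vanish[OF J x Suc.hyps(3) Suc.prems] by (intro Suc.IH) auto
  thus ?case using cohomology_mod_primes_shift[OF J x Suc.hyps(3) Suc.prems] by simp
qed simp

end

section \<open>Associated primes of the lowest cohomology\<close>

text \<open>In the cokernel of K these submodules form a filtration with cyclic quotients, the q-th
  one being R modulo the ideal of all r with r e_q in the q-th submodule. It reduces claims about
  finitely generated modules to cyclic ones.\<close>

definition free_filtration ::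
  "('a, 'm) ring_scheme \<Rightarrow> nat \<Rightarrow> (nat \<Rightarrow> 'a) set \<Rightarrow> nat \<Rightarrow> (nat \<Rightarrow> 'a) set" where
  "free_filtration R k K q = span R (free_module R k) (K \<union> std_basis R k ` {..<q})"

context cring
begin

lemma std_basis_free [simp]: "std_basis R k q \<in> carrier (free_module R k)"
  by (simp add: free_module_simps)

context
  fixes k K
  assumes K: "submodule K R (free_module R k)"
begin

interpretation F: module R "free_module R k" by (rule free_module)

private abbreviation "N q \<equiv> free_filtration R k K q"

lemma free_filtration_submodule: "submodule (N q) R (free_module R k)"
  unfolding free_filtration_def using submoduleD(1)[OF K] by (intro F.span_submodule) auto

lemma free_filtration_superset: "K \<subseteq> N q"
  unfolding free_filtration_def using span_superset[of "K \<union> std_basis R k ` {..<q}" R "free_module R k"] by simp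

lemma free_filtration_0: "N 0 = K"
  unfolding free_filtration_def using span_least[OF K, of K] span_superset[of K R "free_module R k"] by auto

lemma free_filtration_basis: "j < q \<Longrightarrow> std_basis R k j \<in> N q"
  unfolding free_filtration_def using span_superset[of "K \<union> std_basis R k ` {..<q}" R "free_module R k"] by auto

lemma free_filtration_full: "N k = carrier (free_module R k)"
proof
  show "N k \<subseteq> carrier (free_module R k)" using submoduleD(1)[OF free_filtration_submodule] by blast
  show "carrier (free_module R k) \<subseteq> N k"
  proof
    fix x assume x: "x \<in> carrier (free_module R k)"
    have "lincomb (free_module R k) (std_basis R k) x k \<in> N k"
      using free_filtration_basis free_module_coord[OF x]
      by (intro F.lincomb_submodule[OF free_filtration_submodule])
    thus "x \<in> N k" using free_module_expand[OF x] by simp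
  qed
qed

lemma free_filtration_Suc:
  assumes "y \<in> N (Suc q)"
  shows "\<exists>c\<in>carrier R. y \<ominus>\<^bsub>free_module R k\<^esub> c \<odot>\<^bsub>free_module R k\<^esub> std_basis R k q \<in> N q"
proof -
  let ?F = "free_module R k" and ?e = "std_basis R k"
  let ?T = "{y \<in> carrier ?F. \<exists>c\<in>carrier R. y \<ominus>\<^bsub>?F\<^esub> c \<odot>\<^bsub>?F\<^esub> ?e q \<in> N q}"
  note ND = submoduleD[OF free_filtration_submodule]
  have 0: "y \<in> ?T" if "y \<in> N q" for y
  proof -
    have "y \<ominus>\<^bsub>?F\<^esub> \<zero> \<odot>\<^bsub>?F\<^esub> ?e q = y" using ND(1)[OF that] by (simp add: F.minus_eq)
    thus ?thesis using that ND(1)[OF that] by (metis (mono_tags, lifting) mem_Collect_eq zero_closed)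
  qed
  have "submodule ?T R ?F"
  proof (rule F.submoduleI')
    show "\<zero>\<^bsub>?F\<^esub> \<in> ?T" using 0[OF ND(2)] .
    fix y assume "y \<in> ?T"
    then obtain c where y: "y \<in> carrier ?F" "c \<in> carrier R" "y \<ominus>\<^bsub>?F\<^esub> c \<odot>\<^bsub>?F\<^esub> ?e q \<in> N q" by blast
    show "y \<oplus>\<^bsub>?F\<^esub> z \<in> ?T" if "z \<in> ?T" for z
    proof -
      from that obtain b where z: "z \<in> carrier ?F" "b \<in> carrier R" "z \<ominus>\<^bsub>?F\<^esub> b \<odot>\<^bsub>?F\<^esub> ?e q \<in> N q" by blast
      have "(y \<oplus>\<^bsub>?F\<^esub> z) \<ominus>\<^bsub>?F\<^esub> (c \<oplus> b) \<odot>\<^bsub>?F\<^esub> ?e q =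
          (y \<ominus>\<^bsub>?F\<^esub> c \<odot>\<^bsub>?F\<^esub> ?e q) \<oplus>\<^bsub>?F\<^esub> (z \<ominus>\<^bsub>?F\<^esub> b \<odot>\<^bsub>?F\<^esub> ?e q)"
        using y(1,2) z(1,2) by (simp add: F.smult_l_distr F.minus_eq F.minus_add F.a_ac)
      hence "(y \<oplus>\<^bsub>?F\<^esub> z) \<ominus>\<^bsub>?F\<^esub> (c \<oplus> b) \<odot>\<^bsub>?F\<^esub> ?e q \<in> N q" using ND(3)[OF y(3) z(3)] by simp
      thus ?thesis using F.a_closed[OF y(1) z(1)] a_closed[OF y(2) z(2)] by blast
    qed
    show "a \<odot>\<^bsub>?F\<^esub> y \<in> ?T" if a: "a \<in> carrier R" for a
    proof -
      have "a \<odot>\<^bsub>?F\<^esub> y \<ominus>\<^bsub>?F\<^esub> (a \<otimes> c) \<odot>\<^bsub>?F\<^esub> ?e q = a \<odot>\<^bsub>?F\<^esub> (y \<ominus>\<^bsub>?F\<^esub> c \<odot>\<^bsub>?F\<^esub> ?e q)"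
        using y(1,2) a by (simp add: F.smult_minus_distr F.smult_assoc1)
      hence "a \<odot>\<^bsub>?F\<^esub> y \<ominus>\<^bsub>?F\<^esub> (a \<otimes> c) \<odot>\<^bsub>?F\<^esub> ?e q \<in> N q" using ND(4)[OF a y(3)] by simp
      thus ?thesis using F.smult_closed[OF a y(1)] m_closed[OF a y(2)] by blast
    qed
  qed blast
  moreover have "K \<union> ?e ` {..<Suc q} \<subseteq> ?T"
  proof -
    have "K \<subseteq> ?T" using 0 free_filtration_superset by blast
    moreover have "?e j \<in> ?T" if "j < q" for j using 0[OF free_filtration_basis[OF that]] .
    moreover have "?e q \<in> ?T"
    proof -
      have "?e q \<ominus>\<^bsub>?F\<^esub> \<one> \<odot>\<^bsub>?F\<^esub> ?e q = \<zero>\<^bsub>?F\<^esub>" by (simp add: F.minus_eq F.r_neg)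
      hence "?e q \<ominus>\<^bsub>?F\<^esub> \<one> \<odot>\<^bsub>?F\<^esub> ?e q \<in> N q" using ND(2) by simp
      thus ?thesis using one_closed std_basis_free by blast
    qed
    ultimately show ?thesis by (auto simp: less_Suc_eq)
  qed
  ultimately have "N (Suc q) \<subseteq> ?T"
    unfolding free_filtration_def[of R k K "Suc q"] by (intro span_least)
  thus ?thesis using assms by blast
qed

end

end

context free_exact_complex
begin

lemma image_submodule: "submodule (d 0 ` carrier (F (Suc 0))) R (F 0)"
  by (rule linear_map_image_submodule[OF d_linear free_module free_module])

text \<open>P is the annihilator of a homomorphism f from M to R/J, that is, the intersection of the
  annihilators of the finitely many values on generators. A prime that is a finite intersection of
  ideals equals one of them.\<close>

lemma cohomology_mod_primes_0_subset:
  assumes J: "ideal J R" and P: "P \<in> cohomology_mod_primes R n d J 0"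
  shows "P \<in> assoc_primes R J" "coker_annihilator R n d \<subseteq> P"
proof -
  from P obtain f where pr: "primeideal P R" and f: "cocycle_mod R n d J 0 f"
    and Pf: "P = {a \<in> carrier R. coboundary_mod R n d J 0 (\<lambda>x. a \<otimes> f x)}"
    by (auto simp: cohomology_mod_primes_def)
  have fl: "linear_map R (F 0) (self_module R) f" using f by (simp add: cocycle_mod_def)
  have P_iff: "a \<in> P \<longleftrightarrow> (\<forall>x\<in>carrier (F 0). a \<otimes> f x \<in> J)" if "a \<in> carrier R" for a
    using that by (simp add: Pf coboundary_mod_def)
  show "coker_annihilator R n d \<subseteq> P"
    unfolding Pf using annihilator_cocycle[OF _ f] by (auto simp: coker_annihilator_def)
  let ?z = "\<lambda>k. f (std_basis R (n 0) k)"
  have z: "?z k \<in> carrier R" for k using linear_form_closed[OF fl] by simp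
  have PI: "a \<in> P" if a: "a \<in> carrier R" and "\<And>k. k < n 0 \<Longrightarrow> a \<otimes> ?z k \<in> J" for a
  proof -
    have "a \<otimes> f x \<in> J" if x: "x \<in> carrier (F 0)" for x
    proof -
      note xc = free_module_coord[OF x]
      have "f x = lincomb (self_module R) ?z x (n 0)"
        using linear_map_lincomb[OF fl free_module self_module, of "n 0" "std_basis R (n 0)" x]
          xc free_module_expand[OF x] by simp
      moreover have "a \<otimes> lincomb (self_module R) ?z x l \<in> J" if "l \<le> n 0" for l
        using that
      proof (induction l)
        case 0 thus ?case using a idealD(2)[OF J] by simp
      next
        case (Suc l)
        have lc: "lincomb (self_module R) ?z x l \<in> carrier R"
          using S.lincomb_closed[of l ?z x] z xc Suc.prems by simp
        have xl: "x l \<in> carrier R" using xc Suc.prems by simp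
        have "a \<otimes> lincomb (self_module R) ?z x (Suc l) =
            a \<otimes> lincomb (self_module R) ?z x l \<oplus> x l \<otimes> (a \<otimes> ?z l)"
          using lc xl z[of l] a by (simp add: r_distr m_lcomm)
        thus ?case using Suc \<open>\<And>k. k < n 0 \<Longrightarrow> a \<otimes> ?z k \<in> J\<close>[of l] idealD(3,4)[OF J] xl by simp
      qed
      ultimately show ?thesis by simp
    qed
    thus ?thesis using P_iff a by blast
  qed
  have "\<exists>k<n 0. \<forall>a\<in>carrier R. a \<otimes> ?z k \<in> J \<longrightarrow> a \<in> P"
  proof (rule ccontr)
    assume "\<not> ?thesis"
    hence *: "\<exists>a\<in>carrier R. a \<otimes> ?z k \<in> J \<and> a \<notin> P" if "k < n 0" for k using that by blast
    \<comment> \<open>If each value were killed by something outside P, the product of these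
      elements would kill all values while lying outside P.\<close>
    have "\<exists>a\<in>carrier R. a \<notin> P \<and> (\<forall>k<l. a \<otimes> ?z k \<in> J)" if "l \<le> n 0" for l
      using that
    proof (induction l)
      case 0 thus ?case using primeD(2)[OF pr] by blast
    next
      case (Suc l)
      then obtain a where a: "a \<in> carrier R" "a \<notin> P" "\<forall>k<l. a \<otimes> ?z k \<in> J" by auto
      obtain b where b: "b \<in> carrier R" "b \<otimes> ?z l \<in> J" "b \<notin> P" using *[of l] Suc.prems by auto
      have "a \<otimes> b \<notin> P" using primeD(3)[OF pr a(1) b(1)] a(2) b(3) by blast
      moreover have "a \<otimes> b \<otimes> ?z k \<in> J" if "k < Suc l" for k
      proof (cases "k = l")
        case True
        thus ?thesis using idealD(4)[OF J a(1) b(2)] z[of l] a(1) b(1) by (simp add: m_assoc)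
      next
        case False
        hence "a \<otimes> ?z k \<in> J" using that a(3) by simp
        from idealD(4)[OF J b(1) this] show ?thesis using z[of k] a(1) b(1) by (simp add: m_ac)
      qed
      ultimately show ?case using a(1) b(1) by blast
    qed
    from this[of "n 0"] PI show False by auto
  qed
  then obtain k where k: "k < n 0" "\<And>a. a \<in> carrier R \<Longrightarrow> a \<otimes> ?z k \<in> J \<Longrightarrow> a \<in> P" by blast
  have "P = colon R J (?z k)"
  proof (intro equalityI subsetI)
    fix a assume a: "a \<in> P"
    have aR: "a \<in> carrier R" using idealD(1)[OF primeD(1)[OF pr] a] .
    thus "a \<in> colon R J (?z k)" using a P_iff[OF aR] z[of k] by (simp add: colon_def m_comm)
  next
    fix a assume "a \<in> colon R J (?z k)"
    thus "a \<in> P" using k(2)[of a] m_comm[OF z[of k], of a] by (auto simp: colon_def)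
  qed
  thus "P \<in> assoc_primes R J" using pr z unfolding assoc_primes_def by blast
qed

text \<open>A homomorphism from M to R/J with annihilator P is needed, where P is the annihilator of
  z in R/J. It is the composite of multiplication by a suitable s from M into a cyclic quotient of
  the filtration, the projection of that quotient onto R/P, and the embedding of R/P into R/J by
  z.\<close>

lemma cohomology_mod_primes_0_superset:
  assumes J: "ideal J R" and P: "P \<in> assoc_primes R J" and ann: "coker_annihilator R n d \<subseteq> P"
  shows "P \<in> cohomology_mod_primes R n d J 0"
proof -
  from P obtain z where pr: "primeideal P R" and z: "z \<in> carrier R" and Pz: "P = colon R J z"
    by (auto simp: assoc_primes_def)
  have PI: "ideal P R" by (rule primeD(1)[OF pr])
  let ?K = "d 0 ` carrier (F (Suc 0))" and ?e = "std_basis R (n 0)"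
  let ?N = "free_filtration R (n 0) ?K"
  note N = free_filtration_submodule[OF image_submodule]
  note ND = submoduleD[OF N]
  \<comment> \<open>\<open>G l\<close> says that the quotient of \<open>F 0\<close> by the l-th
    submodule vanishes at P. It holds at the top and fails at 0, because P contains the annihilator
    of M; q is a place where it changes.\<close>
  define G where
    "G l \<longleftrightarrow> (\<exists>s\<in>carrier R. s \<notin> P \<and> (\<forall>y\<in>carrier (F 0). s \<odot>\<^bsub>F 0\<^esub> y \<in> ?N l))" for l
  have "G (n 0)"
    unfolding G_def free_filtration_full[OF image_submodule]
    using primeD(2)[OF pr] by (intro bexI[of _ "\<one>"]) simp_all
  moreover have "\<not> G 0"
    using ann by (auto simp: G_def free_filtration_0[OF image_submodule] coker_annihilator_def)
  ultimately obtain q where q: "\<not> G q" "G (Suc q)" using ex_least_nat_less[of G "n 0"] by auto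
  obtain s where s: "s \<in> carrier R" "s \<notin> P" "\<And>y. y \<in> carrier (F 0) \<Longrightarrow> s \<odot>\<^bsub>F 0\<^esub> y \<in> ?N (Suc q)"
    using q(2) unfolding G_def by blast
  \<comment> \<open>If r outside P moved e_q into the q-th submodule, then r s would move all of
    \<open>F 0\<close> into it, contradicting the choice of q.\<close>
  have IP: "r \<in> P" if r: "r \<in> carrier R" "r \<odot>\<^bsub>F 0\<^esub> ?e q \<in> ?N q" for r
  proof (rule ccontr)
    assume rP: "r \<notin> P"
    have "r \<otimes> s \<odot>\<^bsub>F 0\<^esub> y \<in> ?N q" if y: "y \<in> carrier (F 0)" for y
    proof -
      obtain c where c: "c \<in> carrier R" "s \<odot>\<^bsub>F 0\<^esub> y \<ominus>\<^bsub>F 0\<^esub> c \<odot>\<^bsub>F 0\<^esub> ?e q \<in> ?N q"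
        using free_filtration_Suc[OF image_submodule s(3)[OF y]] by blast
      have "r \<otimes> s \<odot>\<^bsub>F 0\<^esub> y = r \<odot>\<^bsub>F 0\<^esub> (s \<odot>\<^bsub>F 0\<^esub> y \<ominus>\<^bsub>F 0\<^esub> c \<odot>\<^bsub>F 0\<^esub> ?e q) \<oplus>\<^bsub>F 0\<^esub> c \<odot>\<^bsub>F 0\<^esub> (r \<odot>\<^bsub>F 0\<^esub> ?e q)"
        using r(1) s(1) c(1) y F.smult_commute[OF c(1) r(1), of "?e q" 0]
        by (simp add: F.smult_minus_distr F.smult_assoc1)
      thus ?thesis using ND(3)[OF ND(4)[OF r(1) c(2)] ND(4)[OF c(1) r(2)]] by simp
    qed
    moreover have "r \<otimes> s \<notin> P" using primeD(3)[OF pr r(1) s(1)] rP s(2) by blast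
    ultimately show False using q(1) r(1) s(1) unfolding G_def by blast
  qed
  have cz: "c \<otimes> z \<in> J \<longleftrightarrow> c \<in> P" if "c \<in> carrier R" for c
    using that z by (simp add: Pz colon_def m_comm)
  \<comment> \<open>The vector s y is congruent to c e_q. By \<open>IP\<close> the coefficient c is
    determined modulo P, hence c z modulo J; \<open>f\<close> is a linear choice of
    representatives.\<close>
  let ?Q = "\<lambda>y u. \<exists>c\<in>carrier R. s \<odot>\<^bsub>F 0\<^esub> y \<ominus>\<^bsub>F 0\<^esub> c \<odot>\<^bsub>F 0\<^esub> ?e q \<in> ?N q \<and> u = c \<otimes> z"
  obtain f where f: "linear_map R (F 0) (self_module R) f" "\<And>y. y \<in> carrier (F 0) \<Longrightarrow> ?Q y (f y)"
  proof (rule S.free_module_choose[of "n 0" ?Q])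
    show "\<exists>u\<in>carrier (self_module R). ?Q y u" if y: "y \<in> carrier (F 0)" for y
      using free_filtration_Suc[OF image_submodule s(3)[OF y]] z by (auto intro: m_closed)
  next
    fix y y' u u' assume y: "y \<in> carrier (F 0)" "y' \<in> carrier (F 0)" and "?Q y u" "?Q y' u'"
    then obtain c c' where c: "c \<in> carrier R" "c' \<in> carrier R" "u = c \<otimes> z" "u' = c' \<otimes> z"
      "s \<odot>\<^bsub>F 0\<^esub> y \<ominus>\<^bsub>F 0\<^esub> c \<odot>\<^bsub>F 0\<^esub> ?e q \<in> ?N q" "s \<odot>\<^bsub>F 0\<^esub> y' \<ominus>\<^bsub>F 0\<^esub> c' \<odot>\<^bsub>F 0\<^esub> ?e q \<in> ?N q" by blast
    have "s \<odot>\<^bsub>F 0\<^esub> (y \<oplus>\<^bsub>F 0\<^esub> y') \<ominus>\<^bsub>F 0\<^esub> (c \<oplus> c') \<odot>\<^bsub>F 0\<^esub> ?e q =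
        (s \<odot>\<^bsub>F 0\<^esub> y \<ominus>\<^bsub>F 0\<^esub> c \<odot>\<^bsub>F 0\<^esub> ?e q) \<oplus>\<^bsub>F 0\<^esub> (s \<odot>\<^bsub>F 0\<^esub> y' \<ominus>\<^bsub>F 0\<^esub> c' \<odot>\<^bsub>F 0\<^esub> ?e q)"
      using y c(1,2) s(1) by (simp add: F.smult_l_distr F.smult_r_distr F.minus_eq F.minus_add F.a_ac)
    hence "s \<odot>\<^bsub>F 0\<^esub> (y \<oplus>\<^bsub>F 0\<^esub> y') \<ominus>\<^bsub>F 0\<^esub> (c \<oplus> c') \<odot>\<^bsub>F 0\<^esub> ?e q \<in> ?N q"
      using ND(3)[OF c(5,6)] by simp
    moreover have "u \<oplus> u' = (c \<oplus> c') \<otimes> z" using c z by (simp add: l_distr)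
    ultimately show "?Q (y \<oplus>\<^bsub>F 0\<^esub> y') (u \<oplus>\<^bsub>self_module R\<^esub> u')"
      using c(1,2) by (intro bexI[of _ "c \<oplus> c'"]) simp_all
  next
    fix a y u assume a: "a \<in> carrier R" and y: "y \<in> carrier (F 0)" and "?Q y u"
    then obtain c where c: "c \<in> carrier R" "u = c \<otimes> z" "s \<odot>\<^bsub>F 0\<^esub> y \<ominus>\<^bsub>F 0\<^esub> c \<odot>\<^bsub>F 0\<^esub> ?e q \<in> ?N q" by blast
    have "s \<odot>\<^bsub>F 0\<^esub> (a \<odot>\<^bsub>F 0\<^esub> y) \<ominus>\<^bsub>F 0\<^esub> (a \<otimes> c) \<odot>\<^bsub>F 0\<^esub> ?e q = a \<odot>\<^bsub>F 0\<^esub> (s \<odot>\<^bsub>F 0\<^esub> y \<ominus>\<^bsub>F 0\<^esub> c \<odot>\<^bsub>F 0\<^esub> ?e q)"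
      using y a c(1) s(1) by (simp add: F.smult_minus_distr F.smult_assoc1 F.smult_commute[of s a])
    hence "s \<odot>\<^bsub>F 0\<^esub> (a \<odot>\<^bsub>F 0\<^esub> y) \<ominus>\<^bsub>F 0\<^esub> (a \<otimes> c) \<odot>\<^bsub>F 0\<^esub> ?e q \<in> ?N q"
      using ND(4)[OF a c(3)] by simp
    moreover have "a \<otimes> u = (a \<otimes> c) \<otimes> z" using a c z by (simp add: m_assoc)
    ultimately show "?Q (a \<odot>\<^bsub>F 0\<^esub> y) (a \<odot>\<^bsub>self_module R\<^esub> u)"
      using a c(1) by (intro bexI[of _ "a \<otimes> c"]) simp_all
  qed (use that in blast)
  have "f (d 0 x) \<in> J" if x: "x \<in> carrier (F (Suc 0))" for x
  proof -
    obtain c where c: "c \<in> carrier R" "f (d 0 x) = c \<otimes> z"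
      "s \<odot>\<^bsub>F 0\<^esub> d 0 x \<ominus>\<^bsub>F 0\<^esub> c \<odot>\<^bsub>F 0\<^esub> ?e q \<in> ?N q" using f(2)[OF d_closed[OF x]] by blast
    have dx: "d 0 x \<in> carrier (F 0)" by (rule d_closed[OF x])
    have "d 0 x \<in> ?N q" using free_filtration_superset[OF image_submodule, of q] x by auto
    hence "s \<odot>\<^bsub>F 0\<^esub> d 0 x \<in> ?N q" using ND(4)[OF s(1)] by blast
    from F.submodule_minus[OF N this c(3)]
    have "c \<odot>\<^bsub>F 0\<^esub> ?e q \<in> ?N q"
      using dx s(1) c(1) by (simp add: F.minus_eq F.minus_add F.minus_minus F.a_assoc[symmetric] F.r_neg)
    thus ?thesis using IP[OF c(1)] cz[OF c(1)] c(2) by simp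
  qed
  hence "cocycle_mod R n d J 0 f" using f(1) by (simp add: cocycle_mod_def)
  moreover have "P = {a \<in> carrier R. coboundary_mod R n d J 0 (\<lambda>x. a \<otimes> f x)}"
  proof (intro equalityI subsetI)
    fix a assume a: "a \<in> P"
    have aR: "a \<in> carrier R" using idealD(1)[OF PI a] .
    have "a \<otimes> f x \<in> J" if x: "x \<in> carrier (F 0)" for x
    proof -
      obtain c where c: "c \<in> carrier R" "f x = c \<otimes> z" using f(2)[OF x] by blast
      have "a \<otimes> f x = c \<otimes> (a \<otimes> z)" using aR c z by (simp add: m_lcomm)
      moreover have "a \<otimes> z \<in> J" using cz[OF aR] a by blast
      ultimately show ?thesis using idealD(4)[OF J c(1)] by simp
    qed
    thus "a \<in> {a \<in> carrier R. coboundary_mod R n d J 0 (\<lambda>x. a \<otimes> f x)}"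
      using aR by (simp add: coboundary_mod_def)
  next
    fix a assume "a \<in> {a \<in> carrier R. coboundary_mod R n d J 0 (\<lambda>x. a \<otimes> f x)}"
    hence aR: "a \<in> carrier R" and aJ: "a \<otimes> f (?e q) \<in> J" by (simp_all add: coboundary_mod_def)
    obtain c where c: "c \<in> carrier R" "f (?e q) = c \<otimes> z"
      "s \<odot>\<^bsub>F 0\<^esub> ?e q \<ominus>\<^bsub>F 0\<^esub> c \<odot>\<^bsub>F 0\<^esub> ?e q \<in> ?N q" using f(2)[OF std_basis_free] by blast
    have "(s \<ominus> c) \<odot>\<^bsub>F 0\<^esub> ?e q = s \<odot>\<^bsub>F 0\<^esub> ?e q \<ominus>\<^bsub>F 0\<^esub> c \<odot>\<^bsub>F 0\<^esub> ?e q"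
      using s(1) c(1) by (simp add: minus_eq F.minus_eq F.smult_l_distr F.smult_l_minus)
    hence sc: "s \<ominus> c \<in> P" using c(1,3) s(1) by (intro IP) simp_all
    have "c \<notin> P"
    proof
      assume "c \<in> P"
      from idealD(3)[OF PI sc this] have "s \<in> P" using s(1) c(1) by (simp add: minus_eq a_assoc l_neg)
      thus False using s(2) by simp
    qed
    moreover have "a \<otimes> c \<in> P" using aJ cz[of "a \<otimes> c"] aR c z by (simp add: m_assoc)
    ultimately show "a \<in> P" using primeD(3)[OF pr aR c(1)] by blast
  qed
  ultimately show ?thesis using pr unfolding cohomology_mod_primes_def by blast
qed

section \<open>Return from cochains modulo the zero ideal to the cohomology modules\<close>

lemma coboundary_mod_zero_iff:
  assumes f: "f \<in> module_hom R (F j) (self_module R)" and a: "a \<in> carrier R"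
  shows "a \<odot>\<^bsub>hom_module R (F j) (self_module R)\<^esub> f \<in> coboundaries R (self_module R) n d j \<longleftrightarrow>
    coboundary_mod R n d {\<zero>} j (\<lambda>x. a \<otimes> f x)"
proof -
  interpret H: module R "hom_module R (F j) (self_module R)" by (rule hom_module) (rule free_module self_module)+
  have af: "(\<lambda>x\<in>carrier (F j). a \<otimes> f x) \<in> module_hom R (F j) (self_module R)"
    using H.smult_closed[of a f] f a by simp
  have fl: "linear_map R (F j) (self_module R) f" using f by (rule module_hom_linear_map)
  show ?thesis
  proof (cases j)
    case 0
    thus ?thesis using af by (simp add: coboundaries_0_iff[OF self_module exact] coboundary_mod_def)
  next
    case (Suc k)
    have "a \<otimes> f x \<ominus> g (d k x) = \<zero> \<longleftrightarrow> a \<otimes> f x = g (d k x)"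
      if "x \<in> carrier (F (Suc k))" "linear_map R (F k) (self_module R) g" for x g
      using that linear_form_closed[OF fl, of x] linear_form_closed[OF that(2) d_closed[OF that(1)]] a Suc
        S.minus_eq_zero_iff by simp
    thus ?thesis using af Suc
      by (auto simp: coboundaries_Suc_iff[OF self_module exact] coboundary_mod_def)
  qed
qed

lemma cocycle_mod_zero: "f \<in> cocycles R (self_module R) n d j \<Longrightarrow> cocycle_mod R n d {\<zero>} j f"
  by (simp add: cocycles_iff[OF self_module exact] cocycle_mod_def module_hom_linear_map)

text \<open>This is the source of the ascending chain of annihilators of the iterated Ext
  modules.\<close>

lemma annihilator_cohomology:
  assumes "a \<in> coker_annihilator R n d" "f \<in> cocycles R (self_module R) n d j"
  shows "a \<odot>\<^bsub>hom_module R (F j) (self_module R)\<^esub> f \<in> coboundaries R (self_module R) n d j"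
  using annihilator_cocycle[OF assms(1) cocycle_mod_zero[OF assms(2)]] assms
  by (subst coboundary_mod_zero_iff) (simp_all add: coker_annihilator_def cocycles_iff[OF self_module exact])

lemma Ass_hom_cohomology_mod:
  "Ass R (hom_cohomology R (self_module R) n d j) = cohomology_mod_primes R n d {\<zero>} j"
proof -
  have 1: "{a \<in> carrier R. a \<odot>\<^bsub>hom_module R (F j) (self_module R)\<^esub> f \<in> coboundaries R (self_module R) n d j} =
      {a \<in> carrier R. coboundary_mod R n d {\<zero>} j (\<lambda>x. a \<otimes> f x)}"
    if "f \<in> cocycles R (self_module R) n d j" for f
    using that coboundary_mod_zero_iff[of f j] by (auto simp: cocycles_iff[OF self_module exact])
  have 2: "\<exists>g\<in>cocycles R (self_module R) n d j. \<forall>a.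
      coboundary_mod R n d {\<zero>} j (\<lambda>x. a \<otimes> g x) = coboundary_mod R n d {\<zero>} j (\<lambda>x. a \<otimes> f x)"
    if f: "cocycle_mod R n d {\<zero>} j f" for f
  proof (intro bexI[of _ "restrict f (carrier (F j))"] allI)
    show "coboundary_mod R n d {\<zero>} j (\<lambda>x. a \<otimes> restrict f (carrier (F j)) x) =
        coboundary_mod R n d {\<zero>} j (\<lambda>x. a \<otimes> f x)" for a
      by (cases j) (auto simp: coboundary_mod_def)
    show "restrict f (carrier (F j)) \<in> cocycles R (self_module R) n d j"
      using f d_closed[of _ j] restrict_module_hom[OF _ free_module, of "n j" "self_module R" f]
      by (auto simp: cocycles_iff[OF self_module exact] cocycle_mod_def)
  qed
  show ?thesis
    unfolding Ass_hom_cohomology[OF self_module exact] cohomology_mod_primes_def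
  proof (intro Collect_cong conj_cong refl iffI)
    fix P
    assume "\<exists>f\<in>cocycles R (self_module R) n d j. P = {a \<in> carrier R.
      a \<odot>\<^bsub>hom_module R (F j) (self_module R)\<^esub> f \<in> coboundaries R (self_module R) n d j}"
    thus "\<exists>f. cocycle_mod R n d {\<zero>} j f \<and> P = {a \<in> carrier R. coboundary_mod R n d {\<zero>} j (\<lambda>x. a \<otimes> f x)}"
      using 1 cocycle_mod_zero by blast
  next
    fix P
    assume "\<exists>f. cocycle_mod R n d {\<zero>} j f \<and> P = {a \<in> carrier R. coboundary_mod R n d {\<zero>} j (\<lambda>x. a \<otimes> f x)}"
    then obtain f where f: "cocycle_mod R n d {\<zero>} j f"
      "P = {a \<in> carrier R. coboundary_mod R n d {\<zero>} j (\<lambda>x. a \<otimes> f x)}" by blast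
    obtain g where g: "g \<in> cocycles R (self_module R) n d j" "\<forall>a. coboundary_mod R n d {\<zero>} j (\<lambda>x. a \<otimes> g x) =
      coboundary_mod R n d {\<zero>} j (\<lambda>x. a \<otimes> f x)" using 2[OF f(1)] by blast
    show "\<exists>f\<in>cocycles R (self_module R) n d j. P = {a \<in> carrier R.
      a \<odot>\<^bsub>hom_module R (F j) (self_module R)\<^esub> f \<in> coboundaries R (self_module R) n d j}"
      using 1[OF g(1)] g f(2) by (intro bexI[of _ g]) simp_all
  qed
qed

text \<open>On the right the module enters only through its annihilator, and one ideal J serves all
  modules annihilated by \<open>A\<close>. This makes the iterated Ext modules comparable with each
  other.\<close>

lemma Ass_hom_cohomology_regular_chain:
  assumes "regular_chain R A l J" "A \<subseteq> coker_annihilator R n d"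
  shows "Ass R (hom_cohomology R (self_module R) n d l) =
    {P \<in> assoc_primes R J. coker_annihilator R n d \<subseteq> P}"
proof -
  have "A \<subseteq> carrier R" using assms(2) by (auto simp: coker_annihilator_def)
  hence J: "ideal J R" by (rule regular_chain_ideal[OF assms(1)])
  have eq: "Ass R (hom_cohomology R (self_module R) n d l) = cohomology_mod_primes R n d J 0"
    using regular_chain_cohomology[OF assms, of 0] by (simp add: Ass_hom_cohomology_mod)
  show ?thesis
    unfolding eq
  proof (intro equalityI subsetI)
    fix P assume P: "P \<in> cohomology_mod_primes R n d J 0"
    show "P \<in> {P \<in> assoc_primes R J. coker_annihilator R n d \<subseteq> P}"
      using cohomology_mod_primes_0_subset[OF J P] by simp
  next
    fix P assume "P \<in> {P \<in> assoc_primes R J. coker_annihilator R n d \<subseteq> P}"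
    thus "P \<in> cohomology_mod_primes R n d J 0"
      using cohomology_mod_primes_0_superset[OF J, of P] by simp
  qed
qed

end

section \<open>Injective resolutions\<close>

text \<open>This replaces all extensions along injections.\<close>

lemma (in cring) injective_extend:
  assumes inj: "injective_module R N"
    and zero: "Q \<zero>\<^bsub>free_module R k\<^esub> \<zero>\<^bsub>N\<^esub>"
    and add: "\<And>x y u v. \<lbrakk>x \<in> carrier (free_module R k); y \<in> carrier (free_module R k);
        u \<in> carrier N; v \<in> carrier N; Q x u; Q y v\<rbrakk> \<Longrightarrow> Q (x \<oplus>\<^bsub>free_module R k\<^esub> y) (u \<oplus>\<^bsub>N\<^esub> v)"
    and smult: "\<And>a x u. \<lbrakk>a \<in> carrier R; x \<in> carrier (free_module R k); u \<in> carrier N; Q x u\<rbrakk>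
        \<Longrightarrow> Q (a \<odot>\<^bsub>free_module R k\<^esub> x) (a \<odot>\<^bsub>N\<^esub> u)"
    and single: "\<And>u. u \<in> carrier N \<Longrightarrow> Q \<zero>\<^bsub>free_module R k\<^esub> u \<Longrightarrow> u = \<zero>\<^bsub>N\<^esub>"
  obtains g where "linear_map R (free_module R k) N g"
    "\<And>x u. x \<in> carrier (free_module R k) \<Longrightarrow> u \<in> carrier N \<Longrightarrow> Q x u \<Longrightarrow> g x = u"
proof -
  let ?F = "free_module R k"
  interpret F: module R ?F by (rule free_module)
  interpret N: module R N using inj by (simp add: injective_module_def)
  \<comment> \<open>\<open>Q\<close> is treated as the graph of a partial homomorphism with domain
    \<open>?A\<close>. The free module has the element type of the test modules in
    \<open>injective_module\<close>, so the extension property applies to it.\<close>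
  let ?A = "{x \<in> carrier ?F. \<exists>u\<in>carrier N. Q x u}"
  have A: "submodule ?A R ?F"
  proof (rule F.submoduleI')
    show "\<zero>\<^bsub>?F\<^esub> \<in> ?A" using zero by auto
    show "x \<oplus>\<^bsub>?F\<^esub> y \<in> ?A" if xy: "x \<in> ?A" "y \<in> ?A" for x y
    proof -
      obtain u v where "u \<in> carrier N" "v \<in> carrier N" "Q x u" "Q y v" using xy by blast
      thus ?thesis using xy add[of x y u v] by (auto intro!: bexI[of _ "u \<oplus>\<^bsub>N\<^esub> v"])
    qed
    show "a \<odot>\<^bsub>?F\<^esub> x \<in> ?A" if ax: "a \<in> carrier R" "x \<in> ?A" for a x
    proof -
      obtain u where "u \<in> carrier N" "Q x u" using ax by blast
      thus ?thesis using ax smult[of a x u] by (auto intro!: bexI[of _ "a \<odot>\<^bsub>N\<^esub> u"])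
    qed
  qed blast
  \<comment> \<open>Two values at the same argument differ by a value at zero, and
    \<open>single\<close> leaves only zero there.\<close>
  have uniq: "u = v" if x: "x \<in> carrier ?F" and uv: "u \<in> carrier N" "v \<in> carrier N" and Q: "Q x u" "Q x v" for x u v
  proof -
    have "Q (x \<oplus>\<^bsub>?F\<^esub> (\<ominus> \<one>) \<odot>\<^bsub>?F\<^esub> x) (u \<oplus>\<^bsub>N\<^esub> (\<ominus> \<one>) \<odot>\<^bsub>N\<^esub> v)"
      using x uv Q by (intro add smult) simp_all
    moreover have "x \<oplus>\<^bsub>?F\<^esub> (\<ominus> \<one>) \<odot>\<^bsub>?F\<^esub> x = \<zero>\<^bsub>?F\<^esub>" using x F.minus_eq_zero_iff[OF x x] F.minus_as_smult[OF x x] by simp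
    ultimately have "u \<oplus>\<^bsub>N\<^esub> (\<ominus> \<one>) \<odot>\<^bsub>N\<^esub> v = \<zero>\<^bsub>N\<^esub>" using uv by (intro single) simp_all
    thus ?thesis using N.minus_eq_zero_iff[OF uv] N.minus_as_smult[OF uv] by simp
  qed
  define f where "f = (\<lambda>x\<in>?A. SOME u. u \<in> carrier N \<and> Q x u)"
  have f: "f x \<in> carrier N" "Q x (f x)" if "x \<in> ?A" for x
  proof -
    have "\<exists>u. u \<in> carrier N \<and> Q x u" using that by blast
    from someI_ex[OF this] that show "f x \<in> carrier N" "Q x (f x)" by (simp_all add: f_def)
  qed
  have f_eq: "f x = u" if "x \<in> carrier ?F" "u \<in> carrier N" "Q x u" for x u
  proof -
    have x: "x \<in> ?A" using that by blast
    show ?thesis by (rule uniq[OF that(1) f(1)[OF x] that(2) f(2)[OF x] that(3)])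
  qed
  have "f \<in> module_hom R (?F\<lparr>carrier := ?A\<rparr>) N"
    unfolding module_hom_iff
  proof
    show "linear_map R (?F\<lparr>carrier := ?A\<rparr>) N f"
    proof (rule linear_mapI)
      fix x assume "x \<in> carrier (?F\<lparr>carrier := ?A\<rparr>)"
      hence x: "x \<in> ?A" by simp
      show "f x \<in> carrier N" by (rule f(1)[OF x])
      show "f (x \<oplus>\<^bsub>?F\<lparr>carrier := ?A\<rparr>\<^esub> y) = f x \<oplus>\<^bsub>N\<^esub> f y" if "y \<in> carrier (?F\<lparr>carrier := ?A\<rparr>)" for y
      proof -
        have y: "y \<in> ?A" using that by simp
        have "f (x \<oplus>\<^bsub>?F\<^esub> y) = f x \<oplus>\<^bsub>N\<^esub> f y"
          using x y f[OF x] f[OF y] by (intro f_eq add) simp_all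
        thus ?thesis by simp
      qed
      show "f (a \<odot>\<^bsub>?F\<lparr>carrier := ?A\<rparr>\<^esub> x) = a \<odot>\<^bsub>N\<^esub> f x" if a: "a \<in> carrier R" for a
      proof -
        have "f (a \<odot>\<^bsub>?F\<^esub> x) = a \<odot>\<^bsub>N\<^esub> f x"
          using x a f[OF x] by (intro f_eq smult) simp_all
        thus ?thesis by simp
      qed
    qed
    show "f \<in> extensional (carrier (?F\<lparr>carrier := ?A\<rparr>))" by (simp add: f_def)
  qed
  then obtain g where g: "g \<in> module_hom R ?F N" "\<forall>x\<in>?A. g x = f x"
    using inj F.module_axioms A unfolding injective_module_def by blast
  show thesis
  proof
    show "linear_map R ?F N g" by (rule module_hom_linear_map[OF g(1)])
    show "g x = u" if "x \<in> carrier ?F" "u \<in> carrier N" "Q x u" for x u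
    proof -
      have "x \<in> ?A" using that by blast
      thus ?thesis using g(2) f_eq[OF that] by simp
    qed
  qed
qed

text \<open>Exactness is required in positive degrees only, and R is not yet embedded in
  \<open>I 0\<close>; this is the dual of \<open>free_exact_complex\<close>. The augmentation is
  added in \<open>gorenstein\<close>.\<close>

locale injective_complex = cring R for R :: "('a, 'm) ring_scheme" (structure) +
  fixes I :: "nat \<Rightarrow> ('a, 'c) module" and \<delta> :: "nat \<Rightarrow> 'c \<Rightarrow> 'c"
  assumes injective: "injective_module R (I j)"
    and \<delta>_linear: "linear_map R (I j) (I (Suc j)) (\<delta> j)"
    and \<delta>_exact: "\<delta> j ` carrier (I j) = a_kernel (I (Suc j)) (I (Suc (Suc j))) (\<delta> (Suc j))"
begin

lemma I_module: "module R (I j)"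
  using injective[of j] by (simp add: injective_module_def)

sublocale I: module R "I j" for j by (rule I_module)

lemmas \<delta>_closed = linear_mapD(1)[OF \<delta>_linear]
lemmas \<delta>_add = linear_mapD(2)[OF \<delta>_linear]
lemmas \<delta>_smult = linear_mapD(3)[OF \<delta>_linear]
lemmas \<delta>_zero = linear_map_zero[OF \<delta>_linear I_module I_module]
lemmas \<delta>_minus = linear_map_minus[OF \<delta>_linear I_module I_module]

lemma \<delta>_\<delta>: "z \<in> carrier (I j) \<Longrightarrow> \<delta> (Suc j) (\<delta> j z) = \<zero>\<^bsub>I (Suc (Suc j))\<^esub>"
  using \<delta>_exact[of j] by (auto simp: a_kernel_iff set_eq_iff)

lemma \<delta>_kernel:
  assumes "z \<in> carrier (I (Suc j))" "\<delta> (Suc j) z = \<zero>\<^bsub>I (Suc (Suc j))\<^esub>"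
  obtains w where "w \<in> carrier (I j)" "z = \<delta> j w"
proof -
  have "z \<in> a_kernel (I (Suc j)) (I (Suc (Suc j))) (\<delta> (Suc j))" using assms by (simp add: a_kernel_iff)
  thus thesis using \<delta>_exact[of j] that by (metis imageE)
qed

text \<open>\<open>torsion J j\<close> is \<open>Hom(R/J, I j)\<close>, so \<open>Ext(R/J, R)\<close> is the cohomology of these modules.\<close>

definition torsion :: "'a set \<Rightarrow> nat \<Rightarrow> 'c set" where
  "torsion J j = {z \<in> carrier (I j). \<forall>r\<in>J. r \<odot>\<^bsub>I j\<^esub> z = \<zero>\<^bsub>I j\<^esub>}"

definition torsion_cocycles :: "'a set \<Rightarrow> nat \<Rightarrow> 'c set" where
  "torsion_cocycles J j = {z \<in> torsion J j. \<delta> j z = \<zero>\<^bsub>I (Suc j)\<^esub>}"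

lemma torsion_submodule:
  assumes "J \<subseteq> carrier R"
  shows "submodule (torsion J j) R (I j)"
proof (rule I.submoduleI')
  show "\<zero>\<^bsub>I j\<^esub> \<in> torsion J j" using assms by (auto simp: torsion_def)
  show "x \<oplus>\<^bsub>I j\<^esub> y \<in> torsion J j" if "x \<in> torsion J j" "y \<in> torsion J j" for x y
  proof -
    have "r \<odot>\<^bsub>I j\<^esub> (x \<oplus>\<^bsub>I j\<^esub> y) = \<zero>\<^bsub>I j\<^esub>" if "r \<in> J" for r
      using that assms \<open>x \<in> torsion J j\<close> \<open>y \<in> torsion J j\<close> by (auto simp: torsion_def I.smult_r_distr subset_iff)
    thus ?thesis using that by (simp add: torsion_def)
  qed
  show "a \<odot>\<^bsub>I j\<^esub> x \<in> torsion J j" if a: "a \<in> carrier R" and x: "x \<in> torsion J j" for a x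
  proof -
    have "r \<odot>\<^bsub>I j\<^esub> (a \<odot>\<^bsub>I j\<^esub> x) = \<zero>\<^bsub>I j\<^esub>" if "r \<in> J" for r
    proof -
      have "r \<in> carrier R" "r \<odot>\<^bsub>I j\<^esub> x = \<zero>\<^bsub>I j\<^esub>" using that assms x by (auto simp: torsion_def)
      thus ?thesis using x a by (simp add: torsion_def I.smult_commute[of r a])
    qed
    thus ?thesis using a x by (simp add: torsion_def)
  qed
qed (auto simp: torsion_def)

lemma torsion_\<delta>: "z \<in> torsion J j \<Longrightarrow> J \<subseteq> carrier R \<Longrightarrow> \<delta> j z \<in> torsion J (Suc j)"
proof -
  assume z: "z \<in> torsion J j" and J: "J \<subseteq> carrier R"
  have "r \<odot>\<^bsub>I (Suc j)\<^esub> \<delta> j z = \<zero>\<^bsub>I (Suc j)\<^esub>" if r: "r \<in> J" for r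
  proof -
    have "z \<in> carrier (I j)" "r \<in> carrier R" "r \<odot>\<^bsub>I j\<^esub> z = \<zero>\<^bsub>I j\<^esub>" using z J r by (auto simp: torsion_def)
    thus ?thesis using \<delta>_smult[of r z j] \<delta>_zero[of j] by simp
  qed
  thus "\<delta> j z \<in> torsion J (Suc j)" using z \<delta>_closed by (simp add: torsion_def)
qed

lemma torsion_antimono: "J \<subseteq> J' \<Longrightarrow> torsion J' j \<subseteq> torsion J j"
  by (auto simp: torsion_def)

text \<open>Restriction of homomorphisms along the injection of R/(J:a) into R/J by a. Its kernel is
  the torsion of J + aR, by \<open>torsion_adjoin\<close>, and it is onto by
  \<open>torsion_lift\<close>; together they form the short exact sequences behind the chases
  below.\<close>

lemma torsion_colon:
  assumes "z \<in> torsion J j" "a \<in> carrier R"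
  shows "a \<odot>\<^bsub>I j\<^esub> z \<in> torsion (colon R J a) j"
proof -
  have "r \<odot>\<^bsub>I j\<^esub> (a \<odot>\<^bsub>I j\<^esub> z) = \<zero>\<^bsub>I j\<^esub>" if r: "r \<in> colon R J a" for r
  proof -
    have "r \<in> carrier R" "a \<otimes> r \<in> J" using r by (auto simp: colon_def)
    hence "(r \<otimes> a) \<odot>\<^bsub>I j\<^esub> z = \<zero>\<^bsub>I j\<^esub>" using assms by (simp add: torsion_def m_comm)
    thus ?thesis using assms \<open>r \<in> carrier R\<close> by (simp add: torsion_def I.smult_assoc1)
  qed
  thus ?thesis using assms by (simp add: torsion_def)
qed

lemma torsion_adjoin:
  assumes "ideal J R" "z \<in> torsion J j" "a \<in> carrier R" "a \<odot>\<^bsub>I j\<^esub> z = \<zero>\<^bsub>I j\<^esub>"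
  shows "z \<in> torsion (ideal_adjoin R J a) j"
proof -
  have z: "z \<in> carrier (I j)" using assms(2) by (simp add: torsion_def)
  have "(k \<oplus> a \<otimes> r) \<odot>\<^bsub>I j\<^esub> z = \<zero>\<^bsub>I j\<^esub>" if k: "k \<in> J" and r: "r \<in> carrier R" for k r
  proof -
    have kR: "k \<in> carrier R" using idealD(1)[OF assms(1) k] .
    have "k \<odot>\<^bsub>I j\<^esub> z = \<zero>\<^bsub>I j\<^esub>" using assms(2) k by (simp add: torsion_def)
    moreover have "(a \<otimes> r) \<odot>\<^bsub>I j\<^esub> z = \<zero>\<^bsub>I j\<^esub>"
      using I.smult_commute[OF assms(3) r z] assms(3,4) r z by (simp add: I.smult_assoc1)
    ultimately show ?thesis using kR r z assms(3) by (simp add: I.smult_l_distr)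
  qed
  thus ?thesis using z by (auto simp: torsion_def ideal_adjoin_def)
qed

text \<open>Injectivity of \<open>I j\<close>: on the ideal J + aR the assignment of r z to k + a r
  is well defined, because a r in J puts r into (J:a), which kills z. The extension to R has the
  value u at 1.\<close>

lemma torsion_lift:
  assumes J: "ideal J R" and a: "a \<in> carrier R" and z: "z \<in> torsion (colon R J a) j"
  obtains u where "u \<in> torsion J j" "a \<odot>\<^bsub>I j\<^esub> u = z"
proof -
  let ?F = "free_module R (Suc 0)" and ?e = "std_basis R (Suc 0) 0"
  interpret F: module R ?F by (rule free_module)
  have zI: "z \<in> carrier (I j)" using z by (simp add: torsion_def)
  note JD = idealD[OF J]
  \<comment> \<open>The ideal is placed in the free module of rank one, where the extension property
    is available.\<close>
  let ?Q = "\<lambda>x u. \<exists>k\<in>J. \<exists>r\<in>carrier R. x = (k \<oplus> a \<otimes> r) \<odot>\<^bsub>?F\<^esub> ?e \<and> u = r \<odot>\<^bsub>I j\<^esub> z"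
  have coord: "(c \<odot>\<^bsub>?F\<^esub> ?e) 0 = c" if "c \<in> carrier R" for c
    using that by (simp add: free_module_simps std_basis_def)
  obtain g where g: "linear_map R ?F (I j) g"
    "\<And>x u. x \<in> carrier ?F \<Longrightarrow> u \<in> carrier (I j) \<Longrightarrow> ?Q x u \<Longrightarrow> g x = u"
  proof (rule injective_extend[OF injective[of j], of ?Q "Suc 0"])
    show "?Q \<zero>\<^bsub>?F\<^esub> \<zero>\<^bsub>I j\<^esub>"
      by (rule bexI[OF _ JD(2)], rule bexI[of _ "\<zero>"]) (use a zI in simp_all)
  next
    fix x y u v assume "?Q x u" "?Q y v"
    then obtain k r k' r' where *: "k \<in> J" "r \<in> carrier R" "x = (k \<oplus> a \<otimes> r) \<odot>\<^bsub>?F\<^esub> ?e" "u = r \<odot>\<^bsub>I j\<^esub> z"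
      "k' \<in> J" "r' \<in> carrier R" "y = (k' \<oplus> a \<otimes> r') \<odot>\<^bsub>?F\<^esub> ?e" "v = r' \<odot>\<^bsub>I j\<^esub> z" by blast
    have kR: "k \<in> carrier R" "k' \<in> carrier R" using JD(1) *(1,5) by auto
    have "(k \<oplus> k') \<oplus> a \<otimes> (r \<oplus> r') = (k \<oplus> a \<otimes> r) \<oplus> (k' \<oplus> a \<otimes> r')"
      using kR *(2,6) a by algebra
    hence "x \<oplus>\<^bsub>?F\<^esub> y = ((k \<oplus> k') \<oplus> a \<otimes> (r \<oplus> r')) \<odot>\<^bsub>?F\<^esub> ?e"
      using kR *(2,6) a by (simp add: *(3,7) F.smult_l_distr)
    moreover have "u \<oplus>\<^bsub>I j\<^esub> v = (r \<oplus> r') \<odot>\<^bsub>I j\<^esub> z" using *(2,6) zI by (simp add: *(4,8) I.smult_l_distr)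
    ultimately show "?Q (x \<oplus>\<^bsub>?F\<^esub> y) (u \<oplus>\<^bsub>I j\<^esub> v)" using JD(3)[OF *(1,5)] a_closed[OF *(2,6)] by blast
  next
    fix b x u assume b: "b \<in> carrier R" and "?Q x u"
    then obtain k r where *: "k \<in> J" "r \<in> carrier R" "x = (k \<oplus> a \<otimes> r) \<odot>\<^bsub>?F\<^esub> ?e" "u = r \<odot>\<^bsub>I j\<^esub> z" by blast
    have kR: "k \<in> carrier R" using JD(1) *(1) by auto
    have "b \<otimes> k \<oplus> a \<otimes> (b \<otimes> r) = b \<otimes> (k \<oplus> a \<otimes> r)" using kR *(2) a b by algebra
    hence "b \<odot>\<^bsub>?F\<^esub> x = (b \<otimes> k \<oplus> a \<otimes> (b \<otimes> r)) \<odot>\<^bsub>?F\<^esub> ?e" using kR *(2) a b by (simp add: *(3) F.smult_assoc1)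
    moreover have "b \<odot>\<^bsub>I j\<^esub> u = (b \<otimes> r) \<odot>\<^bsub>I j\<^esub> z" using *(2) zI b by (simp add: *(4) I.smult_assoc1)
    ultimately show "?Q (b \<odot>\<^bsub>?F\<^esub> x) (b \<odot>\<^bsub>I j\<^esub> u)" using JD(4)[OF b *(1)] m_closed[OF b *(2)] by blast
  next
    fix u assume "?Q \<zero>\<^bsub>?F\<^esub> u"
    then obtain k r where *: "k \<in> J" "r \<in> carrier R" "\<zero>\<^bsub>?F\<^esub> = (k \<oplus> a \<otimes> r) \<odot>\<^bsub>?F\<^esub> ?e" "u = r \<odot>\<^bsub>I j\<^esub> z" by blast
    have kR: "k \<in> carrier R" using JD(1) *(1) by auto
    have "\<zero>\<^bsub>?F\<^esub> 0 = \<zero>" by (simp add: free_module_simps)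
    hence "k \<oplus> a \<otimes> r = \<zero>" using *(3) coord[of "k \<oplus> a \<otimes> r"] kR a *(2) by simp
    hence "k \<oplus> a \<otimes> r \<in> J" using JD(2) by simp
    hence "a \<otimes> r \<in> J" using ideal_add_cancel[OF J *(1)] a *(2) by blast
    thus "u = \<zero>\<^bsub>I j\<^esub>" using z *(2,4) by (simp add: torsion_def colon_def)
  qed (use that in blast)
  have ge: "g (c \<odot>\<^bsub>?F\<^esub> ?e) = c \<odot>\<^bsub>I j\<^esub> g ?e" if "c \<in> carrier R" for c
    using linear_mapD(3)[OF g(1) that] by simp
  have gI: "g ?e \<in> carrier (I j)" using linear_mapD(1)[OF g(1)] by simp
  have "r \<odot>\<^bsub>I j\<^esub> g ?e = \<zero>\<^bsub>I j\<^esub>" if r: "r \<in> J" for r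
  proof -
    have rR: "r \<in> carrier R" using JD(1)[OF r] .
    have "?Q (r \<odot>\<^bsub>?F\<^esub> ?e) \<zero>\<^bsub>I j\<^esub>"
      by (rule bexI[OF _ r], rule bexI[of _ "\<zero>"]) (use a rR zI in simp_all)
    hence "g (r \<odot>\<^bsub>?F\<^esub> ?e) = \<zero>\<^bsub>I j\<^esub>" using rR by (intro g(2)) simp_all
    thus ?thesis using ge[OF rR] by simp
  qed
  hence "g ?e \<in> torsion J j" using gI by (simp add: torsion_def)
  moreover have "a \<odot>\<^bsub>I j\<^esub> g ?e = z"
  proof -
    have "?Q (a \<odot>\<^bsub>?F\<^esub> ?e) z"
      by (rule bexI[OF _ JD(2)], rule bexI[of _ "\<one>"]) (use a zI in simp_all)
    hence "g (a \<odot>\<^bsub>?F\<^esub> ?e) = z" using a zI by (intro g(2)) simp_all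
    thus ?thesis using ge[OF a] by simp
  qed
  ultimately show thesis using that by blast
qed

text \<open>Ext^(k+1)(R/X, R) = 0 for k + 1 > l. For the zero ideal this is exactness of the
  complex. In the step Ext^(k+1) of the new quotient lies between Ext^k and Ext^(k+1) of the old
  one, so the bound rises by one.\<close>

lemma regular_chain_exact:
  assumes "regular_chain R A l X" "A \<subseteq> carrier R" "l \<le> k" "z \<in> torsion_cocycles X (Suc k)"
  shows "\<exists>w\<in>torsion X k. \<delta> k w = z"
  using assms(1,3,4)
proof (induction l X arbitrary: k z rule: regular_chain.induct)
  case zero
  then obtain w where "w \<in> carrier (I k)" "z = \<delta> k w"
    using \<delta>_kernel[of z k] by (auto simp: torsion_cocycles_def torsion_def)
  thus ?case by (intro bexI[of _ w]) (simp_all add: torsion_def)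
next
  case (Suc l X x)
  let ?X = "ideal_adjoin R X x"
  have X: "ideal X R" by (rule regular_chain_ideal[OF Suc.hyps(1) assms(2)])
  have XR: "X \<subseteq> carrier R" using idealD(1)[OF X] by blast
  have xR: "x \<in> carrier R" using Suc.hyps(2) assms(2) by blast
  obtain k' where k: "k = Suc k'" using Suc.prems(1) by (cases k) auto
  note TD = submoduleD[OF torsion_submodule[OF XR]]
  have sub: "torsion ?X j \<subseteq> torsion X j" for j
    by (rule torsion_antimono[OF ideal_adjoin_superset[OF X xR]])
  have "z \<in> torsion_cocycles X (Suc k)" using Suc.prems(2) sub by (auto simp: torsion_cocycles_def)
  then obtain w where w: "w \<in> torsion X k" "\<delta> k w = z" using Suc.IH[of k z] Suc.prems(1) by auto
  have wI: "w \<in> carrier (I k)" using TD(1)[OF w(1)] .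
  have "x \<odot>\<^bsub>I (Suc k)\<^esub> z = \<zero>\<^bsub>I (Suc k)\<^esub>"
    using Suc.prems(2) ideal_adjoin_self[OF X xR] by (simp add: torsion_cocycles_def torsion_def)
  hence "x \<odot>\<^bsub>I k\<^esub> w \<in> torsion_cocycles X k"
    using TD(4)[OF xR w(1)] \<delta>_smult[OF xR wI] w(2) by (simp add: torsion_cocycles_def)
  then obtain v where v: "v \<in> torsion X k'" "\<delta> k' v = x \<odot>\<^bsub>I k\<^esub> w"
    using Suc.IH[of k' "x \<odot>\<^bsub>I k\<^esub> w"] Suc.prems(1) k by auto
  obtain v' where v': "v' \<in> torsion X k'" "x \<odot>\<^bsub>I k'\<^esub> v' = v"
    using torsion_lift[OF X xR, of v k'] v(1) Suc.hyps(3) by auto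
  have v'I: "v' \<in> carrier (I k')" using TD(1)[OF v'(1)] .
  have dv': "\<delta> k' v' \<in> torsion X k" "\<delta> k' v' \<in> carrier (I k)" using torsion_\<delta>[OF v'(1) XR] \<delta>_closed[OF v'I] k by simp_all
  \<comment> \<open>The preimage w is killed by X but perhaps not by x. As x w is the boundary of v
    = x v', subtracting the boundary of v' repairs this without changing the image of w.\<close>
  let ?w = "w \<ominus>\<^bsub>I k\<^esub> \<delta> k' v'"
  have "x \<odot>\<^bsub>I k\<^esub> ?w = x \<odot>\<^bsub>I k\<^esub> w \<ominus>\<^bsub>I k\<^esub> \<delta> k' v"
    using \<delta>_smult[OF xR v'I] v'(2) k wI dv' xR by (simp add: I.smult_minus_distr)
  also have "\<dots> = \<zero>\<^bsub>I k\<^esub>" using v(2) wI xR by (simp add: I.minus_eq_zero_iff)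
  finally have "?w \<in> torsion ?X k"
    using I.submodule_minus[OF torsion_submodule[OF XR] w(1) dv'(1)] by (intro torsion_adjoin X xR)
  moreover have "\<delta> k ?w = z"
  proof -
    have "\<delta> k ?w = z \<ominus>\<^bsub>I (Suc k)\<^esub> \<zero>\<^bsub>I (Suc k)\<^esub>"
      using \<delta>_minus[OF wI dv'(2)] w(2) \<delta>_\<delta>[OF v'I] k by simp
    thus ?thesis using \<delta>_closed[OF wI] w(2) by (simp add: I.minus_eq)
  qed
  ultimately show ?case by blast
qed

text \<open>\<open>Ext\<^sup>k\<^sup>+\<^sup>1(R/J, R)\<close> vanishes after localization at \<open>P\<close>.\<close>

definition locally_exact :: "'a set \<Rightarrow> 'a set \<Rightarrow> nat \<Rightarrow> bool" where
  "locally_exact P J k \<longleftrightarrow> (\<forall>z\<in>torsion_cocycles J (Suc k).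
     \<exists>t\<in>carrier R. t \<notin> P \<and> (\<exists>w\<in>torsion J k. \<delta> k w = t \<odot>\<^bsub>I (Suc k)\<^esub> z))"

text \<open>In Ext^(k+1)(R/X) -> Ext^(k+1)(R/P) -> Ext^(k+2)(R/(X+aR)), all with values in R, the
  left term vanishes since g is at most k, and the right one vanishes at P by \<open>IH\<close>. The
  first map comes from the embedding of R/P into R/X by a.\<close>

lemma locally_exact_assoc_prime:
  assumes chain: "regular_chain R A g X" "A \<subseteq> carrier R" "g \<le> k"
    and P: "P \<in> assoc_primes R X"
    and IH: "\<And>J. ideal J R \<Longrightarrow> locally_exact P J (Suc k)"
  shows "locally_exact P P k"
  unfolding locally_exact_def
proof
  fix z assume z: "z \<in> torsion_cocycles P (Suc k)"
  from P obtain a where a: "a \<in> carrier R" "P = colon R X a" by (auto simp: assoc_primes_def)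
  have X: "ideal X R" by (rule regular_chain_ideal[OF chain(1,2)])
  have XR: "X \<subseteq> carrier R" using idealD(1)[OF X] by blast
  note TD = submoduleD[OF torsion_submodule[OF XR]]
  let ?X = "ideal_adjoin R X a"
  have sub: "torsion ?X j \<subseteq> torsion X j" for j
    by (rule torsion_antimono[OF ideal_adjoin_superset[OF X a(1)]])
  obtain u where u: "u \<in> torsion X (Suc k)" "a \<odot>\<^bsub>I (Suc k)\<^esub> u = z"
    using torsion_lift[OF X a(1), of z] z a(2) by (auto simp: torsion_cocycles_def)
  have uI: "u \<in> carrier (I (Suc k))" using TD(1)[OF u(1)] .
  have "a \<odot>\<^bsub>I (Suc (Suc k))\<^esub> \<delta> (Suc k) u = \<zero>\<^bsub>I (Suc (Suc k))\<^esub>"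
    using \<delta>_smult[OF a(1) uI] u(2) z by (simp add: torsion_cocycles_def)
  hence "\<delta> (Suc k) u \<in> torsion_cocycles ?X (Suc (Suc k))"
    using torsion_adjoin[OF X torsion_\<delta>[OF u(1) XR] a(1)] \<delta>_\<delta>[OF uI] by (simp add: torsion_cocycles_def)
  then obtain t w where t: "t \<in> carrier R" "t \<notin> P"
    and w: "w \<in> torsion ?X (Suc k)" "\<delta> (Suc k) w = t \<odot>\<^bsub>I (Suc (Suc k))\<^esub> \<delta> (Suc k) u"
    using IH[OF ideal_adjoin_ideal[OF X a(1)]] unfolding locally_exact_def by blast
  have wX: "w \<in> torsion X (Suc k)" using w(1) sub by blast
  have wI: "w \<in> carrier (I (Suc k))" using TD(1)[OF wX] .
  let ?y = "t \<odot>\<^bsub>I (Suc k)\<^esub> u \<ominus>\<^bsub>I (Suc k)\<^esub> w"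
  have "\<delta> (Suc k) ?y = \<zero>\<^bsub>I (Suc (Suc k))\<^esub>"
    using \<delta>_minus[of "t \<odot>\<^bsub>I (Suc k)\<^esub> u" "Suc k" w] \<delta>_smult[OF t(1) uI] w(2) t(1) uI wI \<delta>_closed[OF uI]
    by (simp add: I.minus_eq_zero_iff)
  hence "?y \<in> torsion_cocycles X (Suc k)"
    using I.submodule_minus[OF torsion_submodule[OF XR] TD(4)[OF t(1) u(1)] wX] by (simp add: torsion_cocycles_def)
  then obtain v where v: "v \<in> torsion X k" "\<delta> k v = ?y" using regular_chain_exact[OF chain] by blast
  have vI: "v \<in> carrier (I k)" using TD(1)[OF v(1)] .
  have aw: "a \<odot>\<^bsub>I (Suc k)\<^esub> w = \<zero>\<^bsub>I (Suc k)\<^esub>"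
    using w(1) ideal_adjoin_self[OF X a(1)] by (simp add: torsion_def)
  have "\<delta> k (a \<odot>\<^bsub>I k\<^esub> v) = t \<odot>\<^bsub>I (Suc k)\<^esub> z"
    using \<delta>_smult[OF a(1) vI] v(2) aw a(1) t(1) uI wI u(2) I.smult_commute[OF a(1) t(1) uI]
      I.smult_closed[OF a(1) uI]
    by (simp add: I.smult_minus_distr)
  moreover have "a \<odot>\<^bsub>I k\<^esub> v \<in> torsion P k" using torsion_colon[OF v(1) a(1)] a(2) by simp
  ultimately show "\<exists>t\<in>carrier R. t \<notin> P \<and> (\<exists>w\<in>torsion P k. \<delta> k w = t \<odot>\<^bsub>I (Suc k)\<^esub> z)"
    using t by blast
qed

text \<open>The middle term of Ext^(k+1)(R/(J+aR)) -> Ext^(k+1)(R/J) -> Ext^(k+1)(R/(J:a)) vanishes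
  at P if both ends do. The multipliers of the two ends are multiplied, and primality keeps the
  product outside P.\<close>

lemma locally_exact_split:
  assumes P: "primeideal P R" and J: "ideal J R" and a: "a \<in> carrier R"
    and 1: "locally_exact P (colon R J a) k" and 2: "locally_exact P (ideal_adjoin R J a) k"
  shows "locally_exact P J k"
  unfolding locally_exact_def
proof
  fix z assume z: "z \<in> torsion_cocycles J (Suc k)"
  have JR: "J \<subseteq> carrier R" using idealD(1)[OF J] by blast
  note TD = submoduleD[OF torsion_submodule[OF JR]]
  have zT: "z \<in> torsion J (Suc k)" "\<delta> (Suc k) z = \<zero>\<^bsub>I (Suc (Suc k))\<^esub>" using z by (auto simp: torsion_cocycles_def)
  have zI: "z \<in> carrier (I (Suc k))" using TD(1)[OF zT(1)] .
  have "a \<odot>\<^bsub>I (Suc k)\<^esub> z \<in> torsion_cocycles (colon R J a) (Suc k)"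
    using torsion_colon[OF zT(1) a] \<delta>_smult[OF a zI] zT(2) a by (simp add: torsion_cocycles_def)
  then obtain t w where t: "t \<in> carrier R" "t \<notin> P"
    and w: "w \<in> torsion (colon R J a) k" "\<delta> k w = t \<odot>\<^bsub>I (Suc k)\<^esub> (a \<odot>\<^bsub>I (Suc k)\<^esub> z)"
    using 1 unfolding locally_exact_def by blast
  obtain u where u: "u \<in> torsion J k" "a \<odot>\<^bsub>I k\<^esub> u = w" using torsion_lift[OF J a w(1)] .
  have uI: "u \<in> carrier (I k)" using TD(1)[OF u(1)] .
  let ?y = "t \<odot>\<^bsub>I (Suc k)\<^esub> z \<ominus>\<^bsub>I (Suc k)\<^esub> \<delta> k u"
  have du: "\<delta> k u \<in> carrier (I (Suc k))" by (rule \<delta>_closed[OF uI])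
  have yT: "?y \<in> torsion J (Suc k)"
    using I.submodule_minus[OF torsion_submodule[OF JR] TD(4)[OF t(1) zT(1)] torsion_\<delta>[OF u(1) JR]] .
  have "a \<odot>\<^bsub>I (Suc k)\<^esub> ?y = \<zero>\<^bsub>I (Suc k)\<^esub>"
    using \<delta>_smult[OF a uI] u(2) w(2) I.smult_commute[OF a t(1) zI] a t(1) zI du
    by (simp add: I.smult_minus_distr I.minus_eq_zero_iff)
  moreover have "\<delta> (Suc k) ?y = \<zero>\<^bsub>I (Suc (Suc k))\<^esub>"
    using \<delta>_minus[of "t \<odot>\<^bsub>I (Suc k)\<^esub> z" "Suc k" "\<delta> k u"] \<delta>_smult[OF t(1) zI] zT(2) \<delta>_\<delta>[OF uI] t(1) zI du
    by (simp add: I.minus_eq_zero_iff)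
  ultimately have "?y \<in> torsion_cocycles (ideal_adjoin R J a) (Suc k)"
    using torsion_adjoin[OF J yT a] by (simp add: torsion_cocycles_def)
  then obtain s v where s: "s \<in> carrier R" "s \<notin> P"
    and v: "v \<in> torsion (ideal_adjoin R J a) k" "\<delta> k v = s \<odot>\<^bsub>I (Suc k)\<^esub> ?y"
    using 2 unfolding locally_exact_def by blast
  have vJ: "v \<in> torsion J k" using v(1) torsion_antimono[OF ideal_adjoin_superset[OF J a]] by blast
  have vI: "v \<in> carrier (I k)" using TD(1)[OF vJ] .
  have "\<delta> k (v \<oplus>\<^bsub>I k\<^esub> s \<odot>\<^bsub>I k\<^esub> u) = (s \<otimes> t) \<odot>\<^bsub>I (Suc k)\<^esub> z"
    using \<delta>_add[OF vI, of "s \<odot>\<^bsub>I k\<^esub> u"] \<delta>_smult[OF s(1) uI] v(2) s(1) t(1) zI uI du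
    by (simp add: I.smult_minus_distr I.smult_assoc1)
  moreover have "v \<oplus>\<^bsub>I k\<^esub> s \<odot>\<^bsub>I k\<^esub> u \<in> torsion J k" using TD(3)[OF vJ TD(4)[OF s(1) u(1)]] .
  moreover have "s \<otimes> t \<notin> P" using primeD(3)[OF P s(1) t(1)] s(2) t(2) by blast
  ultimately show "\<exists>t\<in>carrier R. t \<notin> P \<and> (\<exists>w\<in>torsion J k. \<delta> k w = t \<odot>\<^bsub>I (Suc k)\<^esub> z)"
    using s(1) t(1) by blast
qed

text \<open>Localized at \<open>P\<close>, multiplication by \<open>y\<close> is surjective on \<open>Ext\<^sup>k\<^sup>+\<^sup>1(R/J, R)\<close>.\<close>

lemma torsion_cocycles_divisible:
  assumes J: "ideal J R" and y: "y \<in> carrier R" and nzd: "colon R J y = J"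
    and IH: "locally_exact P (ideal_adjoin R J y) (Suc k)" and z: "z \<in> torsion_cocycles J (Suc k)"
  shows "\<exists>t\<in>carrier R. t \<notin> P \<and> (\<exists>z'\<in>torsion_cocycles J (Suc k). t \<odot>\<^bsub>I (Suc k)\<^esub> z = y \<odot>\<^bsub>I (Suc k)\<^esub> z')"
proof -
  have JR: "J \<subseteq> carrier R" using idealD(1)[OF J] by blast
  note TD = submoduleD[OF torsion_submodule[OF JR]]
  \<comment> \<open>The boundary of u is the image of z under the connecting map to
    Ext^(k+2)(R/(J+yR), R). Where that group vanishes, u can be corrected to a cocycle, and y times
    it is a multiple of z.\<close>
  obtain u where u: "u \<in> torsion J (Suc k)" "y \<odot>\<^bsub>I (Suc k)\<^esub> u = z"
    using torsion_lift[OF J y, of z] z nzd by (auto simp: torsion_cocycles_def)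
  have uI: "u \<in> carrier (I (Suc k))" using TD(1)[OF u(1)] .
  have "y \<odot>\<^bsub>I (Suc (Suc k))\<^esub> \<delta> (Suc k) u = \<zero>\<^bsub>I (Suc (Suc k))\<^esub>"
    using \<delta>_smult[OF y uI] u(2) z by (simp add: torsion_cocycles_def)
  hence "\<delta> (Suc k) u \<in> torsion_cocycles (ideal_adjoin R J y) (Suc (Suc k))"
    using torsion_adjoin[OF J torsion_\<delta>[OF u(1) JR] y] \<delta>_\<delta>[OF uI] by (simp add: torsion_cocycles_def)
  then obtain t w where t: "t \<in> carrier R" "t \<notin> P"
    and w: "w \<in> torsion (ideal_adjoin R J y) (Suc k)" "\<delta> (Suc k) w = t \<odot>\<^bsub>I (Suc (Suc k))\<^esub> \<delta> (Suc k) u"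
    using IH unfolding locally_exact_def by blast
  have wJ: "w \<in> torsion J (Suc k)" using w(1) torsion_antimono[OF ideal_adjoin_superset[OF J y]] by blast
  have wI: "w \<in> carrier (I (Suc k))" using TD(1)[OF wJ] .
  let ?z = "t \<odot>\<^bsub>I (Suc k)\<^esub> u \<ominus>\<^bsub>I (Suc k)\<^esub> w"
  have "\<delta> (Suc k) ?z = \<zero>\<^bsub>I (Suc (Suc k))\<^esub>"
    using \<delta>_minus[of "t \<odot>\<^bsub>I (Suc k)\<^esub> u" "Suc k" w] \<delta>_smult[OF t(1) uI] w(2) t(1) uI wI \<delta>_closed[OF uI]
    by (simp add: I.minus_eq_zero_iff)
  hence "?z \<in> torsion_cocycles J (Suc k)"
    using I.submodule_minus[OF torsion_submodule[OF JR] TD(4)[OF t(1) u(1)] wJ] by (simp add: torsion_cocycles_def)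
  moreover have "y \<odot>\<^bsub>I (Suc k)\<^esub> w = \<zero>\<^bsub>I (Suc k)\<^esub>"
    using w(1) ideal_adjoin_self[OF J y] by (simp add: torsion_def)
  hence "t \<odot>\<^bsub>I (Suc k)\<^esub> z = y \<odot>\<^bsub>I (Suc k)\<^esub> ?z"
    using y t(1) uI wI u(2) I.smult_commute[OF y t(1) uI] I.smult_closed[OF y uI]
    by (simp add: I.smult_minus_distr)
  ultimately show ?thesis using t by blast
qed

end

text \<open>Nakayama's lemma for \<open>(Z/B)\<^sub>P\<close>.\<close>

lemma (in module) local_nakayama:
  assumes P: "primeideal P R" and y: "y \<in> P"
    and Z: "submodule Z R M" and B: "submodule B R M"
    and a: "\<And>q. q < m \<Longrightarrow> a q \<in> Z"
    and gen: "\<And>z. z \<in> Z \<Longrightarrow> \<exists>s\<in>carrier R. s \<notin> P \<and>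
        (\<exists>c b. (\<forall>q<m. c q \<in> carrier R) \<and> b \<in> B \<and> s \<odot>\<^bsub>M\<^esub> z = lincomb M a c m \<oplus>\<^bsub>M\<^esub> b)"
    and div: "\<And>z. z \<in> Z \<Longrightarrow> \<exists>t\<in>carrier R. t \<notin> P \<and> (\<exists>z'\<in>Z. t \<odot>\<^bsub>M\<^esub> z = y \<odot>\<^bsub>M\<^esub> z')"
    and z: "z \<in> Z"
  shows "\<exists>s\<in>carrier R. s \<notin> P \<and> s \<odot>\<^bsub>M\<^esub> z \<in> B"
  using a gen z
proof (induction m arbitrary: z)
  case 0
  then obtain s c b where "s \<in> carrier R" "s \<notin> P" "b \<in> B" "s \<odot>\<^bsub>M\<^esub> z = \<zero>\<^bsub>M\<^esub> \<oplus>\<^bsub>M\<^esub> b" by force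
  thus ?case using submoduleD(1)[OF B] by auto
next
  case (Suc m)
  note ZD = submoduleD[OF Z] and BD = submoduleD[OF B]
  have yR: "y \<in> carrier R" using idealD(1)[OF R.primeD(1)[OF P] y] .
  have prime: "r \<otimes> s \<notin> P" if "r \<in> carrier R" "s \<in> carrier R" "r \<notin> P" "s \<notin> P" for r s
    using R.primeD(3)[OF P that(1,2)] that(3,4) by blast
  have aZ: "a q \<in> Z" if "q < Suc m" for q using Suc.prems(1) that .
  have aM: "a q \<in> carrier M" if "q < Suc m" for q using ZD(1)[OF aZ[OF that]] .
  have lc: "lincomb M a c m \<in> carrier M" if "\<And>q. q < m \<Longrightarrow> c q \<in> carrier R" for c
    using aM that by (intro lincomb_closed) auto
  \<comment> \<open>Induction on the number of generators: the last one is divisible by y up to a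
    factor outside P, and expanding the quotient z' in the generators lets it be eliminated.\<close>
  obtain t z' where t: "t \<in> carrier R" "t \<notin> P" and z': "z' \<in> Z" "t \<odot>\<^bsub>M\<^esub> a m = y \<odot>\<^bsub>M\<^esub> z'"
    using div[OF aZ[of m]] by auto
  obtain s c b where s: "s \<in> carrier R" "s \<notin> P" and c: "\<And>q. q < Suc m \<Longrightarrow> c q \<in> carrier R" and b: "b \<in> B"
    and eq: "s \<odot>\<^bsub>M\<^esub> z' = lincomb M a c (Suc m) \<oplus>\<^bsub>M\<^esub> b" using Suc.prems(2)[OF z'(1)] by blast
  have z'M: "z' \<in> carrier M" and bM: "b \<in> carrier M" using ZD(1)[OF z'(1)] BD(1)[OF b] .
  have amM: "a m \<in> carrier M" and cmR: "c m \<in> carrier R" using aM[of m] c[of m] by auto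
  have lcM: "lincomb M a c m \<in> carrier M" using lc c by simp
  \<comment> \<open>The coefficient of the last generator after collecting terms. As y lies in P and
    s t does not, it is a unit at P.\<close>
  let ?u = "s \<otimes> t \<ominus> y \<otimes> c m"
  have uR: "?u \<in> carrier R" using s(1) t(1) yR cmR by simp
  have uP: "?u \<notin> P"
  proof
    assume "?u \<in> P"
    moreover have "y \<otimes> c m \<in> P" using idealD(5)[OF R.primeD(1)[OF P] cmR y] .
    ultimately have "?u \<oplus> y \<otimes> c m \<in> P" using idealD(3)[OF R.primeD(1)[OF P]] by blast
    moreover have "?u \<oplus> y \<otimes> c m = s \<otimes> t" using s(1) t(1) yR cmR by (simp add: R.minus_eq R.a_assoc R.l_neg)
    ultimately show False using prime[OF s(1) t(1) s(2) t(2)] by simp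
  qed
  have "(s \<otimes> t) \<odot>\<^bsub>M\<^esub> a m = y \<odot>\<^bsub>M\<^esub> (s \<odot>\<^bsub>M\<^esub> z')"
    using s(1) t(1) amM z'(2) smult_commute[OF s(1) yR z'M] by (simp add: smult_assoc1)
  also have "\<dots> = (y \<odot>\<^bsub>M\<^esub> lincomb M a c m \<oplus>\<^bsub>M\<^esub> y \<odot>\<^bsub>M\<^esub> b) \<oplus>\<^bsub>M\<^esub> (y \<otimes> c m) \<odot>\<^bsub>M\<^esub> a m"
    unfolding eq using yR lcM bM amM cmR by (simp add: smult_r_distr smult_assoc1 M.a_ac)
  finally have eq1: "(s \<otimes> t) \<odot>\<^bsub>M\<^esub> a m = (y \<odot>\<^bsub>M\<^esub> lincomb M a c m \<oplus>\<^bsub>M\<^esub> y \<odot>\<^bsub>M\<^esub> b) \<oplus>\<^bsub>M\<^esub> (y \<otimes> c m) \<odot>\<^bsub>M\<^esub> a m" .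
  have "?u \<odot>\<^bsub>M\<^esub> a m = (s \<otimes> t) \<odot>\<^bsub>M\<^esub> a m \<ominus>\<^bsub>M\<^esub> (y \<otimes> c m) \<odot>\<^bsub>M\<^esub> a m"
    using s(1) t(1) yR cmR amM by (simp add: R.minus_eq M.minus_eq smult_l_distr smult_l_minus)
  hence eq2: "?u \<odot>\<^bsub>M\<^esub> a m = y \<odot>\<^bsub>M\<^esub> lincomb M a c m \<oplus>\<^bsub>M\<^esub> y \<odot>\<^bsub>M\<^esub> b"
    unfolding eq1 using yR lcM bM amM cmR by (simp add: M.minus_eq M.a_assoc M.r_neg)
  show ?case
  proof (rule Suc.IH)
    fix z assume z: "z \<in> Z"
    obtain r e f where r: "r \<in> carrier R" "r \<notin> P" and e: "\<And>q. q < Suc m \<Longrightarrow> e q \<in> carrier R" and f: "f \<in> B"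
      and eqr: "r \<odot>\<^bsub>M\<^esub> z = lincomb M a e (Suc m) \<oplus>\<^bsub>M\<^esub> f" using Suc.prems(2)[OF z] by blast
    have zM: "z \<in> carrier M" and fM: "f \<in> carrier M" using ZD(1)[OF z] BD(1)[OF f] .
    have leM: "lincomb M a e m \<in> carrier M" and emR: "e m \<in> carrier R" using lc e by auto
    have eR: "e q \<in> carrier R" if "q < m" for q using e that by simp
    have cR: "c q \<in> carrier R" if "q < m" for q using c that by simp
    \<comment> \<open>Coefficients after multiplying by \<open>?u\<close> and replacing
      \<open>?u\<close> times the last generator by y times the expansion of z' in the remaining
      generators.\<close>
    let ?c = "\<lambda>q. ?u \<otimes> e q \<oplus> (e m \<otimes> y) \<otimes> c q"
    let ?b = "(e m \<otimes> y) \<odot>\<^bsub>M\<^esub> b \<oplus>\<^bsub>M\<^esub> ?u \<odot>\<^bsub>M\<^esub> f"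
    have "(?u \<otimes> r) \<odot>\<^bsub>M\<^esub> z = ?u \<odot>\<^bsub>M\<^esub> lincomb M a e m \<oplus>\<^bsub>M\<^esub> e m \<odot>\<^bsub>M\<^esub> (?u \<odot>\<^bsub>M\<^esub> a m) \<oplus>\<^bsub>M\<^esub> ?u \<odot>\<^bsub>M\<^esub> f"
      using uR r(1) zM eqr leM emR amM fM smult_commute[OF emR uR amM]
      by (simp add: smult_assoc1 smult_r_distr del: minus_closed')
    also have "\<dots> = (?u \<odot>\<^bsub>M\<^esub> lincomb M a e m \<oplus>\<^bsub>M\<^esub> (e m \<otimes> y) \<odot>\<^bsub>M\<^esub> lincomb M a c m) \<oplus>\<^bsub>M\<^esub> ?b"
      unfolding eq2 using uR emR yR leM lcM bM fM by (simp add: smult_assoc1 smult_r_distr M.a_ac)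
    also have "?u \<odot>\<^bsub>M\<^esub> lincomb M a e m \<oplus>\<^bsub>M\<^esub> (e m \<otimes> y) \<odot>\<^bsub>M\<^esub> lincomb M a c m = lincomb M a ?c m"
    proof -
      have "lincomb M a ?c m = lincomb M a (\<lambda>q. ?u \<otimes> e q) m \<oplus>\<^bsub>M\<^esub> lincomb M a (\<lambda>q. (e m \<otimes> y) \<otimes> c q) m"
        using aM uR emR yR eR cR by (intro lincomb_add) simp_all
      also have "lincomb M a (\<lambda>q. ?u \<otimes> e q) m = ?u \<odot>\<^bsub>M\<^esub> lincomb M a e m"
        using aM uR eR by (intro lincomb_smult) simp_all
      also have "lincomb M a (\<lambda>q. (e m \<otimes> y) \<otimes> c q) m = (e m \<otimes> y) \<odot>\<^bsub>M\<^esub> lincomb M a c m"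
        using aM emR yR cR by (intro lincomb_smult) simp_all
      finally show ?thesis by simp
    qed
    finally have eq: "(?u \<otimes> r) \<odot>\<^bsub>M\<^esub> z = lincomb M a ?c m \<oplus>\<^bsub>M\<^esub> ?b" .
    have bB: "?b \<in> B" using BD(3,4) b f uR emR yR by simp
    have ur: "?u \<otimes> r \<in> carrier R" "?u \<otimes> r \<notin> P" using uR r prime[OF uR r(1) uP r(2)] by simp_all
    have cR': "\<forall>q<m. ?c q \<in> carrier R" using uR emR yR eR cR by simp
    show "\<exists>s\<in>carrier R. s \<notin> P \<and>
        (\<exists>c b. (\<forall>q<m. c q \<in> carrier R) \<and> b \<in> B \<and> s \<odot>\<^bsub>M\<^esub> z = lincomb M a c m \<oplus>\<^bsub>M\<^esub> b)"
      by (rule bexI[OF _ ur(1)], rule conjI[OF ur(2)], rule exI[of _ ?c], rule exI[of _ ?b],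
          rule conjI[OF cR' conjI[OF bB eq]])
  qed (use aZ Suc.prems(3) in auto)
qed

section \<open>Comparison of free and injective resolutions\<close>

locale free_injective = free_exact_complex R n d + injective_complex R I \<delta>
  for R :: "('a, 'm) ring_scheme" (structure) and n :: "nat \<Rightarrow> nat" and d
    and I :: "nat \<Rightarrow> ('a, 'c) module" and \<delta>
begin

text \<open>
  The homology of \<open>Hom(F m, ker (\<delta> j))\<close> along \<open>d\<close>; at \<open>m = 0\<close> this is replaced by the homology
  of \<open>Hom(coker (d 0), I j)\<close> along \<open>\<delta>\<close>, so that the modules for fixed \<open>m + j\<close> are all isomorphic.
\<close>

definition bicocycle :: "nat \<Rightarrow> nat \<Rightarrow> ((nat \<Rightarrow> 'a) \<Rightarrow> 'c) \<Rightarrow> bool" where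
  "bicocycle m j f \<longleftrightarrow> linear_map R (F m) (I j) f \<and>
     (\<forall>x\<in>carrier (F (Suc m)). f (d m x) = \<zero>\<^bsub>I j\<^esub>) \<and>
     (\<forall>x\<in>carrier (F m). \<delta> j (f x) = \<zero>\<^bsub>I (Suc j)\<^esub>)"

definition bicoboundary :: "nat \<Rightarrow> nat \<Rightarrow> ((nat \<Rightarrow> 'a) \<Rightarrow> 'c) \<Rightarrow> bool" where
  "bicoboundary m j f \<longleftrightarrow>
     (case m of
        0 \<Rightarrow> (case j of
          0 \<Rightarrow> \<forall>x\<in>carrier (F 0). f x = \<zero>\<^bsub>I 0\<^esub>
        | Suc l \<Rightarrow> \<exists>h. linear_map R (F 0) (I l) h \<and>
            (\<forall>x\<in>carrier (F (Suc 0)). h (d 0 x) = \<zero>\<^bsub>I l\<^esub>) \<and>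
            (\<forall>x\<in>carrier (F 0). f x = \<delta> l (h x)))
      | Suc k \<Rightarrow> \<exists>h. linear_map R (F k) (I j) h \<and>
            (\<forall>x\<in>carrier (F k). \<delta> j (h x) = \<zero>\<^bsub>I (Suc j)\<^esub>) \<and>
            (\<forall>x\<in>carrier (F (Suc k)). f x = h (d k x)))"

section \<open>The staircase between free and injective resolutions\<close>

lemma bicoboundary_cong:
  "(\<And>x. x \<in> carrier (F m) \<Longrightarrow> f x = g x) \<Longrightarrow> bicoboundary m j f = bicoboundary m j g"
  by (cases m; cases j) (simp_all add: bicoboundary_def)

text \<open>A map that kills the boundaries kills the kernel of \<open>d m\<close>, so it factors
  through the image of \<open>d m\<close>; injectivity of \<open>I j\<close> extends it to all of
  \<open>F m\<close>.\<close>

lemma extend_along_d: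
  assumes f: "linear_map R (F (Suc m)) (I j) f"
    and fd: "\<And>x. x \<in> carrier (F (Suc (Suc m))) \<Longrightarrow> f (d (Suc m) x) = \<zero>\<^bsub>I j\<^esub>"
  shows "\<exists>g. linear_map R (F m) (I j) g \<and> (\<forall>x\<in>carrier (F (Suc m)). g (d m x) = f x)"
proof -
  let ?Q = "\<lambda>y u. \<exists>x\<in>carrier (F (Suc m)). y = d m x \<and> u = f x"
  note D = linear_mapD[OF d_linear] and fD = linear_mapD[OF f]
  have d0: "d m \<zero>\<^bsub>F (Suc m)\<^esub> = \<zero>\<^bsub>F m\<^esub>" by (rule linear_map_zero[OF d_linear free_module free_module])
  have f0: "f \<zero>\<^bsub>F (Suc m)\<^esub> = \<zero>\<^bsub>I j\<^esub>" by (rule linear_map_zero[OF f free_module I_module])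
  obtain g where g: "linear_map R (F m) (I j) g"
    "\<And>x u. x \<in> carrier (F m) \<Longrightarrow> u \<in> carrier (I j) \<Longrightarrow> ?Q x u \<Longrightarrow> g x = u"
  proof (rule injective_extend[OF injective[of j], of ?Q "n m"])
    show "?Q \<zero>\<^bsub>F m\<^esub> \<zero>\<^bsub>I j\<^esub>" using d0 f0 by (intro bexI[of _ "\<zero>\<^bsub>F (Suc m)\<^esub>"]) simp_all
  next
    fix x y u v assume "?Q x u" "?Q y v"
    then obtain a b where "a \<in> carrier (F (Suc m))" "x = d m a" "u = f a"
      "b \<in> carrier (F (Suc m))" "y = d m b" "v = f b" by blast
    thus "?Q (x \<oplus>\<^bsub>F m\<^esub> y) (u \<oplus>\<^bsub>I j\<^esub> v)"
      using D(2) fD(2) by (intro bexI[of _ "a \<oplus>\<^bsub>F (Suc m)\<^esub> b"]) simp_all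
  next
    fix a x u assume "a \<in> carrier R" "?Q x u"
    then obtain b where "b \<in> carrier (F (Suc m))" "x = d m b" "u = f b" by blast
    thus "?Q (a \<odot>\<^bsub>F m\<^esub> x) (a \<odot>\<^bsub>I j\<^esub> u)"
      using D(3) fD(3) \<open>a \<in> carrier R\<close> by (intro bexI[of _ "a \<odot>\<^bsub>F (Suc m)\<^esub> b"]) simp_all
  next
    fix u assume "?Q \<zero>\<^bsub>F m\<^esub> u"
    then obtain b where b: "b \<in> carrier (F (Suc m))" "\<zero>\<^bsub>F m\<^esub> = d m b" "u = f b" by blast
    then obtain y where "y \<in> carrier (F (Suc (Suc m)))" "b = d (Suc m) y"
      using d_kernel[OF b(1)] by metis
    thus "u = \<zero>\<^bsub>I j\<^esub>" using fd b(3) by simp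
  qed (use that in blast)
  have "g (d m x) = f x" if x: "x \<in> carrier (F (Suc m))" for x
    using g(2)[OF D(1)[OF x] fD(1)[OF x]] x by blast
  thus ?thesis using g(1) by blast
qed

lemma lift_along_\<delta>:
  assumes f: "linear_map R (F m) (I (Suc j)) f"
    and \<delta>f: "\<And>x. x \<in> carrier (F m) \<Longrightarrow> \<delta> (Suc j) (f x) = \<zero>\<^bsub>I (Suc (Suc j))\<^esub>"
  shows "\<exists>g. linear_map R (F m) (I j) g \<and> (\<forall>x\<in>carrier (F m). \<delta> j (g x) = f x)"
proof -
  note fD = linear_mapD[OF f]
  obtain g where "linear_map R (F m) (I j) g" "\<And>x. x \<in> carrier (F m) \<Longrightarrow> \<delta> j (g x) = f x"
  proof (rule I.free_module_choose[of "n m" j "\<lambda>x u. \<delta> j u = f x"])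
    show "\<exists>u\<in>carrier (I j). \<delta> j u = f x" if "x \<in> carrier (F m)" for x
      using \<delta>_kernel[OF fD(1)[OF that] \<delta>f[OF that]] by metis
  qed (simp_all add: fD \<delta>_add \<delta>_smult)
  thus ?thesis by blast
qed

text \<open>One step of the staircase: g links g d at (m+1, j) with the composite of g and
  \<open>\<delta> j\<close> at (m, j+1), and neither class can vanish without the other. In both
  directions g is replaced by g', which differs from it by a term that does not affect the side
  under consideration.\<close>

lemma bicoboundary_shift:
  assumes g: "linear_map R (F m) (I j) g"
  shows "bicoboundary (Suc m) j (\<lambda>x. g (d m x)) \<longleftrightarrow> bicoboundary m (Suc j) (\<lambda>x. \<delta> j (g x))"
proof
  note gD = linear_mapD[OF g]
  assume "bicoboundary (Suc m) j (\<lambda>x. g (d m x))"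
  then obtain h where h: "linear_map R (F m) (I j) h"
    "\<And>x. x \<in> carrier (F m) \<Longrightarrow> \<delta> j (h x) = \<zero>\<^bsub>I (Suc j)\<^esub>"
    "\<And>x. x \<in> carrier (F (Suc m)) \<Longrightarrow> g (d m x) = h (d m x)"
    by (auto simp: bicoboundary_def)
  define g' where "g' x = g x \<ominus>\<^bsub>I j\<^esub> h x" for x
  have g': "linear_map R (F m) (I j) g'"
    unfolding g'_def by (rule linear_map_minus_fun[OF g h(1) free_module I_module])
  have g'd: "g' (d m x) = \<zero>\<^bsub>I j\<^esub>" if x: "x \<in> carrier (F (Suc m))" for x
    using h(3)[OF x] gD(1)[OF d_closed[OF x]] linear_mapD(1)[OF h(1) d_closed[OF x]]
    by (simp add: g'_def I.minus_eq_zero_iff)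
  have \<delta>g': "\<delta> j (g x) = \<delta> j (g' x)" if x: "x \<in> carrier (F m)" for x
    using \<delta>_minus[OF gD(1)[OF x] linear_mapD(1)[OF h(1) x]] h(2)[OF x] \<delta>_closed[OF gD(1)[OF x]]
    by (simp add: g'_def)
  \<comment> \<open>g' kills the boundaries. At m = 0 it is itself the required map; for m > 0 it is
    extended along the preceding differential.\<close>
  show "bicoboundary m (Suc j) (\<lambda>x. \<delta> j (g x))"
  proof (cases m)
    case 0
    thus ?thesis using g' g'd \<delta>g' by (auto simp: bicoboundary_def)
  next
    case (Suc k)
    then obtain u where u: "linear_map R (F k) (I j) u" "\<And>x. x \<in> carrier (F (Suc k)) \<Longrightarrow> u (d k x) = g' x"
      using extend_along_d[of k j g'] g' g'd by auto
    have "linear_map R (F k) (I (Suc j)) (\<lambda>x. \<delta> j (u x))" by (rule linear_map_comp[OF u(1) \<delta>_linear])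
    moreover have "\<delta> (Suc j) (\<delta> j (u x)) = \<zero>\<^bsub>I (Suc (Suc j))\<^esub>" if "x \<in> carrier (F k)" for x
      using \<delta>_\<delta>[OF linear_mapD(1)[OF u(1) that]] .
    ultimately show ?thesis using Suc \<delta>g' u(2)
      by (auto simp: bicoboundary_def intro!: exI[of _ "\<lambda>x. \<delta> j (u x)"])
  qed
next
  note gD = linear_mapD[OF g]
  assume b: "bicoboundary m (Suc j) (\<lambda>x. \<delta> j (g x))"
  show "bicoboundary (Suc m) j (\<lambda>x. g (d m x))"
  proof (cases m)
    case 0
    then obtain h where h: "linear_map R (F m) (I j) h"
      "\<And>x. x \<in> carrier (F (Suc m)) \<Longrightarrow> h (d m x) = \<zero>\<^bsub>I j\<^esub>"
      "\<And>x. x \<in> carrier (F m) \<Longrightarrow> \<delta> j (g x) = \<delta> j (h x)" using b by (auto simp: bicoboundary_def)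
    define g' where "g' x = g x \<ominus>\<^bsub>I j\<^esub> h x" for x
    have g': "linear_map R (F m) (I j) g'"
      unfolding g'_def by (rule linear_map_minus_fun[OF g h(1) free_module I_module])
    have "g (d m x) = g' (d m x)" if x: "x \<in> carrier (F (Suc m))" for x
      using h(2)[OF x] gD(1)[OF d_closed[OF x]] by (simp add: g'_def)
    moreover have "\<delta> j (g' x) = \<zero>\<^bsub>I (Suc j)\<^esub>" if x: "x \<in> carrier (F m)" for x
      using \<delta>_minus[OF gD(1)[OF x] linear_mapD(1)[OF h(1) x]] h(3)[OF x]
        \<delta>_closed[OF linear_mapD(1)[OF h(1) x]]
      by (simp add: g'_def I.minus_eq_zero_iff)
    ultimately show ?thesis using g' by (auto simp: bicoboundary_def)
  next
    case (Suc k)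
    then obtain h' where h': "linear_map R (F k) (I (Suc j)) h'"
      "\<And>x. x \<in> carrier (F k) \<Longrightarrow> \<delta> (Suc j) (h' x) = \<zero>\<^bsub>I (Suc (Suc j))\<^esub>"
      "\<And>x. x \<in> carrier (F (Suc k)) \<Longrightarrow> \<delta> j (g x) = h' (d k x)" using b by (auto simp: bicoboundary_def)
    \<comment> \<open>The given h' has values in the kernel of the injective differential, so
      freeness of \<open>F k\<close> lifts it to \<open>I j\<close>.\<close>
    obtain h where h: "linear_map R (F k) (I j) h" "\<And>x. x \<in> carrier (F k) \<Longrightarrow> \<delta> j (h x) = h' x"
      using lift_along_\<delta>[OF h'(1,2)] by blast
    have hd: "linear_map R (F m) (I j) (\<lambda>x. h (d k x))"
      using linear_map_comp[OF d_linear h(1)] Suc by simp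
    define g' where "g' x = g x \<ominus>\<^bsub>I j\<^esub> h (d k x)" for x
    have g': "linear_map R (F m) (I j) g'"
      unfolding g'_def by (rule linear_map_minus_fun[OF g hd free_module I_module])
    have "g (d m x) = g' (d m x)" if x: "x \<in> carrier (F (Suc m))" for x
    proof -
      have "d k (d m x) = \<zero>\<^bsub>F k\<^esub>" using d_d x Suc by simp
      thus ?thesis using gD(1)[OF d_closed[OF x]] linear_map_zero[OF h(1) free_module I_module]
        by (simp add: g'_def)
    qed
    moreover have "\<delta> j (g' x) = \<zero>\<^bsub>I (Suc j)\<^esub>" if x: "x \<in> carrier (F m)" for x
    proof -
      have dx: "d k x \<in> carrier (F k)" using d_closed x Suc by simp
      have "\<delta> j (g x) = \<delta> j (h (d k x))" using h'(3)[of x] h(2)[OF dx] x Suc by simp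
      thus ?thesis using \<delta>_minus[OF gD(1)[OF x] linear_mapD(1)[OF h(1) dx]]
          \<delta>_closed[OF linear_mapD(1)[OF h(1) dx]]
        by (simp add: g'_def I.minus_eq_zero_iff)
    qed
    ultimately show ?thesis using g' by (auto simp: bicoboundary_def)
  qed
qed

lemma bicocycle_shift:
  assumes g: "linear_map R (F m) (I j) g" and z: "\<And>x. x \<in> carrier (F (Suc m)) \<Longrightarrow> \<delta> j (g (d m x)) = \<zero>\<^bsub>I (Suc j)\<^esub>"
  shows "bicocycle (Suc m) j (\<lambda>x. g (d m x))" "bicocycle m (Suc j) (\<lambda>x. \<delta> j (g x))"
  using z linear_map_comp[OF d_linear g] linear_map_comp[OF g \<delta>_linear]
    \<delta>_\<delta>[OF linear_mapD(1)[OF g]] d_d linear_map_zero[OF g free_module I_module]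
  by (auto simp: bicocycle_def)

lemma bicocycle_extend:
  assumes "bicocycle (Suc m) j f"
  shows "\<exists>g. linear_map R (F m) (I j) g \<and> (\<forall>x\<in>carrier (F (Suc m)). g (d m x) = f x)"
  using assms extend_along_d[of m j f] by (auto simp: bicocycle_def)

lemma bicocycle_lift:
  assumes "bicocycle m (Suc j) f"
  shows "\<exists>g. linear_map R (F m) (I j) g \<and> (\<forall>x\<in>carrier (F m). \<delta> j (g x) = f x)"
  using assms lift_along_\<delta>[of m j f] by (auto simp: bicocycle_def)

text \<open>Finite generation of the homology at (m, j), stated without a quotient: the bicocycles
  \<open>L c\<close> represent all classes. Linearity of \<open>L\<close> in c is part of the data,
  so that generators can be carried along the staircase.\<close>

definition finitely_generated_at :: "nat \<Rightarrow> nat \<Rightarrow> bool" where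
  "finitely_generated_at m j \<longleftrightarrow> (\<exists>r L. linear_map R (free_module R r) (hom_module R (F m) (I j)) L \<and>
     (\<forall>c\<in>carrier (free_module R r). bicocycle m j (L c)) \<and>
     (\<forall>f. bicocycle m j f \<longrightarrow>
        (\<exists>c\<in>carrier (free_module R r). bicoboundary m j (\<lambda>x. f x \<ominus>\<^bsub>I j\<^esub> L c x))))"

lemma finitely_generated_at_shift:
  assumes "finitely_generated_at (Suc m) j"
  shows "finitely_generated_at m (Suc j)"
proof -
  obtain r L where L: "linear_map R (free_module R r) (hom_module R (F (Suc m)) (I j)) L"
    "\<And>c. c \<in> carrier (free_module R r) \<Longrightarrow> bicocycle (Suc m) j (L c)"
    "\<And>f. bicocycle (Suc m) j f \<Longrightarrow>
        \<exists>c\<in>carrier (free_module R r). bicoboundary (Suc m) j (\<lambda>x. f x \<ominus>\<^bsub>I j\<^esub> L c x)"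
    using assms unfolding finitely_generated_at_def by blast
  let ?H = "\<lambda>m j. hom_module R (F m) (I j)"
  interpret H: module R "?H p q" for p q by (rule hom_module) (rule free_module I_module)+
  interpret Fr: module R "free_module R r" by (rule free_module)
  have Hc: "g x \<in> carrier (I j)" if "g \<in> carrier (?H m j)" "x \<in> carrier (F m)" for g x
    using that linear_mapD(1)[OF module_hom_linear_map] by fastforce
  \<comment> \<open>The extensions along d must again depend linearly on c. They are therefore
    chosen as one linear map from R^r into the module of homomorphisms.\<close>
  obtain G where G: "linear_map R (free_module R r) (?H m j) G"
    "\<And>c. c \<in> carrier (free_module R r) \<Longrightarrow> \<forall>x\<in>carrier (F (Suc m)). G c (d m x) = L c x"
  proof (rule H.free_module_choose[of r m j "\<lambda>c g. \<forall>x\<in>carrier (F (Suc m)). g (d m x) = L c x"])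
    show "\<exists>g\<in>carrier (?H m j). \<forall>x\<in>carrier (F (Suc m)). g (d m x) = L c x"
      if c: "c \<in> carrier (free_module R r)" for c
    proof -
      have "\<exists>g. linear_map R (F m) (I j) g \<and> (\<forall>x\<in>carrier (F (Suc m)). g (d m x) = L c x)"
        by (rule bicocycle_extend[OF L(2)[OF c]])
      then obtain g where g: "linear_map R (F m) (I j) g"
        "\<forall>x\<in>carrier (F (Suc m)). g (d m x) = L c x" by blast
      show ?thesis using restrict_module_hom[OF g(1) free_module] g(2) d_closed
        by (intro bexI[of _ "restrict g (carrier (F m))"]) simp_all
    qed
  qed (simp_all add: linear_mapD[OF L(1)] d_closed)
  let ?L = "\<lambda>c. \<lambda>x\<in>carrier (F m). \<delta> j (G c x)"
  have Glin: "linear_map R (F m) (I j) (G c)" if "c \<in> carrier (free_module R r)" for c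
    using linear_mapD(1)[OF G(1) that] by (simp add: module_hom_linear_map)
  have "bicocycle m (Suc j) (\<lambda>x. \<delta> j (G c x))" if c: "c \<in> carrier (free_module R r)" for c
    using bicocycle_shift(2)[OF Glin[OF c]] G(2)[OF c] L(2)[OF c] by (simp add: bicocycle_def)
  hence Lc: "bicocycle m (Suc j) (?L c)" if "c \<in> carrier (free_module R r)" for c
    using that d_closed linear_map_cong[OF _ free_module, of "n m" "I (Suc j)" "\<lambda>x. \<delta> j (G c x)" "?L c"]
    by (simp add: bicocycle_def)
  have Llin: "linear_map R (free_module R r) (?H m (Suc j)) ?L"
  proof (rule linear_mapI)
    show "?L c \<in> carrier (?H m (Suc j))" if "c \<in> carrier (free_module R r)" for c
      using Lc[OF that] by (simp add: module_hom_iff bicocycle_def)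
    show "?L (c \<oplus>\<^bsub>free_module R r\<^esub> c') = ?L c \<oplus>\<^bsub>?H m (Suc j)\<^esub> ?L c'"
      if "c \<in> carrier (free_module R r)" "c' \<in> carrier (free_module R r)" for c c'
      using that linear_mapD(1)[OF Glin] by (auto simp: linear_mapD[OF G(1)] \<delta>_add fun_eq_iff)
    show "?L (a \<odot>\<^bsub>free_module R r\<^esub> c) = a \<odot>\<^bsub>?H m (Suc j)\<^esub> ?L c"
      if "a \<in> carrier R" "c \<in> carrier (free_module R r)" for a c
      using that linear_mapD(1)[OF Glin] by (auto simp: linear_mapD[OF G(1)] \<delta>_smult fun_eq_iff)
  qed
  have "\<exists>c\<in>carrier (free_module R r). bicoboundary m (Suc j) (\<lambda>x. f x \<ominus>\<^bsub>I (Suc j)\<^esub> ?L c x)"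
    if f: "bicocycle m (Suc j) f" for f
  proof -
    obtain g where g: "linear_map R (F m) (I j) g" "\<And>x. x \<in> carrier (F m) \<Longrightarrow> \<delta> j (g x) = f x"
      using bicocycle_lift[OF f] by blast
    have "bicocycle (Suc m) j (\<lambda>x. g (d m x))"
      using bicocycle_shift(1)[OF g(1)] g(2)[OF d_closed] f by (simp add: bicocycle_def)
    then obtain c where c: "c \<in> carrier (free_module R r)"
      "bicoboundary (Suc m) j (\<lambda>x. g (d m x) \<ominus>\<^bsub>I j\<^esub> L c x)" using L(3) by blast
    define g' where "g' x = g x \<ominus>\<^bsub>I j\<^esub> G c x" for x
    have g': "linear_map R (F m) (I j) g'"
      unfolding g'_def by (rule linear_map_minus_fun[OF g(1) Glin[OF c(1)] free_module I_module])
    have "bicoboundary (Suc m) j (\<lambda>x. g' (d m x))"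
      using c(2) G(2)[OF c(1)] bicoboundary_cong[of "Suc m" "\<lambda>x. g' (d m x)" "\<lambda>x. g (d m x) \<ominus>\<^bsub>I j\<^esub> L c x" j]
      by (simp add: g'_def)
    hence "bicoboundary m (Suc j) (\<lambda>x. \<delta> j (g' x))" using bicoboundary_shift[OF g'] by simp
    moreover have "\<delta> j (g' x) = f x \<ominus>\<^bsub>I (Suc j)\<^esub> ?L c x" if x: "x \<in> carrier (F m)" for x
      using \<delta>_minus[OF linear_mapD(1)[OF g(1) x] linear_mapD(1)[OF Glin[OF c(1)] x]] g(2)[OF x] x
      by (simp add: g'_def)
    ultimately have "bicoboundary m (Suc j) (\<lambda>x. f x \<ominus>\<^bsub>I (Suc j)\<^esub> ?L c x)"
      using bicoboundary_cong[of m "\<lambda>x. \<delta> j (g' x)" "\<lambda>x. f x \<ominus>\<^bsub>I (Suc j)\<^esub> ?L c x" "Suc j"] by simp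
    thus ?thesis using c(1) by blast
  qed
  thus ?thesis using Llin Lc unfolding finitely_generated_at_def by blast
qed

lemma finitely_generated_at_0:
  "finitely_generated_at m j \<Longrightarrow> finitely_generated_at 0 (m + j)"
proof (induction m arbitrary: j)
  case (Suc m)
  thus ?case using finitely_generated_at_shift[of m j] Suc.IH[of "Suc j"] by simp
qed simp

text \<open>Here the information moves the other way: vanishing at P is known at (0, m + j), on the
  injective side, and is wanted at (m, j). The multiplier t stays the same in every step.\<close>

lemma locally_zero_shift:
  assumes "\<And>f. bicocycle 0 (m + j) f \<Longrightarrow>
      \<exists>t\<in>carrier R. t \<notin> P \<and> bicoboundary 0 (m + j) (\<lambda>x. t \<odot>\<^bsub>I (m + j)\<^esub> f x)"
    and "bicocycle m j f"
  shows "\<exists>t\<in>carrier R. t \<notin> P \<and> bicoboundary m j (\<lambda>x. t \<odot>\<^bsub>I j\<^esub> f x)"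
  using assms
proof (induction m arbitrary: j f)
  case (Suc m)
  obtain g where g: "linear_map R (F m) (I j) g" "\<And>x. x \<in> carrier (F (Suc m)) \<Longrightarrow> g (d m x) = f x"
    using bicocycle_extend[OF Suc.prems(2)] by blast
  have "bicocycle m (Suc j) (\<lambda>x. \<delta> j (g x))"
    using bicocycle_shift(2)[OF g(1)] g(2) Suc.prems(2) by (simp add: bicocycle_def)
  then obtain t where t: "t \<in> carrier R" "t \<notin> P"
    "bicoboundary m (Suc j) (\<lambda>x. t \<odot>\<^bsub>I (Suc j)\<^esub> \<delta> j (g x))"
    using Suc.IH[of "Suc j" "\<lambda>x. \<delta> j (g x)"] Suc.prems(1) by auto
  have tg: "linear_map R (F m) (I j) (\<lambda>x. t \<odot>\<^bsub>I j\<^esub> g x)"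
    by (rule linear_map_smult_fun[OF g(1) t(1) I_module])
  have "bicoboundary m (Suc j) (\<lambda>x. \<delta> j (t \<odot>\<^bsub>I j\<^esub> g x))"
    using t(3) bicoboundary_cong[of m "\<lambda>x. \<delta> j (t \<odot>\<^bsub>I j\<^esub> g x)" "\<lambda>x. t \<odot>\<^bsub>I (Suc j)\<^esub> \<delta> j (g x)" "Suc j"]
      \<delta>_smult[OF t(1) linear_mapD(1)[OF g(1)]] by simp
  hence "bicoboundary (Suc m) j (\<lambda>x. t \<odot>\<^bsub>I j\<^esub> g (d m x))" using bicoboundary_shift[OF tg] by simp
  hence "bicoboundary (Suc m) j (\<lambda>x. t \<odot>\<^bsub>I j\<^esub> f x)"
    using bicoboundary_cong[of "Suc m" "\<lambda>x. t \<odot>\<^bsub>I j\<^esub> g (d m x)" "\<lambda>x. t \<odot>\<^bsub>I j\<^esub> f x" j] g(2) by simp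
  thus ?case using t(1,2) by blast
qed simp

end

section \<open>The grade of Ext over a Gorenstein ring\<close>

locale gorenstein = injective_complex R I \<delta>
  for R :: "('a, 'm) ring_scheme" (structure) and I :: "nat \<Rightarrow> ('a, 'c) module" and \<delta> +
  fixes e :: "'a \<Rightarrow> 'c" and K :: nat
  assumes noetherian: "noetherian_ring R"
    and e_linear: "linear_map R (self_module R) (I 0) e"
    and e_inj: "inj_on e (carrier R)"
    and e_image: "e ` carrier R = a_kernel (I 0) (I (Suc 0)) (\<delta> 0)"
    and bounded: "j > K \<Longrightarrow> carrier (I j) = {\<zero>\<^bsub>I j\<^esub>}"
begin

lemma e_zero: "e \<zero> = \<zero>\<^bsub>I 0\<^esub>"
  using linear_map_zero[OF e_linear self_module I_module] by simp

lemma e_smult: "a \<in> carrier R \<Longrightarrow> b \<in> carrier R \<Longrightarrow> e (a \<otimes> b) = a \<odot>\<^bsub>I 0\<^esub> e b"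
  using linear_mapD(3)[OF e_linear] by simp

lemma e_add: "a \<in> carrier R \<Longrightarrow> b \<in> carrier R \<Longrightarrow> e (a \<oplus> b) = e a \<oplus>\<^bsub>I 0\<^esub> e b"
  using linear_mapD(2)[OF e_linear] by simp

lemma \<delta>_e: "a \<in> carrier R \<Longrightarrow> \<delta> 0 (e a) = \<zero>\<^bsub>I (Suc 0)\<^esub>"
  using e_image by (auto simp: a_kernel_iff set_eq_iff)

lemma e_eqD: "a \<in> carrier R \<Longrightarrow> b \<in> carrier R \<Longrightarrow> e a = e b \<Longrightarrow> a = b"
  using e_inj by (rule inj_onD)

text \<open>The kernel of \<open>\<delta> 0\<close> is a copy of R, so at j = 0 the staircase ends
  in the cochains with values in R, whose cohomology defines Ext.\<close>

lemma factor_through_e: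
  assumes h: "linear_map R (free_module R k) (I 0) h"
    and \<delta>h: "\<And>x. x \<in> carrier (free_module R k) \<Longrightarrow> \<delta> 0 (h x) = \<zero>\<^bsub>I (Suc 0)\<^esub>"
  shows "\<exists>g. linear_map R (free_module R k) (self_module R) g \<and>
    (\<forall>x\<in>carrier (free_module R k). e (g x) = h x)"
proof -
  interpret S: module R "self_module R" by (rule self_module)
  note hD = linear_mapD[OF h]
  obtain g where "linear_map R (free_module R k) (self_module R) g"
    "\<And>x. x \<in> carrier (free_module R k) \<Longrightarrow> e (g x) = h x"
  proof (rule S.free_module_choose[of k "\<lambda>x u. e u = h x"])
    show "\<exists>u\<in>carrier (self_module R). e u = h x" if x: "x \<in> carrier (free_module R k)" for x
    proof -
      have "h x \<in> a_kernel (I 0) (I (Suc 0)) (\<delta> 0)" using hD(1)[OF x] \<delta>h[OF x] by (simp add: a_kernel_iff)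
      hence "h x \<in> e ` carrier R" unfolding e_image .
      thus ?thesis by (auto simp: image_iff)
    qed
  qed (simp_all add: hD e_add e_smult)
  thus ?thesis by blast
qed

section \<open>The free end of the staircase\<close>

context
  fixes n d
  assumes exact: "free_exact R n d"
begin

interpretation free_injective R n d I \<delta>
  by unfold_locales (rule exact)

lemma bicocycle_e:
  assumes "f \<in> cocycles R (self_module R) n d j"
  shows "bicocycle j 0 (\<lambda>x. e (f x))"
proof -
  have f: "linear_map R (F j) (self_module R) f"
    "\<And>x. x \<in> carrier (F (Suc j)) \<Longrightarrow> f (d j x) = \<zero>"
    using assms by (simp_all add: cocycles_iff[OF self_module exact] module_hom_linear_map)
  show ?thesis
    using linear_map_comp[OF f(1) e_linear] f(2) e_zero \<delta>_e[OF linear_form_closed[OF f(1)]]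
    by (simp add: bicocycle_def)
qed

text \<open>Bicocycles with j = 0 are cocycles with values in R, by \<open>factor_through_e\<close>,
  and these form a submodule of Hom(R^n, R), which is finitely generated.\<close>

lemma finitely_generated_at_Suc_0: "finitely_generated_at (Suc k) 0"
proof -
  let ?H = "hom_module R (F (Suc k)) (I 0)" and ?H' = "hom_module R (F (Suc k)) (self_module R)"
  let ?C = "cocycles R (self_module R) n d (Suc k)"
  obtain r L where L: "linear_map R (free_module R r) ?H' L" "L ` carrier (free_module R r) = ?C"
    using hom_self_submodule_image[OF noetherian cocycles_submodule[OF self_module exact]] .
  have LC: "L c \<in> ?C" if "c \<in> carrier (free_module R r)" for c using L(2) that by blast
  have Llin: "linear_map R (F (Suc k)) (self_module R) (L c)" if "c \<in> carrier (free_module R r)" for c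
    using LC[OF that] by (simp add: cocycles_iff[OF self_module exact] module_hom_linear_map)
  let ?L = "\<lambda>c. \<lambda>x\<in>carrier (F (Suc k)). e (L c x)"
  have lin: "linear_map R (free_module R r) ?H ?L"
  proof (rule linear_mapI)
    show "?L c \<in> carrier ?H" if "c \<in> carrier (free_module R r)" for c
      using restrict_module_hom[OF linear_map_comp[OF Llin[OF that] e_linear] free_module] by simp
    show "?L (c \<oplus>\<^bsub>free_module R r\<^esub> c') = ?L c \<oplus>\<^bsub>?H\<^esub> ?L c'"
      if "c \<in> carrier (free_module R r)" "c' \<in> carrier (free_module R r)" for c c'
      using that linear_form_closed[OF Llin] by (auto simp: linear_mapD[OF L(1)] e_add fun_eq_iff)
    show "?L (a \<odot>\<^bsub>free_module R r\<^esub> c) = a \<odot>\<^bsub>?H\<^esub> ?L c"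
      if "a \<in> carrier R" "c \<in> carrier (free_module R r)" for a c
      using that linear_form_closed[OF Llin] by (auto simp: linear_mapD[OF L(1)] e_smult fun_eq_iff)
  qed
  have Lb: "bicocycle (Suc k) 0 (?L c)" if "c \<in> carrier (free_module R r)" for c
    using bicocycle_e[OF LC[OF that]] d_closed
      linear_map_cong[OF _ free_module, of "n (Suc k)" "I 0" "\<lambda>x. e (L c x)" "?L c"]
    by (simp add: bicocycle_def)
  have "\<exists>c\<in>carrier (free_module R r). bicoboundary (Suc k) 0 (\<lambda>x. f x \<ominus>\<^bsub>I 0\<^esub> ?L c x)"
    if f: "bicocycle (Suc k) 0 f" for f
  proof -
    have fl: "linear_map R (F (Suc k)) (I 0) f" and fd: "\<And>x. x \<in> carrier (F (Suc (Suc k))) \<Longrightarrow> f (d (Suc k) x) = \<zero>\<^bsub>I 0\<^esub>"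
      and f\<delta>: "\<And>x. x \<in> carrier (F (Suc k)) \<Longrightarrow> \<delta> 0 (f x) = \<zero>\<^bsub>I (Suc 0)\<^esub>"
      using f by (simp_all add: bicocycle_def)
    obtain g where g: "linear_map R (F (Suc k)) (self_module R) g"
      "\<And>x. x \<in> carrier (F (Suc k)) \<Longrightarrow> e (g x) = f x"
      using factor_through_e[OF fl f\<delta>] by blast
    have "g (d (Suc k) x) = \<zero>" if x: "x \<in> carrier (F (Suc (Suc k)))" for x
      using e_eqD[OF linear_form_closed[OF g(1) d_closed[OF x]] zero_closed]
        g(2)[OF d_closed[OF x]] fd[OF x] e_zero by simp
    hence "restrict g (carrier (F (Suc k))) \<in> ?C"
      using restrict_module_hom[OF g(1) free_module] d_closed
      by (simp add: cocycles_iff[OF self_module exact])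
    then obtain c where c: "c \<in> carrier (free_module R r)" "restrict g (carrier (F (Suc k))) = L c"
      using L(2) by (metis imageE)
    have eq: "f x \<ominus>\<^bsub>I 0\<^esub> ?L c x = \<zero>\<^bsub>I 0\<^esub>" if x: "x \<in> carrier (F (Suc k))" for x
    proof -
      have "L c x = g x" using c(2) x by (metis restrict_apply')
      thus ?thesis using x g(2)[OF x] linear_mapD(1)[OF fl x] by (simp add: I.minus_eq_zero_iff)
    qed
    have "bicoboundary (Suc k) 0 (\<lambda>x. \<zero>\<^bsub>I 0\<^esub>)"
      using linear_map_zero_fun[OF I_module, of "F k" 0] \<delta>_zero
      by (auto simp: bicoboundary_def intro!: exI[of _ "\<lambda>x. \<zero>\<^bsub>I 0\<^esub>"])
    hence "bicoboundary (Suc k) 0 (\<lambda>x. f x \<ominus>\<^bsub>I 0\<^esub> ?L c x)"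
      using bicoboundary_cong[of "Suc k" "\<lambda>x. f x \<ominus>\<^bsub>I 0\<^esub> ?L c x" "\<lambda>x. \<zero>\<^bsub>I 0\<^esub>" 0, OF eq] by blast
    thus ?thesis using c(1) by blast
  qed
  thus ?thesis using lin Lb unfolding finitely_generated_at_def by blast
qed

end

text \<open>Ext^(k+1)(R/J, R) is finitely generated, although the injective modules computing it may
  be large. A free resolution of R/J shows this at (k+1, 0), and the staircase carries it to (0,
  k+1), where homomorphisms from R/J are evaluated at 1.\<close>

lemma torsion_cocycles_finitely_generated:
  assumes J: "ideal J R"
  shows "\<exists>r a. (\<forall>q<r. a q \<in> torsion_cocycles J (Suc k)) \<and>
    (\<forall>z\<in>torsion_cocycles J (Suc k). \<exists>c. (\<forall>q<r. c q \<in> carrier R) \<and>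
      (\<exists>w\<in>torsion J k. z = lincomb (I (Suc k)) a c r \<oplus>\<^bsub>I (Suc k)\<^esub> \<delta> k w))"
proof -
  let ?F = "free_module R (Suc 0)" and ?e = "std_basis R (Suc 0) 0"
  interpret F1: module R ?F by (rule free_module)
  note JD = idealD[OF J]
  \<comment> \<open>J as a submodule of the free module of rank one; its quotient R/J is what the
    resolution resolves.\<close>
  let ?K = "{y \<in> carrier ?F. y 0 \<in> J}"
  have "submodule ?K R ?F"
    by (rule F1.submoduleI') (use JD in \<open>auto simp: free_module_simps\<close>)
  from free_exact_exists[OF noetherian this] obtain n d where n0: "n 0 = Suc 0" and exact: "free_exact R n d" and dK: "d 0 ` carrier (free_module R (n 1)) = ?K" .
  interpret free_injective R n d I \<delta> by unfold_locales (rule exact)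
  have eF: "?e \<in> carrier (F 0)" by (simp add: n0)
  have coord: "(r \<odot>\<^bsub>F 0\<^esub> ?e) 0 = r" if "r \<in> carrier R" for r
    using that by (simp add: n0 free_module_simps std_basis_def)
  have expand: "x = x 0 \<odot>\<^bsub>F 0\<^esub> ?e" "x 0 \<in> carrier R" if "x \<in> carrier (F 0)" for x
  proof -
    show x0: "x 0 \<in> carrier R" using that free_module_coord[of x R "Suc 0" 0] by (simp add: n0)
    show "x = x 0 \<odot>\<^bsub>F 0\<^esub> ?e"
      using that x0 by (auto simp: n0 free_module_simps std_basis_def fun_eq_iff PiE_def extensional_def)
  qed
  \<comment> \<open>A homomorphism on R that vanishes on J has a value at 1 killed by J.\<close>
  have kill: "r \<odot>\<^bsub>I j\<^esub> h ?e = \<zero>\<^bsub>I j\<^esub>"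
    if h: "linear_map R (F 0) (I j) h" and hd: "\<And>x. x \<in> carrier (F (Suc 0)) \<Longrightarrow> h (d 0 x) = \<zero>\<^bsub>I j\<^esub>"
      and r: "r \<in> J" for h j r
  proof -
    have rR: "r \<in> carrier R" using JD(1)[OF r] .
    have "r \<odot>\<^bsub>F 0\<^esub> ?e \<in> ?K" using F.smult_closed[OF rR eF] coord[OF rR] r by (simp add: n0)
    then obtain x where "x \<in> carrier (F (Suc 0))" "r \<odot>\<^bsub>F 0\<^esub> ?e = d 0 x"
      unfolding dK[symmetric] by auto
    thus ?thesis using linear_mapD(3)[OF h rR eF] hd by simp
  qed
  have "finitely_generated_at 0 (Suc k)"
    using finitely_generated_at_0[OF finitely_generated_at_Suc_0[OF exact, of k]] by simp
  then obtain r L where L: "linear_map R (free_module R r) (hom_module R (F 0) (I (Suc k))) L"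
    "\<And>c. c \<in> carrier (free_module R r) \<Longrightarrow> bicocycle 0 (Suc k) (L c)"
    "\<And>f. bicocycle 0 (Suc k) f \<Longrightarrow>
        \<exists>c\<in>carrier (free_module R r). bicoboundary 0 (Suc k) (\<lambda>x. f x \<ominus>\<^bsub>I (Suc k)\<^esub> L c x)"
    unfolding finitely_generated_at_def by blast
  have Llin: "linear_map R (F 0) (I (Suc k)) (L c)" if "c \<in> carrier (free_module R r)" for c
    using L(2)[OF that] by (simp add: bicocycle_def)
  define a where "a q = L (std_basis R r q) ?e" for q
  have ev: "linear_map R (free_module R r) (I (Suc k)) (\<lambda>c. L c ?e)"
    by (rule linear_mapI) (use eF linear_mapD(1)[OF Llin] in \<open>simp_all add: linear_mapD[OF L(1)]\<close>)
  have a_tc: "a q \<in> torsion_cocycles J (Suc k)" for q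
  proof -
    have b: "bicocycle 0 (Suc k) (L (std_basis R r q))" by (rule L(2)) simp
    hence "\<And>s. s \<in> J \<Longrightarrow> s \<odot>\<^bsub>I (Suc k)\<^esub> a q = \<zero>\<^bsub>I (Suc k)\<^esub>"
      unfolding a_def by (intro kill) (simp_all add: bicocycle_def)
    thus ?thesis using b eF linear_mapD(1)[OF ev, of "std_basis R r q"]
      by (simp add: torsion_cocycles_def torsion_def a_def bicocycle_def)
  qed
  have "\<exists>c. (\<forall>q<r. c q \<in> carrier R) \<and>
      (\<exists>w\<in>torsion J k. z = lincomb (I (Suc k)) a c r \<oplus>\<^bsub>I (Suc k)\<^esub> \<delta> k w)"
    if z: "z \<in> torsion_cocycles J (Suc k)" for z
  proof -
    have zT: "z \<in> carrier (I (Suc k))" "\<And>s. s \<in> J \<Longrightarrow> s \<odot>\<^bsub>I (Suc k)\<^esub> z = \<zero>\<^bsub>I (Suc k)\<^esub>"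
      "\<delta> (Suc k) z = \<zero>\<^bsub>I (Suc (Suc k))\<^esub>" using z by (auto simp: torsion_cocycles_def torsion_def)
    \<comment> \<open>Conversely, z is turned into the homomorphism sending 1 to z.\<close>
    have "linear_map R (F 0) (I (Suc k)) (\<lambda>x. x 0 \<odot>\<^bsub>I (Suc k)\<^esub> z)"
    proof (rule linear_mapI)
      fix x assume x: "x \<in> carrier (F 0)"
      show "x 0 \<odot>\<^bsub>I (Suc k)\<^esub> z \<in> carrier (I (Suc k))" using expand(2)[OF x] zT(1) by simp
      show "(x \<oplus>\<^bsub>F 0\<^esub> y) 0 \<odot>\<^bsub>I (Suc k)\<^esub> z = x 0 \<odot>\<^bsub>I (Suc k)\<^esub> z \<oplus>\<^bsub>I (Suc k)\<^esub> y 0 \<odot>\<^bsub>I (Suc k)\<^esub> z"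
        if y: "y \<in> carrier (F 0)" for y
        using expand(2)[OF x] expand(2)[OF y] zT(1) by (simp add: n0 free_module_simps I.smult_l_distr)
      show "(b \<odot>\<^bsub>F 0\<^esub> x) 0 \<odot>\<^bsub>I (Suc k)\<^esub> z = b \<odot>\<^bsub>I (Suc k)\<^esub> (x 0 \<odot>\<^bsub>I (Suc k)\<^esub> z)"
        if b: "b \<in> carrier R" for b
        using expand(2)[OF x] b zT(1) by (simp add: n0 free_module_simps I.smult_assoc1)
    qed
    moreover have "d 0 x 0 \<odot>\<^bsub>I (Suc k)\<^esub> z = \<zero>\<^bsub>I (Suc k)\<^esub>" if x: "x \<in> carrier (F (Suc 0))" for x
    proof -
      have "d 0 x \<in> ?K" unfolding dK[symmetric] using x by simp
      thus ?thesis using zT(2) by simp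
    qed
    moreover have "\<delta> (Suc k) (x 0 \<odot>\<^bsub>I (Suc k)\<^esub> z) = \<zero>\<^bsub>I (Suc (Suc k))\<^esub>" if x: "x \<in> carrier (F 0)" for x
      using \<delta>_smult[OF expand(2)[OF x] zT(1)] zT(3) expand(2)[OF x] by simp
    ultimately have "bicocycle 0 (Suc k) (\<lambda>x. x 0 \<odot>\<^bsub>I (Suc k)\<^esub> z)" by (simp add: bicocycle_def)
    then obtain c where c: "c \<in> carrier (free_module R r)"
      and b: "bicoboundary 0 (Suc k) (\<lambda>x. x 0 \<odot>\<^bsub>I (Suc k)\<^esub> z \<ominus>\<^bsub>I (Suc k)\<^esub> L c x)" using L(3) by blast
    from b obtain h where h: "linear_map R (F 0) (I k) h"
      "\<And>x. x \<in> carrier (F (Suc 0)) \<Longrightarrow> h (d 0 x) = \<zero>\<^bsub>I k\<^esub>"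
      "\<And>x. x \<in> carrier (F 0) \<Longrightarrow> x 0 \<odot>\<^bsub>I (Suc k)\<^esub> z \<ominus>\<^bsub>I (Suc k)\<^esub> L c x = \<delta> k (h x)"
      by (auto simp: bicoboundary_def)
    have cR: "c q \<in> carrier R" if "q < r" for q using free_module_coord[OF c that] .
    have "L c ?e = lincomb (I (Suc k)) a c r"
      using linear_map_lincomb[OF ev free_module I_module, of r "std_basis R r" c] cR
        free_module_expand[OF c] by (simp add: a_def[abs_def])
    moreover have "?e 0 = \<one>" by (simp add: std_basis_def)
    ultimately have "z \<ominus>\<^bsub>I (Suc k)\<^esub> lincomb (I (Suc k)) a c r = \<delta> k (h ?e)"
      using h(3)[OF eF] zT(1) by simp
    moreover have "lincomb (I (Suc k)) a c r \<in> carrier (I (Suc k))"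
      using a_tc cR by (intro I.lincomb_closed) (auto simp: torsion_cocycles_def torsion_def)
    ultimately have "z = lincomb (I (Suc k)) a c r \<oplus>\<^bsub>I (Suc k)\<^esub> \<delta> k (h ?e)"
      using I.minus_plus_cancel[OF zT(1)] by metis
    moreover have "h ?e \<in> torsion J k"
      using kill[OF h(1,2)] linear_mapD(1)[OF h(1) eF] by (simp add: torsion_def)
    ultimately show ?thesis using cR by blast
  qed
  thus ?thesis using a_tc by blast
qed

text \<open>Descending induction on k, with noetherian induction on J inside. Ideals larger than J
  are treated in the same degree, ideals of the next degree up without restriction; the latter is
  what the prime cases use.\<close>

lemma locally_exact_all:
  assumes chain: "regular_chain R A g X" "A \<subseteq> carrier R" and P: "P \<in> assoc_primes R X"
    and "g \<le> k" "ideal J R"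
  shows "locally_exact P J k"
proof -
  have pr: "primeideal P R" using P by (simp add: assoc_primes_def)
  note PI = primeD(1)[OF pr]
  have trivial: "locally_exact P J k"
    if J: "J \<subseteq> carrier R" and *: "\<And>z. z \<in> torsion_cocycles J (Suc k) \<Longrightarrow> \<exists>t\<in>carrier R. t \<notin> P \<and> t \<odot>\<^bsub>I (Suc k)\<^esub> z = \<zero>\<^bsub>I (Suc k)\<^esub>"
    for J k
    unfolding locally_exact_def
  proof
    fix z assume "z \<in> torsion_cocycles J (Suc k)"
    then obtain t where t: "t \<in> carrier R" "t \<notin> P" "t \<odot>\<^bsub>I (Suc k)\<^esub> z = \<zero>\<^bsub>I (Suc k)\<^esub>" using * by blast
    have "\<delta> k \<zero>\<^bsub>I k\<^esub> = t \<odot>\<^bsub>I (Suc k)\<^esub> z" unfolding t(3) by (rule \<delta>_zero)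
    thus "\<exists>t\<in>carrier R. t \<notin> P \<and> (\<exists>w\<in>torsion J k. \<delta> k w = t \<odot>\<^bsub>I (Suc k)\<^esub> z)"
      using t(1,2) submoduleD(2)[OF torsion_submodule[OF J]] by blast
  qed
  \<comment> \<open>m bounds the distance from k to the end of the injective resolution. At m = 0
    the module \<open>I (Suc k)\<close> is zero.\<close>
  have "\<forall>J. ideal J R \<longrightarrow> locally_exact P J k" if "K \<le> k + m" "g \<le> k" for m
    using that
  proof (induction m arbitrary: k)
    case 0
    show ?case
    proof (intro allI impI)
      fix J assume J: "ideal J R"
      show "locally_exact P J k"
      proof (rule trivial)
        show "J \<subseteq> carrier R" using idealD(1)[OF J] by blast
        fix z assume "z \<in> torsion_cocycles J (Suc k)"
        hence "z = \<zero>\<^bsub>I (Suc k)\<^esub>" using bounded[of "Suc k"] 0 by (auto simp: torsion_cocycles_def torsion_def)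
        thus "\<exists>t\<in>carrier R. t \<notin> P \<and> t \<odot>\<^bsub>I (Suc k)\<^esub> z = \<zero>\<^bsub>I (Suc k)\<^esub>"
          using primeD(2)[OF pr] by (intro bexI[of _ "\<one>"]) simp_all
      qed
    qed
  next
    case (Suc m)
    have IH: "locally_exact P J (Suc k)" if "ideal J R" for J
      using Suc.IH[of "Suc k"] Suc.prems that by simp
    show ?case
    proof (intro allI impI)
      fix J assume J: "ideal J R"
      show "locally_exact P J k"
        using noetherian J
      proof (induction J rule: noetherian_ideal_induct)
        case (step J)
        have JR: "J \<subseteq> carrier R" using idealD(1)[OF step(1)] by blast
        \<comment> \<open>Outside P an element of J kills all torsion. J = P is the associated
          prime, where the regular chain is used; a prime strictly inside P is left to Nakayama's
          lemma, and a nonprime ideal is split into two larger ones.\<close>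
        consider "\<not> J \<subseteq> P" | "J = P" | "J \<subset> P" "primeideal J R" | "J \<subset> P" "\<not> primeideal J R" by blast
        thus ?case
        proof cases
          case 1
          then obtain t where t: "t \<in> J" "t \<notin> P" by blast
          show ?thesis
          proof (rule trivial[OF JR])
            fix z assume "z \<in> torsion_cocycles J (Suc k)"
            thus "\<exists>t\<in>carrier R. t \<notin> P \<and> t \<odot>\<^bsub>I (Suc k)\<^esub> z = \<zero>\<^bsub>I (Suc k)\<^esub>"
              using t JR by (auto simp: torsion_cocycles_def torsion_def)
          qed
        next
          case 2
          show ?thesis unfolding 2
            by (rule locally_exact_assoc_prime[OF chain Suc.prems(2) P IH])
        next
          case 3
          then obtain y where y: "y \<in> P" "y \<notin> J" by blast
          have yR: "y \<in> carrier R" using idealD(1)[OF PI y(1)] .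
          have "colon R J y = J"
            using primeD(3)[OF 3(2) yR] y(2) colon_superset[OF step(1) yR] by (auto simp: colon_def)
          note div = torsion_cocycles_divisible[OF step(1) yR this IH[OF ideal_adjoin_ideal[OF step(1) yR]]]
          note TD = submoduleD[OF torsion_submodule[OF JR]]
          let ?Z = "torsion_cocycles J (Suc k)" and ?B = "\<delta> k ` torsion J k"
          have Z: "submodule ?Z R (I (Suc k))"
            by (rule I.submoduleI')
              (auto simp: torsion_cocycles_def \<delta>_zero \<delta>_add \<delta>_smult TD)
          have B: "submodule ?B R (I (Suc k))"
          proof (rule I.submoduleI')
            show "\<zero>\<^bsub>I (Suc k)\<^esub> \<in> ?B" using TD(2)[of k] \<delta>_zero[of k] by (metis imageI)
            show "?B \<subseteq> carrier (I (Suc k))" using TD(1) \<delta>_closed by blast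
            show "u \<oplus>\<^bsub>I (Suc k)\<^esub> v \<in> ?B" if "u \<in> ?B" "v \<in> ?B" for u v
              using that TD(1,3) by (auto simp flip: \<delta>_add)
            show "a \<odot>\<^bsub>I (Suc k)\<^esub> u \<in> ?B" if "a \<in> carrier R" "u \<in> ?B" for a u
              using that TD(1,4) by (auto simp flip: \<delta>_smult)
          qed
          obtain r a where a: "\<And>q. q < r \<Longrightarrow> a q \<in> ?Z"
            and gen: "\<And>z. z \<in> ?Z \<Longrightarrow> \<exists>c. (\<forall>q<r. c q \<in> carrier R) \<and>
              (\<exists>w\<in>torsion J k. z = lincomb (I (Suc k)) a c r \<oplus>\<^bsub>I (Suc k)\<^esub> \<delta> k w)"
            using torsion_cocycles_finitely_generated[OF step(1), of k] by blast
          have gen': "\<exists>s\<in>carrier R. s \<notin> P \<and> (\<exists>c b. (\<forall>q<r. c q \<in> carrier R) \<and> b \<in> ?B \<and>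
              s \<odot>\<^bsub>I (Suc k)\<^esub> z = lincomb (I (Suc k)) a c r \<oplus>\<^bsub>I (Suc k)\<^esub> b)" if z: "z \<in> ?Z" for z
          proof -
            have "\<one> \<odot>\<^bsub>I (Suc k)\<^esub> z = z" using submoduleD(1)[OF Z z] by simp
            moreover obtain c w where "\<forall>q<r. c q \<in> carrier R" "w \<in> torsion J k"
              "z = lincomb (I (Suc k)) a c r \<oplus>\<^bsub>I (Suc k)\<^esub> \<delta> k w" using gen[OF z] by blast
            ultimately show ?thesis using primeD(2)[OF pr]
              by (intro bexI[of _ "\<one>"] conjI exI[of _ c] exI[of _ "\<delta> k w"]) simp_all
          qed
          have "\<exists>s\<in>carrier R. s \<notin> P \<and> s \<odot>\<^bsub>I (Suc k)\<^esub> z \<in> ?B" if "z \<in> ?Z" for z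
            by (rule I.local_nakayama[OF pr y(1) Z B a gen' div that])
          thus ?thesis unfolding locally_exact_def by (metis (no_types, lifting) imageE)
        next
          case 4
          have "J \<noteq> carrier R" using 4(1) idealD(1)[OF PI] by blast
          then obtain a b where ab: "a \<in> carrier R" "b \<in> carrier R" "a \<otimes> b \<in> J" "a \<notin> J" "b \<notin> J"
            using not_primeE[OF step(1) 4(2)] by metis
          have "J \<subset> colon R J a" using colon_superset[OF step(1) ab(1)] ab by (auto simp: colon_def)
          moreover have "J \<subset> ideal_adjoin R J a"
            using ideal_adjoin_superset[OF step(1) ab(1)] ideal_adjoin_self[OF step(1) ab(1)] ab(4) by blast
          ultimately show ?thesis
            using step(2) colon_ideal[OF step(1) ab(1)] ideal_adjoin_ideal[OF step(1) ab(1)]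
            by (intro locally_exact_split[OF pr step(1) ab(1)]) simp_all
        qed
      qed
    qed
  qed
  from this[of K] assms(4,5) show ?thesis by simp
qed

end

section \<open>From cyclic modules to arbitrary ones, and the regular sequence in the
  annihilator\<close>

definition cohomology_annihilator ::
  "('a, 'm) ring_scheme \<Rightarrow> (nat \<Rightarrow> nat) \<Rightarrow> (nat \<Rightarrow> (nat \<Rightarrow> 'a) \<Rightarrow> (nat \<Rightarrow> 'a)) \<Rightarrow> nat \<Rightarrow> 'a set" where
  "cohomology_annihilator R n d j = {a \<in> carrier R. \<forall>f\<in>cocycles R (self_module R) n d j.
     a \<odot>\<^bsub>hom_module R (free_module R (n j)) (self_module R)\<^esub> f \<in> coboundaries R (self_module R) n d j}"

context gorenstein
begin

context
  fixes n d
  assumes exact: "free_exact R n d"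
begin

interpretation free_injective R n d I \<delta>
  by unfold_locales (rule exact)

text \<open>Vanishing at P passes from the cyclic modules R/J to the cokernel M of
  \<open>d 0\<close> along the filtration of M. The induction on q makes t f a boundary on the q-th
  submodule, with a primitive h defined on all of \<open>F 0\<close>.\<close>

lemma bicocycle_locally_zero:
  assumes P: "primeideal P R" and loc: "\<And>J. ideal J R \<Longrightarrow> locally_exact P J k"
    and f: "bicocycle 0 (Suc k) f"
  shows "\<exists>t\<in>carrier R. t \<notin> P \<and> bicoboundary 0 (Suc k) (\<lambda>x. t \<odot>\<^bsub>I (Suc k)\<^esub> f x)"
proof -
  let ?K = "d 0 ` carrier (F (Suc 0))" and ?e = "std_basis R (n 0)"
  let ?N = "free_filtration R (n 0) ?K"
  note N = free_filtration_submodule[OF image_submodule]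
  note ND = submoduleD[OF N]
  have fl: "linear_map R (F 0) (I (Suc k)) f" and fK: "\<And>x. x \<in> carrier (F (Suc 0)) \<Longrightarrow> f (d 0 x) = \<zero>\<^bsub>I (Suc k)\<^esub>"
    and f\<delta>: "\<And>x. x \<in> carrier (F 0) \<Longrightarrow> \<delta> (Suc k) (f x) = \<zero>\<^bsub>I (Suc (Suc k))\<^esub>"
    using f by (simp_all add: bicocycle_def)
  note fD = linear_mapD[OF fl]
  have "\<exists>t\<in>carrier R. t \<notin> P \<and> (\<exists>h. linear_map R (F 0) (I k) h \<and>
      (\<forall>x\<in>carrier (F (Suc 0)). h (d 0 x) = \<zero>\<^bsub>I k\<^esub>) \<and>
      (\<forall>x\<in>?N q. t \<odot>\<^bsub>I (Suc k)\<^esub> f x = \<delta> k (h x)))" for q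
  proof (induction q)
    case 0
    have "\<one> \<odot>\<^bsub>I (Suc k)\<^esub> f x = \<delta> k \<zero>\<^bsub>I k\<^esub>" if "x \<in> ?N 0" for x
      using that fK by (auto simp: free_filtration_0[OF image_submodule] \<delta>_zero)
    thus ?case using primeD(2)[OF P] linear_map_zero_fun[OF I_module, of "F 0" k]
      by (intro bexI[of _ "\<one>"] conjI exI[of _ "\<lambda>x. \<zero>\<^bsub>I k\<^esub>"]) simp_all
  next
    case (Suc q)
    then obtain t h where t: "t \<in> carrier R" "t \<notin> P" and h: "linear_map R (F 0) (I k) h"
      "\<And>x. x \<in> carrier (F (Suc 0)) \<Longrightarrow> h (d 0 x) = \<zero>\<^bsub>I k\<^esub>"
      "\<And>x. x \<in> ?N q \<Longrightarrow> t \<odot>\<^bsub>I (Suc k)\<^esub> f x = \<delta> k (h x)" by blast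
    note hD = linear_mapD[OF h(1)]
    \<comment> \<open>The remaining error vanishes on the q-th submodule. Its value at e_q is thus
      killed by the ideal \<open>?J\<close> that presents the next cyclic quotient, and is a
      boundary up to some s outside P.\<close>
    define g where "g x = t \<odot>\<^bsub>I (Suc k)\<^esub> f x \<ominus>\<^bsub>I (Suc k)\<^esub> \<delta> k (h x)" for x
    have g: "linear_map R (F 0) (I (Suc k)) g"
      unfolding g_def
      by (intro linear_map_minus_fun linear_map_smult_fun[OF fl t(1) I_module]
          linear_map_comp[OF h(1) \<delta>_linear] free_module I_module)
    note gD = linear_mapD[OF g]
    have gN: "g x = \<zero>\<^bsub>I (Suc k)\<^esub>" if "x \<in> ?N q" for x
      using h(3)[OF that] \<delta>_closed[OF hD(1)[OF ND(1)[OF that]]] by (simp add: g_def I.minus_eq_zero_iff)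
    have g\<delta>: "\<delta> (Suc k) (g x) = \<zero>\<^bsub>I (Suc (Suc k))\<^esub>" if x: "x \<in> carrier (F 0)" for x
      using \<delta>_minus[of "t \<odot>\<^bsub>I (Suc k)\<^esub> f x" "Suc k" "\<delta> k (h x)"] \<delta>_smult[OF t(1) fD(1)[OF x]] f\<delta>[OF x]
        \<delta>_\<delta>[OF hD(1)[OF x]] t(1) fD(1)[OF x] \<delta>_closed[OF hD(1)[OF x]] by (simp add: g_def)
    let ?J = "{r \<in> carrier R. r \<odot>\<^bsub>F 0\<^esub> ?e q \<in> ?N q}"
    have J: "ideal ?J R"
    proof (rule idealI')
      show "\<zero> \<in> ?J" using ND(2) by simp
      show "a \<oplus> b \<in> ?J" if "a \<in> ?J" "b \<in> ?J" for a b
        using that ND(3) by (simp add: F.smult_l_distr)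
      show "a \<otimes> b \<in> ?J" if "a \<in> carrier R" "b \<in> ?J" for a b
        using that ND(4) by (simp add: F.smult_assoc1)
    qed blast
    have "r \<odot>\<^bsub>I (Suc k)\<^esub> g (?e q) = \<zero>\<^bsub>I (Suc k)\<^esub>" if "r \<in> ?J" for r
      using that gD(3)[of r "?e q"] gN by simp
    hence "g (?e q) \<in> torsion_cocycles ?J (Suc k)"
      using gD(1)[OF std_basis_free] g\<delta>[OF std_basis_free] by (simp add: torsion_cocycles_def torsion_def)
    then obtain s w where s: "s \<in> carrier R" "s \<notin> P"
      and w: "w \<in> torsion ?J k" "\<delta> k w = s \<odot>\<^bsub>I (Suc k)\<^esub> g (?e q)"
      using loc[OF J] unfolding locally_exact_def by blast
    have wI: "w \<in> carrier (I k)" and wJ: "\<And>r. r \<in> ?J \<Longrightarrow> r \<odot>\<^bsub>I k\<^esub> w = \<zero>\<^bsub>I k\<^esub>"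
      using w(1) by (auto simp: torsion_def)
    \<comment> \<open>The correction h' sends y congruent to r e_q to r w. It is defined on the next
      submodule, is well defined because \<open>?J\<close> kills w, and extends to
      \<open>F 0\<close> by injectivity.\<close>
    let ?Q = "\<lambda>y u. \<exists>r\<in>carrier R. y \<ominus>\<^bsub>F 0\<^esub> r \<odot>\<^bsub>F 0\<^esub> ?e q \<in> ?N q \<and> u = r \<odot>\<^bsub>I k\<^esub> w"
    have Q0: "?Q y \<zero>\<^bsub>I k\<^esub>" if "y \<in> ?N q" for y
      using that ND(1)[OF that] wI by (intro bexI[of _ "\<zero>"]) simp_all
    obtain h' where h': "linear_map R (F 0) (I k) h'"
      "\<And>x u. x \<in> carrier (F 0) \<Longrightarrow> u \<in> carrier (I k) \<Longrightarrow> ?Q x u \<Longrightarrow> h' x = u"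
    proof (rule injective_extend[OF injective[of k], of ?Q "n 0"])
      show "?Q \<zero>\<^bsub>F 0\<^esub> \<zero>\<^bsub>I k\<^esub>" by (rule Q0[OF ND(2)])
    next
      fix x y u v assume x: "x \<in> carrier (F 0)" "y \<in> carrier (F 0)" and "?Q x u" "?Q y v"
      then obtain r r' where r: "r \<in> carrier R" "x \<ominus>\<^bsub>F 0\<^esub> r \<odot>\<^bsub>F 0\<^esub> ?e q \<in> ?N q" "u = r \<odot>\<^bsub>I k\<^esub> w"
        "r' \<in> carrier R" "y \<ominus>\<^bsub>F 0\<^esub> r' \<odot>\<^bsub>F 0\<^esub> ?e q \<in> ?N q" "v = r' \<odot>\<^bsub>I k\<^esub> w" by blast
      have "(x \<oplus>\<^bsub>F 0\<^esub> y) \<ominus>\<^bsub>F 0\<^esub> (r \<oplus> r') \<odot>\<^bsub>F 0\<^esub> ?e q =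
          (x \<ominus>\<^bsub>F 0\<^esub> r \<odot>\<^bsub>F 0\<^esub> ?e q) \<oplus>\<^bsub>F 0\<^esub> (y \<ominus>\<^bsub>F 0\<^esub> r' \<odot>\<^bsub>F 0\<^esub> ?e q)"
        using x r(1,4) by (simp add: F.smult_l_distr F.minus_eq F.minus_add F.a_ac)
      hence "(x \<oplus>\<^bsub>F 0\<^esub> y) \<ominus>\<^bsub>F 0\<^esub> (r \<oplus> r') \<odot>\<^bsub>F 0\<^esub> ?e q \<in> ?N q" using ND(3)[OF r(2,5)] by simp
      moreover have "u \<oplus>\<^bsub>I k\<^esub> v = (r \<oplus> r') \<odot>\<^bsub>I k\<^esub> w" using r(1,4) wI by (simp add: r(3,6) I.smult_l_distr)
      ultimately show "?Q (x \<oplus>\<^bsub>F 0\<^esub> y) (u \<oplus>\<^bsub>I k\<^esub> v)" using a_closed[OF r(1,4)] by blast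
    next
      fix a x u assume a: "a \<in> carrier R" and x: "x \<in> carrier (F 0)" and "?Q x u"
      then obtain r where r: "r \<in> carrier R" "x \<ominus>\<^bsub>F 0\<^esub> r \<odot>\<^bsub>F 0\<^esub> ?e q \<in> ?N q" "u = r \<odot>\<^bsub>I k\<^esub> w" by blast
      have "a \<odot>\<^bsub>F 0\<^esub> x \<ominus>\<^bsub>F 0\<^esub> (a \<otimes> r) \<odot>\<^bsub>F 0\<^esub> ?e q = a \<odot>\<^bsub>F 0\<^esub> (x \<ominus>\<^bsub>F 0\<^esub> r \<odot>\<^bsub>F 0\<^esub> ?e q)"
        using x a r(1) by (simp add: F.smult_minus_distr F.smult_assoc1)
      hence "a \<odot>\<^bsub>F 0\<^esub> x \<ominus>\<^bsub>F 0\<^esub> (a \<otimes> r) \<odot>\<^bsub>F 0\<^esub> ?e q \<in> ?N q" using ND(4)[OF a r(2)] by simp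
      moreover have "a \<odot>\<^bsub>I k\<^esub> u = (a \<otimes> r) \<odot>\<^bsub>I k\<^esub> w" using a r(1) wI by (simp add: r(3) I.smult_assoc1)
      ultimately show "?Q (a \<odot>\<^bsub>F 0\<^esub> x) (a \<odot>\<^bsub>I k\<^esub> u)" using m_closed[OF a r(1)] by blast
    next
      fix u assume "?Q \<zero>\<^bsub>F 0\<^esub> u"
      then obtain r where r: "r \<in> carrier R" "\<zero>\<^bsub>F 0\<^esub> \<ominus>\<^bsub>F 0\<^esub> r \<odot>\<^bsub>F 0\<^esub> ?e q \<in> ?N q" "u = r \<odot>\<^bsub>I k\<^esub> w" by blast
      have "\<zero>\<^bsub>F 0\<^esub> \<ominus>\<^bsub>F 0\<^esub> (\<zero>\<^bsub>F 0\<^esub> \<ominus>\<^bsub>F 0\<^esub> r \<odot>\<^bsub>F 0\<^esub> ?e q) \<in> ?N q"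
        by (rule F.submodule_minus[OF N ND(2) r(2)])
      moreover have "\<zero>\<^bsub>F 0\<^esub> \<ominus>\<^bsub>F 0\<^esub> (\<zero>\<^bsub>F 0\<^esub> \<ominus>\<^bsub>F 0\<^esub> r \<odot>\<^bsub>F 0\<^esub> ?e q) = r \<odot>\<^bsub>F 0\<^esub> ?e q"
        using r(1) by (simp add: F.minus_eq F.minus_minus)
      ultimately show "u = \<zero>\<^bsub>I k\<^esub>" using wJ r(1,3) by simp
    qed (use that in blast)
    note h'D = linear_mapD[OF h'(1)]
    have h'N: "h' y = \<zero>\<^bsub>I k\<^esub>" if "y \<in> ?N q" for y
      using h'(2)[OF ND(1)[OF that] I.zero_closed Q0[OF that]] .
    have sh: "linear_map R (F 0) (I k) (\<lambda>x. s \<odot>\<^bsub>I k\<^esub> h x)" by (rule linear_map_smult_fun[OF h(1) s(1) I_module])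
    \<comment> \<open>The old primitive is multiplied by s to match the new multiplier s t; the
      correction h' vanishes on the q-th submodule, hence on the boundaries.\<close>
    define H where "H x = h' x \<oplus>\<^bsub>I k\<^esub> s \<odot>\<^bsub>I k\<^esub> h x" for x
    have H: "linear_map R (F 0) (I k) H"
      unfolding H_def by (rule linear_map_add_fun[OF h'(1) sh I_module])
    have HK: "H (d 0 x) = \<zero>\<^bsub>I k\<^esub>" if x: "x \<in> carrier (F (Suc 0))" for x
    proof -
      have "d 0 x \<in> ?N q" using free_filtration_superset[OF image_submodule, of q] x by blast
      thus ?thesis using h'N h(2)[OF x] s(1) by (simp add: H_def)
    qed
    have HN: "(s \<otimes> t) \<odot>\<^bsub>I (Suc k)\<^esub> f y = \<delta> k (H y)" if y: "y \<in> ?N (Suc q)" for y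
    proof -
      have yF: "y \<in> carrier (F 0)" by (rule ND(1)[OF y])
      obtain r where r: "r \<in> carrier R" "y \<ominus>\<^bsub>F 0\<^esub> r \<odot>\<^bsub>F 0\<^esub> ?e q \<in> ?N q"
        using free_filtration_Suc[OF image_submodule y] by blast
      have gy: "g y \<in> carrier (I (Suc k))" and ge: "g (?e q) \<in> carrier (I (Suc k))"
        using gD(1) yF by simp_all
      have "g y \<ominus>\<^bsub>I (Suc k)\<^esub> r \<odot>\<^bsub>I (Suc k)\<^esub> g (?e q) = g (y \<ominus>\<^bsub>F 0\<^esub> r \<odot>\<^bsub>F 0\<^esub> ?e q)"
        using linear_map_minus[OF g free_module I_module yF, of "r \<odot>\<^bsub>F 0\<^esub> ?e q"] gD(3)[of r "?e q"] r(1) by simp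
      also have "\<dots> = \<zero>\<^bsub>I (Suc k)\<^esub>" by (rule gN[OF r(2)])
      finally have gyr: "g y = r \<odot>\<^bsub>I (Suc k)\<^esub> g (?e q)" using gy ge r(1) by (simp add: I.minus_eq_zero_iff)
      have "h' y = r \<odot>\<^bsub>I k\<^esub> w" using r wI by (intro h'(2)[OF yF]) auto
      hence "\<delta> k (h' y) = s \<odot>\<^bsub>I (Suc k)\<^esub> g y"
        using \<delta>_smult[OF r(1) wI] w(2) gyr I.smult_commute[OF r(1) s(1) ge] by simp
      moreover have "t \<odot>\<^bsub>I (Suc k)\<^esub> f y = g y \<oplus>\<^bsub>I (Suc k)\<^esub> \<delta> k (h y)"
        using t(1) fD(1)[OF yF] \<delta>_closed[OF hD(1)[OF yF]] by (simp add: g_def)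
      moreover have "(s \<otimes> t) \<odot>\<^bsub>I (Suc k)\<^esub> f y = s \<odot>\<^bsub>I (Suc k)\<^esub> (t \<odot>\<^bsub>I (Suc k)\<^esub> f y)"
        by (rule I.smult_assoc1[OF s(1) t(1) fD(1)[OF yF]])
      ultimately show ?thesis
        using s(1) gy hD(1)[OF yF] h'D(1)[OF yF] \<delta>_closed[OF hD(1)[OF yF]]
        by (simp add: H_def \<delta>_add \<delta>_smult I.smult_r_distr)
    qed
    have "s \<otimes> t \<notin> P" using primeD(3)[OF P s(1) t(1)] s(2) t(2) by blast
    thus ?case using H HK HN m_closed[OF s(1) t(1)] by blast
  qed
  from this[of "n 0"] obtain t h where "t \<in> carrier R" "t \<notin> P" "linear_map R (F 0) (I k) h"
    "\<forall>x\<in>carrier (F (Suc 0)). h (d 0 x) = \<zero>\<^bsub>I k\<^esub>"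
    "\<forall>x\<in>carrier (F 0). t \<odot>\<^bsub>I (Suc k)\<^esub> f x = \<delta> k (h x)"
    unfolding free_filtration_full[OF image_submodule] by blast
  thus ?thesis by (intro bexI[of _ t] conjI) (auto simp: bicoboundary_def)
qed

text \<open>The cocycle is carried by \<open>e\<close> to (k+1, 0), its vanishing at P is fetched
  from (0, k+1), and the primitive obtained lies in the kernel of \<open>\<delta> 0\<close>, so it
  comes back to R.\<close>

lemma cocycle_locally_coboundary:
  assumes P: "primeideal P R" and loc: "\<And>J. ideal J R \<Longrightarrow> locally_exact P J k"
    and f: "f \<in> cocycles R (self_module R) n d (Suc k)"
  shows "\<exists>t\<in>carrier R. t \<notin> P \<and>
    t \<odot>\<^bsub>hom_module R (F (Suc k)) (self_module R)\<^esub> f \<in> coboundaries R (self_module R) n d (Suc k)"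
proof -
  interpret H: module R "hom_module R (F (Suc k)) (self_module R)" by (rule hom_module) (rule free_module self_module)+
  have fH: "f \<in> module_hom R (F (Suc k)) (self_module R)"
    using f by (simp add: cocycles_iff[OF self_module exact])
  note fl = module_hom_linear_map[OF fH]
  have "\<exists>t\<in>carrier R. t \<notin> P \<and> bicoboundary (Suc k) 0 (\<lambda>x. t \<odot>\<^bsub>I 0\<^esub> e (f x))"
  proof (rule locally_zero_shift[OF _ bicocycle_e[OF exact f]])
    fix g assume "bicocycle 0 (Suc k + 0) g"
    thus "\<exists>t\<in>carrier R. t \<notin> P \<and> bicoboundary 0 (Suc k + 0) (\<lambda>x. t \<odot>\<^bsub>I (Suc k + 0)\<^esub> g x)"
      using bicocycle_locally_zero[OF P loc, of g] by simp
  qed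
  then obtain t h where t: "t \<in> carrier R" "t \<notin> P" and h: "linear_map R (F k) (I 0) h"
    "\<And>x. x \<in> carrier (F k) \<Longrightarrow> \<delta> 0 (h x) = \<zero>\<^bsub>I (Suc 0)\<^esub>"
    "\<And>x. x \<in> carrier (F (Suc k)) \<Longrightarrow> t \<odot>\<^bsub>I 0\<^esub> e (f x) = h (d k x)" by (auto simp: bicoboundary_def)
  obtain g where g: "linear_map R (F k) (self_module R) g" "\<And>x. x \<in> carrier (F k) \<Longrightarrow> e (g x) = h x"
    using factor_through_e[OF h(1,2)] by blast
  have "t \<otimes> f x = g (d k x)" if x: "x \<in> carrier (F (Suc k))" for x
  proof (rule e_eqD)
    show "t \<otimes> f x \<in> carrier R" "g (d k x) \<in> carrier R"
      using t(1) linear_form_closed[OF fl x] linear_form_closed[OF g(1) d_closed[OF x]] by simp_all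
    show "e (t \<otimes> f x) = e (g (d k x))"
      using h(3)[OF x] g(2)[OF d_closed[OF x]] e_smult[OF t(1) linear_form_closed[OF fl x]] by simp
  qed
  hence "t \<odot>\<^bsub>hom_module R (F (Suc k)) (self_module R)\<^esub> f \<in> coboundaries R (self_module R) n d (Suc k)"
    using H.smult_closed[OF t(1), of f] fH g(1) by (auto simp: coboundaries_Suc_iff[OF self_module exact])
  thus ?thesis using t by blast
qed

text \<open>Every cocycle is killed modulo coboundaries by some element outside P. As the cocycles
  are finitely generated, the product of the multipliers for the generators works for all of them at
  once.\<close>

lemma cohomology_annihilator_not_subset:
  assumes P: "primeideal P R" and loc: "\<And>J. ideal J R \<Longrightarrow> locally_exact P J k"
  shows "\<not> cohomology_annihilator R n d (Suc k) \<subseteq> P"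
proof -
  let ?H = "hom_module R (F (Suc k)) (self_module R)"
  let ?C = "cocycles R (self_module R) n d (Suc k)" and ?B = "coboundaries R (self_module R) n d (Suc k)"
  interpret H: module R ?H by (rule hom_module) (rule free_module self_module)+
  note C = cocycles_submodule[OF self_module exact, of "Suc k"]
  note B = coboundaries_submodule[OF self_module exact, of "Suc k"]
  note BD = submoduleD[OF B]
  obtain r L where L: "linear_map R (free_module R r) ?H L" "L ` carrier (free_module R r) = ?C"
    using hom_self_submodule_image[OF noetherian C] .
  let ?a = "\<lambda>q. L (std_basis R r q)"
  have aC: "?a q \<in> ?C" for q using L(2) std_basis_free by blast
  have aH: "?a q \<in> carrier ?H" for q using submoduleD(1)[OF C aC] .
  have "\<exists>t\<in>carrier R. t \<notin> P \<and> (\<forall>q<l. t \<odot>\<^bsub>?H\<^esub> ?a q \<in> ?B)" for l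
  proof (induction l)
    case 0 thus ?case using primeD(2)[OF P] by blast
  next
    case (Suc l)
    then obtain t where t: "t \<in> carrier R" "t \<notin> P" "\<And>q. q < l \<Longrightarrow> t \<odot>\<^bsub>?H\<^esub> ?a q \<in> ?B" by blast
    obtain s where s: "s \<in> carrier R" "s \<notin> P" "s \<odot>\<^bsub>?H\<^esub> ?a l \<in> ?B"
      using cocycle_locally_coboundary[OF P loc aC] by blast
    have "(s \<otimes> t) \<odot>\<^bsub>?H\<^esub> ?a q \<in> ?B" if q: "q < Suc l" for q
    proof (cases "q = l")
      case True
      have "(s \<otimes> t) \<odot>\<^bsub>?H\<^esub> ?a l = t \<odot>\<^bsub>?H\<^esub> (s \<odot>\<^bsub>?H\<^esub> ?a l)"
        using H.smult_assoc1[OF s(1) t(1) aH] H.smult_commute[OF s(1) t(1) aH] by (rule trans)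
      thus ?thesis using BD(4)[OF t(1) s(3)] True by simp
    next
      case False
      hence "t \<odot>\<^bsub>?H\<^esub> ?a q \<in> ?B" using t(3) q by simp
      thus ?thesis unfolding H.smult_assoc1[OF s(1) t(1) aH] by (rule BD(4)[OF s(1)])
    qed
    moreover have "s \<otimes> t \<notin> P" using primeD(3)[OF P s(1) t(1)] s(2) t(2) by blast
    ultimately show ?case using m_closed[OF s(1) t(1)] by blast
  qed
  then obtain t where t: "t \<in> carrier R" "t \<notin> P" "\<And>q. q < r \<Longrightarrow> t \<odot>\<^bsub>?H\<^esub> ?a q \<in> ?B" by blast
  let ?T = "{f \<in> carrier ?H. t \<odot>\<^bsub>?H\<^esub> f \<in> ?B}"
  have T: "submodule ?T R ?H"
  proof (rule H.submoduleI')
    show "\<zero>\<^bsub>?H\<^esub> \<in> ?T" using BD(2) H.smult_r_null[OF t(1)] H.zero_closed by (simp del: hom_module_simps)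
    show "f \<oplus>\<^bsub>?H\<^esub> g \<in> ?T" if "f \<in> ?T" "g \<in> ?T" for f g
      using that BD(3) t(1) by (simp add: H.smult_r_distr del: hom_module_simps)
    show "a \<odot>\<^bsub>?H\<^esub> f \<in> ?T" if "a \<in> carrier R" "f \<in> ?T" for a f
      using that BD(4) t(1) H.smult_commute[of t a f] by (simp del: hom_module_simps)
  qed blast
  have "t \<odot>\<^bsub>?H\<^esub> f \<in> ?B" if f: "f \<in> ?C" for f
  proof -
    obtain c where c: "c \<in> carrier (free_module R r)" "f = L c" using L(2) f by blast
    have cR: "c q \<in> carrier R" if "q < r" for q using free_module_coord[OF c(1) that] .
    have "f = lincomb ?H ?a c r"
      using linear_map_lincomb[OF L(1) free_module H.module_axioms, of r "std_basis R r" c] cR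
        free_module_expand[OF c(1)] c(2) by simp
    moreover have "lincomb ?H ?a c r \<in> ?T"
      using t(3) aH cR by (intro H.lincomb_submodule[OF T]) simp_all
    ultimately show ?thesis by blast
  qed
  hence "t \<in> cohomology_annihilator R n d (Suc k)" using t(1) by (simp add: cohomology_annihilator_def)
  thus ?thesis using t(2) by blast
qed

lemma cohomology_annihilator_ideal: "ideal (cohomology_annihilator R n d j) R"
proof (rule idealI')
  let ?H = "hom_module R (F j) (self_module R)"
  interpret H: module R ?H by (rule hom_module) (rule free_module self_module)+
  note CD = submoduleD[OF cocycles_submodule[OF self_module exact, of j]]
  note BD = submoduleD[OF coboundaries_submodule[OF self_module exact, of j]]
  show "cohomology_annihilator R n d j \<subseteq> carrier R" by (auto simp: cohomology_annihilator_def)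
  show "\<zero> \<in> cohomology_annihilator R n d j"
    using BD(2) H.smult_l_null[OF CD(1)] by (simp add: cohomology_annihilator_def del: hom_module_simps)
  show "a \<oplus> b \<in> cohomology_annihilator R n d j"
    if "a \<in> cohomology_annihilator R n d j" "b \<in> cohomology_annihilator R n d j" for a b
    using that BD(3) H.smult_l_distr[OF _ _ CD(1)] by (simp add: cohomology_annihilator_def del: hom_module_simps)
  show "a \<otimes> b \<in> cohomology_annihilator R n d j"
    if "a \<in> carrier R" "b \<in> cohomology_annihilator R n d j" for a b
    using that BD(4) H.smult_assoc1[OF _ _ CD(1)] by (simp add: cohomology_annihilator_def del: hom_module_simps)
qed

lemma cohomology_annihilator_regular_chain:
  "\<exists>X. regular_chain R (cohomology_annihilator R n d i) i X"
proof (cases i)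
  case 0
  show ?thesis unfolding 0 by (blast intro: regular_chain.zero)
next
  case (Suc k)
  let ?A = "cohomology_annihilator R n d (Suc k)"
  have A: "ideal ?A R" by (rule cohomology_annihilator_ideal)
  have AR: "?A \<subseteq> carrier R" using idealD(1)[OF A] by blast
  have "\<exists>X. regular_chain R ?A g X" if "g \<le> Suc k" for g
    using that
  proof (induction g)
    case 0 show ?case by (blast intro: regular_chain.zero)
  next
    case (Suc g)
    then obtain X where X: "regular_chain R ?A g X" by auto
    have XI: "ideal X R" by (rule regular_chain_ideal[OF X AR])
    \<comment> \<open>As long as the chain has length g at most k, Ext^(k+1) vanishes at each
      associated prime P of R/X, so its annihilator is not inside P and contributes a further
      regular element.\<close>
    have "\<not> ?A \<subseteq> P" if P: "P \<in> assoc_primes R X" for P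
    proof (rule cohomology_annihilator_not_subset)
      show "primeideal P R" using P by (simp add: assoc_primes_def)
      show "locally_exact P J k" if "ideal J R" for J
        using Suc.prems by (intro locally_exact_all[OF X AR P _ that]) simp
    qed
    then obtain a where "a \<in> ?A" "colon R X a = X"
      using regular_element_or_assoc_prime[OF noetherian XI A] by blast
    thus ?case using regular_chain.Suc[OF X] by blast
  qed
  thus ?thesis unfolding Suc by blast
qed

end

end


section \<open>Associated primes of iterated Ext modules\<close>

definition module_annihilator ::
  "('a, 'm) ring_scheme \<Rightarrow> ('a, 'b, 'n) module_scheme \<Rightarrow> 'a set" where
  "module_annihilator R M = {a \<in> carrier R. \<forall>x\<in>carrier M. a \<odot>\<^bsub>M\<^esub> x = \<zero>\<^bsub>M\<^esub>}"

lemma coker_annihilator_resolution: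
  assumes "module R M" "free_resolution R M n d e"
  shows "coker_annihilator R n d = module_annihilator R M"
proof -
  interpret module R M by fact
  interpret F: module R "free_module R (n 0)" by (rule R.free_module)
  have e: "linear_map R (free_module R (n 0)) M e" "e ` carrier (free_module R (n 0)) = carrier M"
    "d 0 ` carrier (free_module R (n 1)) = a_kernel (free_module R (n 0)) M e"
    using assms(2) by (simp_all add: free_resolution_iff module_hom_linear_map)
  have "a \<odot>\<^bsub>free_module R (n 0)\<^esub> x \<in> a_kernel (free_module R (n 0)) M e \<longleftrightarrow> a \<odot>\<^bsub>M\<^esub> e x = \<zero>\<^bsub>M\<^esub>"
    if "a \<in> carrier R" "x \<in> carrier (free_module R (n 0))" for a x
    using that linear_mapD(3)[OF e(1) that] by (simp add: a_kernel_iff)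
  thus ?thesis
    unfolding coker_annihilator_def module_annihilator_def e(3) e(2)[symmetric] by auto
qed

text \<open>Collects what one application of Ext yields: the facts about associated primes and
  annihilators of this step, and the two properties that allow the next application.\<close>

lemma (in cring) Ext_step:
  assumes "noetherian_ring R" "module R M" "\<exists>n d e. free_resolution R M n d e" "i \<ge> 0"
  obtains n d where "free_exact R n d" "coker_annihilator R n d = module_annihilator R M"
    "Ext R i M (self_module R) = hom_cohomology R (self_module R) n d (nat i)"
    "module_annihilator R (Ext R i M (self_module R)) = cohomology_annihilator R n d (nat i)"
    "module R (Ext R i M (self_module R))"
    "\<exists>n d e. free_resolution R (Ext R i M (self_module R)) n d e"
proof -
  obtain n d e where res: "free_resolution R M n d e"
    and ext: "Ext R i M (self_module R) = hom_cohomology R (self_module R) n d (nat i)"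
    using Ext_eq_hom_cohomology[OF assms(4,3)] .
  have exact: "free_exact R n d" using res by (simp add: free_resolution_iff)
  have mod: "module R (hom_cohomology R (self_module R) n d (nat i))"
    by (rule hom_cohomology_module[OF self_module exact])
  obtain m u where u: "linear_map R (free_module R m) (hom_cohomology R (self_module R) n d (nat i)) u"
    "u ` carrier (free_module R m) = carrier (hom_cohomology R (self_module R) n d (nat i))"
    using hom_cohomology_image[OF assms(1) exact] .
  show thesis
  proof (rule that[OF exact coker_annihilator_resolution[OF assms(2) res] ext])
    show "module_annihilator R (Ext R i M (self_module R)) = cohomology_annihilator R n d (nat i)"
      unfolding ext module_annihilator_def cohomology_annihilator_def
      using hom_cohomology_annihilator[OF self_module exact] by (intro Collect_cong conj_cong refl)
    show "module R (Ext R i M (self_module R))" unfolding ext by (rule mod)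
    show "\<exists>n d e. free_resolution R (Ext R i M (self_module R)) n d e"
      unfolding ext by (rule module.free_resolution_exists[OF mod assms(1) u])
  qed
qed

lemma gorenstein_local_ring_resolution:
  assumes "gorenstein_local_ring TYPE('c) R"
  obtains I :: "nat \<Rightarrow> ('a, 'c) module" and \<delta> e K where "gorenstein (R :: ('a, 'm) ring_scheme) I \<delta> e K"
proof -
  have cr: "cring R" and noeth: "noetherian_ring R"
    using assms by (simp_all add: gorenstein_local_ring_def local_ring_def)
  obtain I :: "nat \<Rightarrow> ('a, 'c) module" and \<delta> e k where *:
    "\<And>j. injective_module R (I j)" "e \<in> module_hom R (self_module R) (I 0)"
    "\<And>j. \<delta> j \<in> module_hom R (I j) (I (Suc j))" "inj_on e (carrier (self_module R))"
    "e ` carrier (self_module R) = a_kernel (I 0) (I 1) (\<delta> 0)"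
    "\<And>j. \<delta> j ` carrier (I j) = a_kernel (I (Suc j)) (I (Suc (Suc j))) (\<delta> (Suc j))"
    "\<And>j. j > k \<Longrightarrow> carrier (I j) = {\<zero>\<^bsub>I j\<^esub>}"
    using assms unfolding gorenstein_local_ring_def finite_injective_dimension_def by blast
  have "gorenstein R I \<delta> e k"
  proof (intro gorenstein.intro injective_complex.intro injective_complex_axioms.intro gorenstein_axioms.intro)
    show "cring R" by (rule cr)
    show "noetherian_ring R" by (rule noeth)
    show "injective_module R (I j)" for j by (rule *(1))
    show "linear_map R (I j) (I (Suc j)) (\<delta> j)" for j by (rule module_hom_linear_map[OF *(3)])
    show "\<delta> j ` carrier (I j) = a_kernel (I (Suc j)) (I (Suc (Suc j))) (\<delta> (Suc j))" for j by (rule *(6))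
    show "linear_map R (self_module R) (I 0) e" by (rule module_hom_linear_map[OF *(2)])
    show "inj_on e (carrier R)" using *(4) by simp
    show "e ` carrier R = a_kernel (I 0) (I (Suc 0)) (\<delta> 0)" using *(5) by simp
    show "carrier (I j) = {\<zero>\<^bsub>I j\<^esub>}" if "j > k" for j using *(7)[OF that] .
  qed
  thus thesis by (rule that)
qed

text \<open>In a zero module every element has annihilator R, which is not prime.\<close>

lemma Ass_Ext_neg:
  assumes "i < 0"
  shows "Ass R (Ext R i M N) = {}"
proof -
  have "P \<notin> Ass R (Ext R i M N)" for P
  proof
    assume "P \<in> Ass R (Ext R i M N)"
    hence "primeideal P R" "P = carrier R" using assms by (auto simp: Ass_def Ext_def)
    thus False using primeideal.I_notcarr by blast
  qed
  thus ?thesis by blast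
qed

theorem corollary3p12:
  fixes R :: "('a, 'm) ring_scheme" and M :: "('a, 'b, 'n) module_scheme" and i :: int
  assumes "gorenstein_local_ring TYPE('c) R"
    and "finitely_generated_module R M"
  shows "(\<Union>p. Ass_iterated_Ext R i M p) = (\<Union>p\<in>{0..3}. Ass_iterated_Ext R i M p)"
proof -
  let ?S = "self_module R"
  \<comment> \<open>The index is shifted: \<open>N q\<close> is the iterated Ext module with p = q +
    1, so that all \<open>N q\<close> have elements of one type.\<close>
  define N where "N q = ((\<lambda>N. Ext R i N ?S) ^^ q) (Ext R i M ?S)" for q
  have N_0: "N 0 = Ext R i M ?S" and N_Suc: "N (Suc q) = Ext R i (N q) ?S" for q by (simp_all add: N_def)
  have Ass_Suc: "Ass_iterated_Ext R i M (Suc q) = Ass R (N q)" for q by (simp add: Ass_iterated_Ext_def N_def)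
  have sub: "Ass R (N (Suc (Suc q))) \<subseteq> Ass R (N (Suc q))" for q
  proof (cases "i < 0")
    case True
    thus ?thesis by (simp add: N_Suc Ass_Ext_neg)
  next
    case False
    hence i: "i \<ge> 0" by simp
    obtain I :: "nat \<Rightarrow> ('a, 'c) module" and \<delta> e K where "gorenstein R I \<delta> e K"
      using gorenstein_local_ring_resolution[OF assms(1)] .
    then interpret gorenstein R I \<delta> e K .
    have M: "module R M" "\<exists>n d e. free_resolution R M n d e"
      using assms(2) finitely_generated_free_resolution[OF noetherian assms(2)]
      by (simp_all add: finitely_generated_module_def)
    obtain n d where nd: "free_exact R n d" "module_annihilator R (N 0) = cohomology_annihilator R n d (nat i)"
      and N0: "module R (N 0)" "\<exists>n d e. free_resolution R (N 0) n d e"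
      unfolding N_0 by (rule Ext_step[OF noetherian M i])
    \<comment> \<open>The chain is taken once, inside the annihilator of \<open>N 0\<close>. The
      same X describes the associated primes at every later stage.\<close>
    obtain X where X: "regular_chain R (module_annihilator R (N 0)) (nat i) X"
      unfolding nd(2) using cohomology_annihilator_regular_chain[OF nd(1)] by blast
    have N: "module R (N q) \<and> (\<exists>n d e. free_resolution R (N q) n d e)" for q
    proof (induction q)
      case (Suc q)
      show ?case unfolding N_Suc
        by (rule Ext_step[OF noetherian conjunct1[OF Suc] conjunct2[OF Suc] i]) (intro conjI; assumption)
    qed (use N0 in blast)
    have ann_mono: "module_annihilator R (N q) \<subseteq> module_annihilator R (N (Suc q))"
      \<comment> \<open>The premise states that the chain lies in the annihilator of
        \<open>N q\<close>. It is supplied for all q by \<open>ann\<close>, after monotonicity has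
        been established.\<close>
      and Ass_eq: "module_annihilator R (N 0) \<subseteq> module_annihilator R (N q) \<Longrightarrow>
        Ass R (N (Suc q)) = {P \<in> assoc_primes R X. module_annihilator R (N q) \<subseteq> P}" for q
    proof -
      obtain n d where nd: "free_exact R n d" "coker_annihilator R n d = module_annihilator R (N q)"
        "N (Suc q) = hom_cohomology R ?S n d (nat i)"
        "module_annihilator R (N (Suc q)) = cohomology_annihilator R n d (nat i)"
        unfolding N_Suc by (rule Ext_step[OF noetherian conjunct1[OF N[of q]] conjunct2[OF N[of q]] i])
      interpret free_exact_complex R n d by unfold_locales (rule nd(1))
      show "module_annihilator R (N q) \<subseteq> module_annihilator R (N (Suc q))"
        unfolding nd(4) nd(2)[symmetric] cohomology_annihilator_def
        using annihilator_cohomology by (auto simp: coker_annihilator_def)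
      show "Ass R (N (Suc q)) = {P \<in> assoc_primes R X. module_annihilator R (N q) \<subseteq> P}"
        if "module_annihilator R (N 0) \<subseteq> module_annihilator R (N q)"
        unfolding nd(3) nd(2)[symmetric]
        by (rule Ass_hom_cohomology_regular_chain[OF X]) (simp add: nd(2) that)
    qed
    have ann: "module_annihilator R (N 0) \<subseteq> module_annihilator R (N q)" for q
      by (rule lift_Suc_mono_le[of "\<lambda>q. module_annihilator R (N q)", OF ann_mono]) simp
    show ?thesis unfolding Ass_eq[OF ann] using ann_mono[of q] by blast
  qed
  have sub1: "Ass R (N (Suc q)) \<subseteq> Ass R (N (Suc 0))" for q
    by (induction q) (use sub in blast)+
  have "Ass_iterated_Ext R i M p \<subseteq> (\<Union>p\<in>{0..3}. Ass_iterated_Ext R i M p)" for p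
  proof (cases "p \<le> 3")
    case True thus ?thesis by auto
  next
    case False
    \<comment> \<open>The term with index p is \<open>N (Suc q)\<close>; it is compared with
      \<open>N (Suc 0)\<close>, which is the term p = 2.\<close>
    then obtain q where "p = Suc (Suc q)" by (metis Suc_le_eq not_less_eq_eq numeral_3_eq_3 old.nat.exhaust le0)
    hence "Ass_iterated_Ext R i M p \<subseteq> Ass_iterated_Ext R i M (Suc (Suc 0))"
      using sub1[of q] by (simp only: Ass_Suc)
    moreover have "Suc (Suc 0) \<in> {0..3}" by simp
    ultimately show ?thesis by blast
  qed
  thus ?thesis by blast
qed

end
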